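(* Let $\lambda,\mu\in\Lambda^+(n,r)$ and $\nu\in\Lambda^+(n)$. Put $g=\ell(\nu)$ (with $g\ge 1$) and $m=\ell(\mu)$. Suppose $\lambda\in P(\mu)$, $\mu\in\Lambda^+(n)_g$ and $g<m$. For each nonnegative integer $k$ let $$d_k=\dim_K\mathrm{Hom}_G(\Delta(\lambda+k\nu),\Delta(\mu+k\nu)).$$ Then the sequence $d_p,d_{p^2},d_{p^3},\dots$ eventually stabilizes, i.e. it is eventually constant.
   Context: $K$ is an infinite field of characteristic $p>0$, $G=GL_n(K)$, $r$ a positive integer. $\Lambda(n,r)$ is the set of sequences $(\alpha_1,\dots,\alpha_n)$ of nonnegative integers with sum $r$; $\Lambda^+(n,r)$ is the subset of partitions (weakly decreasing sequences); $\Lambda^+(n)$ is the set of all partitions $(\nu_1\ge\dots\ge\nu_n\ge0)$. $\ell(\mu)$ is the number of nonzero parts of $\mu$. $k\nu=(k\nu_1,\dots,k\nu_n)$, and addition is componentwise. $\Delta(\mu)$ is the Weyl module of $G$ corresponding to the partition $\mu$. $P(\mu)$: let $m=\ell(\mu)$. If $m=1$, $P(\mu)=\Lambda(n,r)$; if $m\ge2$, $P(\mu)$ consists of all $\alpha\in\Lambda(n,r)$ with $\mu_1+\dots+\mu_{i-2}+\mu_i\le\alpha_1+\dots+\alpha_{i-1}$ for all $i=2,\dots,m$. $\Lambda^+(n)_g$, $1\le g\le n$: $\Lambda^+(n)_1=\Lambda^+(n)$, and for $g\ge2$, $\Lambda^+(n)_g=\{\mu\in\Lambda^+(n):\mu_{j-1}\le\mu_j+\mu_{j+1},\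 j=2,\dots,g\}$, with $\mu_{n+1}=0$. *)

theory Defs
  imports
    "HOL-Library.Function_Algebras"
    "HOL-Library.FuncSet"
    "HOL-Combinatorics.Permutations"
    "HOL-Computational_Algebra.Computational_Algebra"
    "Jordan_Normal_Form.Matrix"
begin

section \<open>Compositions and partitions\<close>

text \<open>
  A sequence \<open>(\<alpha>\<^sub>1, \<dots>, \<alpha>\<^sub>n)\<close> is a function \<open>\<alpha> :: nat \<Rightarrow> nat\<close> vanishing outside \<open>{1..n}\<close>;
  in particular \<open>\<alpha> (n + 1) = 0\<close>.
\<close>

definition compositions :: "nat \<Rightarrow> nat \<Rightarrow> (nat \<Rightarrow> nat) set" where
  "compositions n r = {\<alpha>. (\<forall>i. i \<notin> {1..n} \<longrightarrow> \<alpha> i = 0) \<and> (\<Sum>i=1..n. \<alpha> i) = r}"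

definition partitions :: "nat \<Rightarrow> (nat \<Rightarrow> nat) set" where
  "partitions n = {\<nu>. (\<forall>i. i \<notin> {1..n} \<longrightarrow> \<nu> i = 0) \<and> antimono_on {1..n} \<nu>}"

definition partitions_of :: "nat \<Rightarrow> nat \<Rightarrow> (nat \<Rightarrow> nat) set" where
  "partitions_of n r = compositions n r \<inter> partitions n"

definition num_parts :: "(nat \<Rightarrow> nat) \<Rightarrow> nat" where
  "num_parts \<mu> = card {i. \<mu> i \<noteq> 0}"

definition P_set :: "nat \<Rightarrow> nat \<Rightarrow> (nat \<Rightarrow> nat) \<Rightarrow> (nat \<Rightarrow> nat) set" where
  "P_set n r \<mu> =
     (if num_parts \<mu> = 1 then compositions n r
      else {\<alpha> \<in> compositions n r. \<forall>i\<in>{2..num_parts \<mu>}.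
              (\<Sum>j=1..i-2. \<mu> j) + \<mu> i \<le> (\<Sum>j=1..i-1. \<alpha> j)})"

definition partitions_g :: "nat \<Rightarrow> nat \<Rightarrow> (nat \<Rightarrow> nat) set" where
  "partitions_g n g =
     (if g = 1 then partitions n
      else {\<mu> \<in> partitions n. \<forall>j\<in>{2..g}. \<mu> (j - 1) \<le> \<mu> j + \<mu> (j + 1)})"

section \<open>Tensor powers of the natural module\<close>

definition young_diagram :: "(nat \<Rightarrow> nat) \<Rightarrow> (nat \<times> nat) set" where
  "young_diagram \<mu> = {(i, j). 1 \<le> j \<and> j \<le> \<mu> i}"

text \<open>
  Let \<open>V = K\<^sup>n\<close> with basis \<open>e\<^sub>0, \<dots>, e\<^sub>n\<^sub>-\<^sub>1\<close> (matrices are indexed from 0).  The factors of the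
  tensor power \<open>V\<^sup>\<otimes>\<^sup>r\<close> are indexed by the boxes of a Young diagram \<open>D\<close> of size \<open>r\<close>
  rather than by \<open>1, \<dots>, r\<close>.  Its basis consists of the
  tensors \<open>\<Otimes>\<^sub>b e\<^bsub>T b\<^esub>\<close> for the fillings \<open>T \<in> D \<rightarrow>\<^sub>E {..<n}\<close>, and an element of it is
  the function mapping each \<open>T\<close> to its coefficient.
\<close>

type_synonym filling = "nat \<times> nat \<Rightarrow> nat"
type_synonym 'k tensor = "filling \<Rightarrow> 'k"

definition fillings :: "nat \<Rightarrow> (nat \<Rightarrow> nat) \<Rightarrow> filling set" where
  "fillings n \<mu> = young_diagram \<mu> \<rightarrow>\<^sub>E {..<n}"

definition tensors :: "nat \<Rightarrow> (nat \<Rightarrow> nat) \<Rightarrow> 'k::field tensor set" where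
  "tensors n \<mu> = {x. \<forall>T. T \<notin> fillings n \<mu> \<longrightarrow> x T = 0}"

definition tensor_scale :: "'k::field \<Rightarrow> 'k tensor \<Rightarrow> 'k tensor" where
  "tensor_scale c x = (\<lambda>T. c * x T)"

definition GL :: "nat \<Rightarrow> 'k::field mat set" where
  "GL n = {A \<in> carrier_mat n n. invertible_mat A}"

text \<open>The diagonal action, coming from \<open>A e\<^sub>j = (\<Sum>i<n. A $$ (i, j) e\<^sub>i)\<close> on each factor.\<close>

definition GL_act :: "nat \<Rightarrow> (nat \<Rightarrow> nat) \<Rightarrow> 'k::field mat \<Rightarrow> 'k tensor \<Rightarrow> 'k tensor" where
  "GL_act n \<mu> A x = (\<lambda>T. if T \<in> fillings n \<mu>
     then \<Sum>S\<in>fillings n \<mu>. (\<Prod>b\<in>young_diagram \<mu>. A $$ (T b, S b)) * x S else 0)"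

section \<open>Weyl modules\<close>

definition row_perms :: "(nat \<Rightarrow> nat) \<Rightarrow> (nat \<times> nat \<Rightarrow> nat \<times> nat) set" where
  "row_perms \<mu> = {\<sigma>. \<sigma> permutes young_diagram \<mu> \<and> (\<forall>b. fst (\<sigma> b) = fst b)}"

definition col_perms :: "(nat \<Rightarrow> nat) \<Rightarrow> (nat \<times> nat \<Rightarrow> nat \<times> nat) set" where
  "col_perms \<mu> = {\<sigma>. \<sigma> permutes young_diagram \<mu> \<and> (\<forall>b. snd (\<sigma> b) = snd b)}"

text \<open>
  The tensors symmetric along the rows form \<open>D\<^bsub>\<mu>\<^sub>1\<^esub> V \<otimes> \<dots> \<otimes> D\<^bsub>\<mu>\<^sub>n\<^esub> V\<close>, the divided power \<open>D\<^sub>a V\<close>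
  being the invariants of the symmetric group in \<open>V\<^sup>\<otimes>\<^sup>a\<close>.
\<close>

definition row_symmetric :: "nat \<Rightarrow> (nat \<Rightarrow> nat) \<Rightarrow> 'k::field tensor set" where
  "row_symmetric n \<mu> = {x \<in> tensors n \<mu>. \<forall>\<sigma>\<in>row_perms \<mu>. \<forall>T. x (T \<circ> \<sigma>) = x T}"

definition col_antisymmetrize :: "(nat \<Rightarrow> nat) \<Rightarrow> 'k::field tensor \<Rightarrow> 'k tensor" where
  "col_antisymmetrize \<mu> x = (\<lambda>T. \<Sum>\<sigma>\<in>col_perms \<mu>. of_int (sign \<sigma>) * x (T \<circ> \<sigma>))"

text \<open>
  The Weyl module as defined by Akin, Buchsbaum and Weyman: the image of
  the composite \<open>D\<^bsub>\<mu>\<^sub>1\<^esub> V \<otimes> \<dots> \<otimes> D\<^bsub>\<mu>\<^sub>n\<^esub> V \<rightarrow> V\<^sup>\<otimes>\<^sup>r \<rightarrow> \<Lambda>\<^bsup>\<mu>'\<^sub>1\<^esup> V \<otimes> \<dots> \<otimes> \<Lambda>\<^bsup>\<mu>'\<^sub>s\<^esup> V\<close> of the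
  comultiplication along the rows and the multiplication along the columns, where \<open>\<mu>'\<close> is
  the conjugate partition.  Each
  exterior power is identified with its image under the comultiplication
  \<open>\<Lambda>\<^sup>a V \<rightarrow> V\<^sup>\<otimes>\<^sup>a\<close>, which maps \<open>v\<^sub>1 \<and> \<dots> \<and> v\<^sub>a\<close> to the signed sum of
  the permutations of \<open>v\<^sub>1 \<otimes> \<dots> \<otimes> v\<^sub>a\<close> and is injective in every characteristic.
\<close>

definition weyl_module :: "nat \<Rightarrow> (nat \<Rightarrow> nat) \<Rightarrow> 'k::field tensor set" where
  "weyl_module n \<mu> = col_antisymmetrize \<mu> ` row_symmetric n \<mu>"

section \<open>Homomorphisms\<close>

type_synonym 'k tensor_map = "'k tensor \<Rightarrow> 'k tensor"

definition map_scale :: "'k::field \<Rightarrow> 'k tensor_map \<Rightarrow> 'k tensor_map" where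
  "map_scale c \<phi> = (\<lambda>x. tensor_scale c (\<phi> x))"

global_interpretation tensor_map: vector_space map_scale
  by unfold_locales
    (auto simp: map_scale_def tensor_scale_def fun_eq_iff algebra_simps)

text \<open>
  A homomorphism out of the Weyl module is extended by 0 to all of \<^typ>\<open>'k tensor\<close>, so
  that it is determined by its values on the Weyl module.
\<close>

definition weyl_Hom :: "nat \<Rightarrow> (nat \<Rightarrow> nat) \<Rightarrow> (nat \<Rightarrow> nat) \<Rightarrow> 'k::field tensor_map set" where
  "weyl_Hom n \<alpha> \<beta> = {\<phi>.
     (\<forall>x\<in>weyl_module n \<alpha>. \<phi> x \<in> weyl_module n \<beta>) \<and>
     (\<forall>x. x \<notin> weyl_module n \<alpha> \<longrightarrow> \<phi> x = 0) \<and>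
     (\<forall>x\<in>weyl_module n \<alpha>. \<forall>y\<in>weyl_module n \<alpha>. \<phi> (x + y) = \<phi> x + \<phi> y) \<and>
     (\<forall>c. \<forall>x\<in>weyl_module n \<alpha>. \<phi> (tensor_scale c x) = tensor_scale c (\<phi> x)) \<and>
     (\<forall>A\<in>GL n. \<forall>x\<in>weyl_module n \<alpha>. \<phi> (GL_act n \<alpha> A x) = GL_act n \<beta> A (\<phi> x))}"

end

theory Submission
  imports Defs "Jordan_Normal_Form.Determinant"
begin

text \<open>
  A homomorphism from \<open>\<Delta>(\<lambda>)\<close> is determined by the image of the highest
  weight vector, because the orbit of that vector spans \<open>\<Delta>(\<lambda>)\<close>
  (\<open>weyl_module_eq_span_orbit\<close>). The vectors of \<open>\<Delta>(\<mu>)\<close> that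
  occur as images are the primitive ones: every invertible upper triangular matrix
  \<open>B\<close> acts on them by the scalar \<open>chi n \<lambda> B\<close>, the value at
  \<open>B\<close> of the character \<open>\<lambda>\<close>. That each primitive vector does
  occur rests on a polynomial form of the Borel--Weil theorem, valid over every infinite field
  (\<open>semi_invariants_spanned_by_bidets\<close>). The matrix coefficients of a primitive
  vector are polynomials \<open>f\<close> with \<open>f (A B) = chi n \<lambda> B * f A\<close>,
  and all such polynomials are combinations of bideterminants, which are the matrix coefficients
  of the highest weight vector itself. So the dimension in question is that of a space of
  primitive vectors (\<open>dim_weyl_Hom_eq_dim_primitive\<close>).

  To compare \<open>k\<close> with \<open>k + Q\<close>, let \<open>h\<close> be the product of
  leading principal minors that is the highest weight coefficient of
  \<open>\<Delta>(\<nu>)\<close>. Multiplication by \<open>h\<^sup>Q\<close> turns semi-invariants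
  of weight \<open>\<mu> + k\<nu>\<close> into semi-invariants of weight
  \<open>\<mu> + (k + Q)\<nu>\<close>. Dually there is a linear map from
  \<open>\<Delta>(\<mu> + (k + Q)\<nu>)\<close> to \<open>\<Delta>(\<mu> + k\<nu>)\<close> sending
  \<open>A v\<close> to \<open>h(A)\<^sup>Q A v'\<close>, where \<open>v\<close> and
  \<open>v'\<close> are the highest weight vectors. Two facts make it an injection between the
  spaces of primitive vectors (\<open>dim_primitive_decreasing\<close>).

  The map fails to commute with \<open>B\<close> only through the difference of
  \<open>h(B A)\<^sup>Q\<close> and \<open>(chi n \<nu> B * h(A))\<^sup>Q\<close>. If
  \<open>Q\<close> is a multiple of a large power \<open>q\<close> of the characteristic, then by
  the Frobenius map this difference only involves weights at height at least \<open>q\<close>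
  below the highest one, whereas the weight \<open>\<lambda> + k\<nu>\<close> of a primitive
  vector lies below \<open>\<mu> + k\<nu>\<close> at a height that is bounded independently of
  \<open>k\<close>. Hence primitive vectors go to primitive vectors.

  For injectivity, restrict semi-invariants to lower unitriangular matrices, where
  \<open>h\<close> is 1. Nothing is lost, and the part of weight \<open>\<lambda> + k\<nu>\<close>
  becomes a space of polynomials of bounded degree that grows with \<open>k\<close>. So this space
  is constant from some \<open>k\<close> on, multiplication by \<open>h\<^sup>Q\<close> is onto in
  the relevant degree, and the dual map is injective there.

  Consequently the dimension at \<open>p\<^bsup>a+1\<^esup>\<close> is at most the one at
  \<open>p\<^sup>a\<close> for all large \<open>a\<close>, and a decreasing sequence of natural
  numbers is eventually constant.
\<close>

section \<open>Vector spaces of functions\<close>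

definition fun_scale :: "'k::field \<Rightarrow> ('a \<Rightarrow> 'k) \<Rightarrow> 'a \<Rightarrow> 'k" where
  "fun_scale c f = (\<lambda>x. c * f x)"

global_interpretation fs: vector_space "fun_scale :: 'k::field \<Rightarrow> ('a \<Rightarrow> 'k) \<Rightarrow> _"
  by unfold_locales (auto simp: fun_scale_def fun_eq_iff algebra_simps)

lemma fun_sum_apply: "(\<Sum>a\<in>A. F a) x = (\<Sum>a\<in>A. F a x)"
  by (induction A rule: infinite_finite_induct) auto

lemma fs_subspaceI:
  assumes "(\<lambda>x. 0) \<in> S" "\<And>f g. f \<in> S \<Longrightarrow> g \<in> S \<Longrightarrow> (\<lambda>x. f x + g x) \<in> S"
    "\<And>c f. f \<in> S \<Longrightarrow> (\<lambda>x. c * f x) \<in> S"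
  shows "fs.subspace S"
  using assms by (auto simp: fs.subspace_def fun_scale_def plus_fun_def zero_fun_def)

lemma fs_span_add: "f \<in> fs.span S \<Longrightarrow> g \<in> fs.span S \<Longrightarrow> (\<lambda>x. f x + g x) \<in> fs.span S"
  using fs.span_add[of f S g] by (simp add: plus_fun_def)

lemma fs_span_diff: "f \<in> fs.span S \<Longrightarrow> g \<in> fs.span S \<Longrightarrow> (\<lambda>x. f x - g x) \<in> fs.span S"
  using fs.span_diff[of f S g] by (simp add: fun_diff_def)

lemma fs_span_scale: "f \<in> fs.span S \<Longrightarrow> (\<lambda>x. c * f x) \<in> fs.span S"
  using fs.span_scale[of f S c] by (simp add: fun_scale_def)

lemma fs_span_zero: "(\<lambda>x. 0) \<in> fs.span S"
  using fs.span_zero[of S] by (simp add: zero_fun_def)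

lemma fs_span_sum:
  assumes "\<And>a. a \<in> A \<Longrightarrow> F a \<in> fs.span S"
  shows "(\<lambda>x. \<Sum>a\<in>A. F a x) \<in> fs.span S"
proof -
  have "(\<Sum>a\<in>A. F a) \<in> fs.span S"
    using assms by (rule fs.span_sum)
  moreover have "(\<Sum>a\<in>A. F a) = (\<lambda>x. \<Sum>a\<in>A. F a x)"
    by (auto simp: fun_sum_apply)
  ultimately show ?thesis by simp
qed

lemma fs_span_mult:
  assumes "f \<in> fs.span A" "g \<in> fs.span B"
    and "\<And>a b. a \<in> A \<Longrightarrow> b \<in> B \<Longrightarrow> (\<lambda>x. a x * b x) \<in> fs.span C"
  shows "(\<lambda>x. f x * g x) \<in> fs.span C"
proof -
  have 1: "(\<lambda>x. a x * g x) \<in> fs.span C" if a: "a \<in> A" for a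
  proof -
    have "fs.span B \<subseteq> {g. (\<lambda>x. a x * g x) \<in> fs.span C}"
    proof (rule fs.span_minimal)
      show "fs.subspace {g. (\<lambda>x. a x * g x) \<in> fs.span C}"
        by (rule fs_subspaceI)
          (auto simp: algebra_simps fs_span_zero intro: fs_span_add dest: fs_span_scale)
    qed (use assms a in auto)
    then show ?thesis using assms by auto
  qed
  have "fs.span A \<subseteq> {f. (\<lambda>x. f x * g x) \<in> fs.span C}"
  proof (rule fs.span_minimal)
    show "fs.subspace {f. (\<lambda>x. f x * g x) \<in> fs.span C}"
      by (rule fs_subspaceI)
        (auto simp: algebra_simps fs_span_zero intro: fs_span_add dest: fs_span_scale)
  qed (use 1 in auto)
  then show ?thesis using assms by auto
qed

lemma fs_span_image_explicit:
  assumes "f \<in> fs.span (F ` S)"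
  obtains T c where "finite T" "T \<subseteq> S" "f = (\<lambda>x. \<Sum>a\<in>T. c a * F a x)"
proof -
  obtain t r where t: "finite t" "t \<subseteq> F ` S" "f = (\<Sum>a\<in>t. fun_scale (r a) a)"
    using assms unfolding fs.span_explicit by auto
  obtain T where T: "T \<subseteq> S" "inj_on F T" "t = F ` T"
    using t(2) by (auto simp: subset_image_inj)
  have "f x = (\<Sum>a\<in>T. r (F a) * F a x)" for x
    using T by (simp add: t(3) fun_sum_apply fun_scale_def sum.reindex)
  then show thesis
    using that[of T "\<lambda>a. r (F a)"] T(1) finite_imageD[OF t(1)[unfolded T(3)] T(2)] by blast
qed

text \<open>
  A functional on the whole function space restricts to a coordinate form
  \<open>y \<mapsto> \<Sum>i. g i * y i\<close> on functions supported in a finite set, and this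
  explicit form is what can be evaluated on polynomials.
\<close>

lemma separating_functional:
  fixes W :: "('a \<Rightarrow> 'k::field) set"
  assumes I: "finite I" and W: "fs.subspace W" and u: "u \<notin> W"
    and supp: "\<And>y i. y \<in> insert u W \<Longrightarrow> i \<notin> I \<Longrightarrow> y i = 0"
  obtains g where "\<And>y. y \<in> W \<Longrightarrow> (\<Sum>i\<in>I. g i * y i) = 0" "(\<Sum>i\<in>I. g i * u i) \<noteq> 0"
proof -
  interpret vp: vector_space_pair "fun_scale :: 'k \<Rightarrow> ('a \<Rightarrow> 'k) \<Rightarrow> _" "(*) :: 'k \<Rightarrow> 'k \<Rightarrow> 'k"
    by unfold_locales (auto simp: algebra_simps)
  obtain B where B: "B \<subseteq> W" "fs.independent B" "W \<subseteq> fs.span B"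
    using fs.maximal_independent_subset[of W] by auto
  have "fs.span B \<subseteq> W"
    using B W by (simp add: fs.span_minimal)
  then have "fs.independent (insert u B)"
    using u B(2) by (intro fs.independent_insertI) auto
  then obtain f where f: "Vector_Spaces.linear fun_scale (*) f"
      "\<forall>x\<in>insert u B. f x = (if x = u then 1 else 0)"
    using vp.linear_independent_extend[of "insert u B" "\<lambda>x. if x = u then 1 else 0"] by auto
  interpret f: Vector_Spaces.linear fun_scale "(*)" f by fact
  define e :: "'a \<Rightarrow> 'a \<Rightarrow> 'k" where "e i = (\<lambda>j. if j = i then 1 else 0)" for i
  have expand: "f y = (\<Sum>i\<in>I. f (e i) * y i)" if "y \<in> insert u W" for y
  proof -
    have "y = (\<Sum>i\<in>I. fun_scale (y i) (e i))"
      using supp[OF that] I by (auto simp: fun_eq_iff fun_sum_apply fun_scale_def e_def if_distrib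
          sum.delta cong: if_cong)
    then have "f y = f (\<Sum>i\<in>I. fun_scale (y i) (e i))" by simp
    also have "\<dots> = (\<Sum>i\<in>I. f (e i) * y i)"
      by (simp add: f.sum f.scale mult.commute)
    finally show ?thesis .
  qed
  have "f y = 0" if "y \<in> W" for y
  proof -
    have "\<forall>x\<in>B. f x = 0" using f(2) B(1) u by auto
    then show ?thesis
      using f.eq_0_on_span[of B y] B(3) that by auto
  qed
  then show thesis
    using that[of "\<lambda>i. f (e i)"] expand f(2) by (metis insertCI zero_neq_one)
qed

text \<open>
  The maps to which this is applied are additive and homogeneous only on a subspace, so the
  assumptions are confined to \<open>V\<close>. Finite dimension of \<open>W\<close> has to be
  assumed because \<open>dim\<close> is 0 on spaces of infinite dimension; it passes to
  \<open>V\<close>.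
\<close>

lemma dim_le_of_injective:
  fixes s1 :: "'k::field \<Rightarrow> 'b::ab_group_add \<Rightarrow> 'b" and s2 :: "'k \<Rightarrow> 'c::ab_group_add \<Rightarrow> 'c"
  assumes vs: "vector_space s1" "vector_space s2"
    and V: "module.subspace s1 V"
    and add: "\<And>x y. x \<in> V \<Longrightarrow> y \<in> V \<Longrightarrow> f (x + y) = f x + f y"
    and scale: "\<And>c x. x \<in> V \<Longrightarrow> f (s1 c x) = s2 c (f x)"
    and inj: "\<And>x. x \<in> V \<Longrightarrow> f x = 0 \<Longrightarrow> x = 0"
    and img: "\<And>x. x \<in> V \<Longrightarrow> f x \<in> W"
    and fin: "finite T" "W \<subseteq> module.span s2 T"
  shows "vector_space.dim s1 V \<le> vector_space.dim s2 W"
    and "\<exists>T'. finite T' \<and> V \<subseteq> module.span s1 T'"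
proof -
  interpret v1: vector_space s1 by fact
  interpret v2: vector_space s2 by fact
  interpret vp: vector_space_pair s1 s2 by unfold_locales
  obtain B where B: "B \<subseteq> V" "v1.independent B" "V \<subseteq> v1.span B" "card B = v1.dim V"
    using v1.basis_exists by metis
  have span: "v1.span B = V"
    using B V v1.span_minimal by blast
  obtain g where g: "Vector_Spaces.linear s1 s2 g" "\<forall>x\<in>B. g x = f x"
    using vp.linear_independent_extend[OF B(2)] by metis
  interpret g: Vector_Spaces.linear s1 s2 g by fact
  have gf: "x \<in> V \<and> g x = f x" if "x \<in> v1.span B" for x
    using that
  proof (induction rule: v1.span_induct_alt)
    case base
    have "f (s1 0 0) = s2 0 (f 0)"
      using scale[of 0 0] v1.subspace_0[OF V] by blast
    then show ?case using g.zero v1.subspace_0[OF V] by simp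
  next
    case (step c x y)
    then have "x \<in> V" "s1 c x \<in> V" using B(1) V v1.subspace_scale by auto
    then show ?case
      using step g(2) add[of "s1 c x" y] scale[of x c] V
      by (auto simp: g.add g.scale v1.subspace_add)
  qed
  have "inj_on g (v1.span B)"
  proof (rule inj_onI)
    fix x y assume xy: "x \<in> v1.span B" "y \<in> v1.span B" "g x = g y"
    then have "x - y \<in> v1.span B" "g (x - y) = 0" by (simp_all add: v1.span_diff g.diff)
    then have "x - y = 0" using gf[of "x - y"] inj[of "x - y"] by simp
    then show "x = y" by simp
  qed
  then have ind: "v2.independent (g ` B)" and injB: "inj_on g B"
    using g.independent_injective_image[OF B(2)] v1.span_superset[of B]
    by (blast, blast intro: inj_on_subset)
  have "g ` B \<subseteq> W" using g(2) B(1) img by auto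
  then obtain C where C: "g ` B \<subseteq> C" "C \<subseteq> W" "v2.independent C" "W \<subseteq> v2.span C"
    using v2.maximal_independent_subset_extend[OF _ ind, of W] by blast
  have fC: "finite C" using v2.independent_span_bound[OF fin(1) C(3)] C(2) fin(2) by auto
  have "card B = card (g ` B)" using injB by (simp add: card_image)
  also have "\<dots> \<le> card C" using fC C(1) by (simp add: card_mono)
  also have "card C = v2.dim W" using C by (simp add: v2.basis_card_eq_dim)
  finally show "v1.dim V \<le> v2.dim W" using B(4) by simp
  have "finite B" by (rule finite_imageD[OF finite_subset[OF C(1) fC] injB])
  then show "\<exists>T'. finite T' \<and> V \<subseteq> v1.span T'" using B by auto
qed

section \<open>Polynomial functions over an infinite field\<close>

definition mon_fun :: "'v set \<Rightarrow> ('v \<Rightarrow> nat) \<Rightarrow> ('v \<Rightarrow> 'k::comm_ring_1) \<Rightarrow> 'k" where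
  "mon_fun I M x = (\<Prod>i\<in>I. x i ^ M i)"

lemma poly_eq_0_if_infinite:
  fixes p :: "'k::field poly"
  assumes "infinite (UNIV :: 'k set)" "\<And>x. poly p x = 0"
  shows "p = 0"
  using poly_roots_finite[of p] assms by auto

text \<open>
  Induction on the set of variables: with the others fixed, the sum is a polynomial in one
  variable with infinitely many zeros, so each of its coefficients vanishes.
\<close>

lemma mon_independent:
  fixes c :: "('v \<Rightarrow> nat) \<Rightarrow> 'k::field"
  assumes inf: "infinite (UNIV :: 'k set)" and "finite I" and "finite S"
    and "\<And>M i. M \<in> S \<Longrightarrow> i \<notin> I \<Longrightarrow> M i = 0"
    and "\<And>x. (\<Sum>M\<in>S. c M * mon_fun I M x) = 0" and "M \<in> S"
  shows "c M = 0"
  using assms(2-)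
proof (induction I arbitrary: S c M rule: finite_induct)
  case empty
  have "S = {\<lambda>_. 0}" using empty.prems by (auto simp: fun_eq_iff) (metis ext)
  then show ?case using empty.prems(3)[of undefined] empty.prems(4) by (simp add: mon_fun_def)
next
  case (insert i I)
  define d where "d = M i"
  define S1 where "S1 = {M \<in> S. M i = d}"
  have 1: "(\<Sum>M\<in>S1. c M * mon_fun I M x) = 0" for x
  proof -
    define p where "p = (\<Sum>M\<in>S. Polynomial.monom (c M * mon_fun I M x) (M i))"
    have "poly p t = 0" for t
    proof -
      have "poly p t = (\<Sum>M\<in>S. c M * mon_fun (insert i I) M (x(i := t)))"
        unfolding p_def poly_sum
      proof (rule sum.cong[OF refl])
        fix M
        have "mon_fun (insert i I) M (x(i := t)) = t ^ M i * mon_fun I M x"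
          using insert.hyps by (simp add: mon_fun_def) (intro disjI2 prod.cong; auto)
        then show "poly (Polynomial.monom (c M * mon_fun I M x) (M i)) t
            = c M * mon_fun (insert i I) M (x(i := t))"
          by (simp add: poly_monom)
      qed
      then show ?thesis using insert.prems(3) by simp
    qed
    then have "p = 0" using poly_eq_0_if_infinite[OF inf] by auto
    then have "0 = coeff p d" by simp
    also have "\<dots> = (\<Sum>M\<in>S. if M i = d then c M * mon_fun I M x else 0)"
      by (auto simp: p_def coeff_sum intro!: sum.cong)
    also have "\<dots> = (\<Sum>M\<in>S1. c M * mon_fun I M x)"
      using insert.prems(1) by (auto simp: S1_def sum.inter_filter)
    finally show ?thesis by simp
  qed
  define r where "r = (\<lambda>M::'v \<Rightarrow> nat. M(i := 0))"
  have inj: "inj_on r S1"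
  proof (rule inj_onI)
    fix M M' assume "M \<in> S1" "M' \<in> S1" "r M = r M'"
    then show "M = M'"
      by (intro ext) (metis (mono_tags, lifting) S1_def fun_upd_apply mem_Collect_eq r_def)
  qed
  have mr: "mon_fun I (r M) x = mon_fun I M x" for M and x :: "'v \<Rightarrow> 'k"
    using insert.hyps by (auto simp: mon_fun_def r_def intro!: prod.cong)
  define c' where "c' = (\<lambda>M. c (M(i := d)))"
  have cr: "c' (r M) = c M" if "M \<in> S1" for M
    using that unfolding c'_def r_def S1_def by (metis (mono_tags, lifting) fun_upd_triv fun_upd_upd mem_Collect_eq)
  have "c' (r M) = 0"
  proof (rule insert.IH[of "r ` S1" c' "r M"])
    show "finite (r ` S1)" using insert.prems(1) by (simp add: S1_def)
    show "M j = 0" if "M \<in> r ` S1" "j \<notin> I" for M j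
      using that insert.prems(2) by (auto simp: r_def S1_def)
    show "(\<Sum>M\<in>r ` S1. c' M * mon_fun I M x) = 0" for x
      using 1[of x] inj by (simp add: sum.reindex mr cr cong: sum.cong)
    show "r M \<in> r ` S1" using insert.prems(4) by (simp add: S1_def d_def)
  qed
  then show ?case using cr[of M] insert.prems(4) by (simp add: S1_def d_def)
qed

abbreviation polyfun :: "'v set \<Rightarrow> (('v \<Rightarrow> 'k::field) \<Rightarrow> 'k) set" where
  "polyfun I \<equiv> fs.span (range (mon_fun I))"

lemma polyfun_mult:
  assumes "f \<in> polyfun I" "g \<in> polyfun I"
  shows "(\<lambda>x. f x * g x) \<in> polyfun I"
proof (rule fs_span_mult[OF assms], safe)
  fix M M'
  have "(\<lambda>x. mon_fun I M x * mon_fun I M' x) = mon_fun I (\<lambda>i. M i + M' i)"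
    by (auto simp: mon_fun_def power_add prod.distrib)
  then show "(\<lambda>x. mon_fun I M x * mon_fun I M' x) \<in> polyfun I"
    by (auto intro: fs.span_base)
qed

lemma polyfun_const: "(\<lambda>x. c) \<in> polyfun I"
proof -
  have "(\<lambda>x. c) = (\<lambda>x. c * mon_fun I (\<lambda>_. 0) x)"
    by (auto simp: mon_fun_def)
  then show ?thesis by (simp add: fs_span_scale fs.span_base)
qed

lemma polyfun_var:
  assumes "finite I" "i \<in> I"
  shows "(\<lambda>x. x i) \<in> polyfun I"
proof -
  have "(\<lambda>x. x i) = mon_fun I (\<lambda>j. if j = i then 1 else 0)"
    using assms by (auto simp: mon_fun_def fun_eq_iff if_distrib prod.delta cong: if_cong)
  then show ?thesis by (auto intro: fs.span_base)
qed

lemma polyfun_prod: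
  assumes "\<And>a. a \<in> A \<Longrightarrow> F a \<in> polyfun I"
  shows "(\<lambda>x. \<Prod>a\<in>A. F a x) \<in> polyfun I"
  using assms
  by (induction A rule: infinite_finite_induct) (auto simp: polyfun_const intro!: polyfun_mult)

text \<open>
  Restriction to lines reduces questions about products of polynomial functions to polynomials in
  one variable.
\<close>

lemma polyfun_on_line:
  assumes "f \<in> polyfun I"
  shows "\<exists>p. \<forall>t. f (\<lambda>i. x i + t * y i) = poly p t"
proof -
  let ?P = "{f. \<exists>p. \<forall>t. f (\<lambda>i. x i + t * y i) = poly p t}"
  have "polyfun I \<subseteq> ?P"
  proof (rule fs.span_minimal)
    show "fs.subspace ?P"
    proof (rule fs_subspaceI)
      show "(\<lambda>x. 0) \<in> ?P" by (auto intro: exI[of _ 0])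
    next
      fix f g assume "f \<in> ?P" "g \<in> ?P"
      then obtain p q where "\<forall>t. f (\<lambda>i. x i + t * y i) = poly p t"
          "\<forall>t. g (\<lambda>i. x i + t * y i) = poly q t" by auto
      then show "(\<lambda>x. f x + g x) \<in> ?P" by (auto intro!: exI[of _ "p + q"])
    next
      fix c f assume "f \<in> ?P"
      then obtain p where "\<forall>t. f (\<lambda>i. x i + t * y i) = poly p t" by auto
      then show "(\<lambda>x. c * f x) \<in> ?P" by (auto intro!: exI[of _ "Polynomial.smult c p"])
    qed
    show "range (mon_fun I) \<subseteq> ?P"
    proof safe
      fix M
      show "\<exists>p. \<forall>t. mon_fun I M (\<lambda>i. x i + t * y i) = poly p t"
        by (rule exI[of _ "\<Prod>i\<in>I. [:x i, y i:] ^ M i"]) (auto simp: mon_fun_def poly_prod algebra_simps)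
    qed
  qed
  then show ?thesis using assms by auto
qed

text \<open>
  Zariski density of the complement of a hypersurface: on the line through \<open>x\<close> and a
  point where \<open>g\<close> does not vanish, the product of \<open>f\<close> and
  \<open>g\<close> is the zero polynomial and \<open>g\<close> is not.
\<close>

lemma polyfun_zero_on_dense:
  fixes f :: "('v \<Rightarrow> 'k::field) \<Rightarrow> 'k"
  assumes inf: "infinite (UNIV :: 'k set)" and f: "f \<in> polyfun I" and g: "g \<in> polyfun I"
    and x0: "g x0 \<noteq> 0" and zero: "\<And>x. g x \<noteq> 0 \<Longrightarrow> f x = 0"
  shows "f x = 0"
proof -
  let ?l = "\<lambda>t i. x i + t * (x0 i - x i)"
  obtain p q where p: "\<And>t. f (?l t) = poly p t" and q: "\<And>t. g (?l t) = poly q t"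
    using polyfun_on_line[OF f, of x "\<lambda>i. x0 i - x i"] polyfun_on_line[OF g, of x "\<lambda>i. x0 i - x i"]
    by auto
  have "poly (p * q) t = 0" for t
    using zero[of "?l t"] by (auto simp: p[symmetric] q[symmetric])
  then have "p * q = 0" by (rule poly_eq_0_if_infinite[OF inf])
  moreover have "q \<noteq> 0" using q[of 1] x0 by auto
  ultimately have "p = 0" by simp
  then show ?thesis using p[of 0] by simp
qed

section \<open>The diagonal action and bideterminants\<close>

type_synonym 'k entries = "nat \<times> nat \<Rightarrow> 'k"

definition box_row :: "nat \<times> nat \<Rightarrow> nat" where
  "box_row b = fst b - 1"

definition canonical :: "(nat \<Rightarrow> nat) \<Rightarrow> filling" where
  "canonical \<mu> = restrict box_row (young_diagram \<mu>)"

text \<open>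
  The action \<open>GL_act\<close> only reads the entries of a matrix. Taking the entries as a
  function makes singular matrices available too, so that the coefficients of
  \<open>mat_act n \<mu> A x\<close> are polynomial functions of an arbitrary \<open>A\<close>.
\<close>

definition mat_act :: "nat \<Rightarrow> (nat \<Rightarrow> nat) \<Rightarrow> ('k::field entries) \<Rightarrow> 'k tensor \<Rightarrow> 'k tensor" where
  "mat_act n \<mu> A x = (\<lambda>T. if T \<in> fillings n \<mu>
     then \<Sum>S\<in>fillings n \<mu>. (\<Prod>b\<in>young_diagram \<mu>. A (T b, S b)) * x S else 0)"

definition mat_mult :: "nat \<Rightarrow> ('k::field entries) \<Rightarrow> ('k entries) \<Rightarrow> 'k entries" where
  "mat_mult n A B = (\<lambda>(i, j). \<Sum>l<n. A (i, l) * B (l, j))"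

definition basis_tensor :: "filling \<Rightarrow> 'k::field tensor" where
  "basis_tensor T = (\<lambda>S. if S = T then 1 else 0)"

definition hw_vector :: "(nat \<Rightarrow> nat) \<Rightarrow> 'k::field tensor" where
  "hw_vector \<mu> = col_antisymmetrize \<mu> (basis_tensor (canonical \<mu>))"

text \<open>
  The product over the columns of \<open>\<mu>\<close> of the minors of \<open>A\<close> whose
  rows are the entries of \<open>T\<close> in that column and whose columns are the first ones. As
  a function of \<open>A\<close> it is the coefficient at \<open>T\<close> of the translate by
  \<open>A\<close> of the highest weight vector.
\<close>

definition bidet :: "(nat \<Rightarrow> nat) \<Rightarrow> filling \<Rightarrow> ('k::field entries) \<Rightarrow> 'k" where
  "bidet \<mu> T A = (\<Sum>\<sigma>\<in>col_perms \<mu>. of_int (sign \<sigma>) * (\<Prod>b\<in>young_diagram \<mu>. A (T (\<sigma> b), box_row b)))"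

definition borel :: "nat \<Rightarrow> ('k::field entries) \<Rightarrow> bool" where
  "borel n B \<longleftrightarrow> (\<forall>i j. j < i \<longrightarrow> i < n \<longrightarrow> B (i, j) = 0) \<and> (\<forall>i<n. B (i, i) \<noteq> 0)"

definition chi :: "nat \<Rightarrow> (nat \<Rightarrow> nat) \<Rightarrow> ('k::field entries) \<Rightarrow> 'k" where
  "chi n \<alpha> B = (\<Prod>c<n. B (c, c) ^ \<alpha> (Suc c))"

lemma partitions_outside: "\<mu> \<in> partitions n \<Longrightarrow> i \<notin> {1..n} \<Longrightarrow> \<mu> i = 0"
  by (auto simp: partitions_def)

lemma partitions_mono:
  assumes "\<mu> \<in> partitions n" "1 \<le> i" "i \<le> j"
  shows "\<mu> j \<le> \<mu> i"
proof (cases "j \<le> n")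
  case True
  then show ?thesis using assms by (auto simp: partitions_def monotone_on_def)
next
  case False
  then show ?thesis using partitions_outside[OF assms(1), of j] by auto
qed

lemma young_diagram_eq:
  assumes "\<mu> \<in> partitions n"
  shows "young_diagram \<mu> = (SIGMA i:{1..n}. {1..\<mu> i})"
  using partitions_outside[OF assms] by (fastforce simp: young_diagram_def)

lemma finite_young_diagram: "\<mu> \<in> partitions n \<Longrightarrow> finite (young_diagram \<mu>)"
  by (simp add: young_diagram_eq)

lemma young_diagram_up:
  assumes "\<mu> \<in> partitions n" "(j, c) \<in> young_diagram \<mu>" "1 \<le> i" "i \<le> j"
  shows "(i, c) \<in> young_diagram \<mu>"
  using assms partitions_mono[OF assms(1,3,4)] by (auto simp: young_diagram_def)

lemma box_row_less: "\<mu> \<in> partitions n \<Longrightarrow> b \<in> young_diagram \<mu> \<Longrightarrow> box_row b < n"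
  by (auto simp: young_diagram_eq box_row_def)

lemma fst_eq_Suc_row: "\<mu> \<in> partitions n \<Longrightarrow> b \<in> young_diagram \<mu> \<Longrightarrow> fst b = Suc (box_row b)"
  by (auto simp: young_diagram_eq box_row_def)

lemma finite_fillings: "\<mu> \<in> partitions n \<Longrightarrow> finite (fillings n \<mu>)"
  by (auto simp: fillings_def finite_young_diagram intro: finite_PiE)

lemma fillings_less: "T \<in> fillings n \<mu> \<Longrightarrow> b \<in> young_diagram \<mu> \<Longrightarrow> T b < n"
  by (auto simp: fillings_def)

lemma canonical_fillings: "\<mu> \<in> partitions n \<Longrightarrow> canonical \<mu> \<in> fillings n \<mu>"
  by (auto simp: canonical_def fillings_def box_row_less)

lemma fillings_comp_permutes:
  assumes "\<sigma> permutes young_diagram \<mu>"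
  shows "T \<circ> \<sigma> \<in> fillings n \<mu> \<longleftrightarrow> T \<in> fillings n \<mu>"
proof -
  have 1: "T \<circ> \<sigma> \<in> fillings n \<mu>" if "\<sigma> permutes young_diagram \<mu>" "T \<in> fillings n \<mu>" for T \<sigma>
    using that permutes_in_image[OF that(1)] permutes_not_in[OF that(1)]
    by (auto simp: fillings_def PiE_iff extensional_def)
  have "(T \<circ> \<sigma>) \<circ> inv_into UNIV \<sigma> = T"
    using assms by (auto simp: fun_eq_iff permutes_inverses)
  then show ?thesis
    using 1[OF assms, of T] 1[OF permutes_inv[OF assms], of "T \<circ> \<sigma>"] by auto
qed

lemma col_perms_permutes: "\<sigma> \<in> col_perms \<mu> \<Longrightarrow> \<sigma> permutes young_diagram \<mu>"
  by (simp add: col_perms_def)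

lemma id_in_col_perms: "id \<in> col_perms \<mu>"
  by (simp add: col_perms_def permutes_id)

lemma finite_col_perms: "\<mu> \<in> partitions n \<Longrightarrow> finite (col_perms \<mu>)"
  unfolding col_perms_def using finite_permutations[OF finite_young_diagram] by auto

lemma sum_fillings_comp:
  assumes "\<sigma> permutes young_diagram \<mu>"
  shows "(\<Sum>S\<in>fillings n \<mu>. F (S \<circ> \<sigma>)) = (\<Sum>S\<in>fillings n \<mu>. F S)"
  by (rule sum.reindex_bij_witness[of _ "\<lambda>S. S \<circ> inv_into UNIV \<sigma>" "\<lambda>S. S \<circ> \<sigma>"])
    (use assms in \<open>auto simp: fillings_comp_permutes permutes_inv fun_eq_iff permutes_inverses\<close>)

lemma prod_comp_permutes:
  assumes "\<sigma> permutes Y"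
  shows "(\<Prod>b\<in>Y. F (\<sigma> b)) = (\<Prod>b\<in>Y. F b)"
  using prod.permute[OF assms, of F] by (simp add: o_def)

text \<open>
  The diagonal action commutes with every permutation of the tensor factors.
\<close>

lemma col_antisymmetrize_mat_act:
  assumes mu: "\<mu> \<in> partitions n"
  shows "col_antisymmetrize \<mu> (mat_act n \<mu> A x) = mat_act n \<mu> A (col_antisymmetrize \<mu> x)"
proof
  fix T
  show "col_antisymmetrize \<mu> (mat_act n \<mu> A x) T = mat_act n \<mu> A (col_antisymmetrize \<mu> x) T"
  proof (cases "T \<in> fillings n \<mu>")
    case False
    then show ?thesis
      by (auto simp: col_antisymmetrize_def mat_act_def fillings_comp_permutes col_perms_permutes)
  next
    case True
    have 1: "mat_act n \<mu> A x (T \<circ> \<sigma>) =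
        (\<Sum>S\<in>fillings n \<mu>. (\<Prod>b\<in>young_diagram \<mu>. A (T b, S b)) * x (S \<circ> \<sigma>))"
      if s: "\<sigma> \<in> col_perms \<mu>" for \<sigma>
    proof -
      note p = col_perms_permutes[OF s]
      have "mat_act n \<mu> A x (T \<circ> \<sigma>) =
          (\<Sum>S\<in>fillings n \<mu>. (\<Prod>b\<in>young_diagram \<mu>. A (T (\<sigma> b), S b)) * x S)"
        using True by (simp add: mat_act_def fillings_comp_permutes[OF p])
      also have "\<dots> = (\<Sum>S\<in>fillings n \<mu>. (\<Prod>b\<in>young_diagram \<mu>. A (T (\<sigma> b), (S \<circ> \<sigma>) b)) * x (S \<circ> \<sigma>))"
        by (rule sum_fillings_comp[OF p, symmetric])
      also have "\<dots> = (\<Sum>S\<in>fillings n \<mu>. (\<Prod>b\<in>young_diagram \<mu>. A (T b, S b)) * x (S \<circ> \<sigma>))"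
        using prod_comp_permutes[OF p, of "\<lambda>b. A (T b, S b)" for S] by simp
      finally show ?thesis .
    qed
    have "col_antisymmetrize \<mu> (mat_act n \<mu> A x) T = (\<Sum>\<sigma>\<in>col_perms \<mu>.
        \<Sum>S\<in>fillings n \<mu>. of_int (sign \<sigma>) * ((\<Prod>b\<in>young_diagram \<mu>. A (T b, S b)) * x (S \<circ> \<sigma>)))"
      by (simp add: col_antisymmetrize_def 1 sum_distrib_left)
    also have "\<dots> = (\<Sum>S\<in>fillings n \<mu>. \<Sum>\<sigma>\<in>col_perms \<mu>.
        of_int (sign \<sigma>) * ((\<Prod>b\<in>young_diagram \<mu>. A (T b, S b)) * x (S \<circ> \<sigma>)))"
      by (rule sum.swap)
    also have "\<dots> = mat_act n \<mu> A (col_antisymmetrize \<mu> x) T"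
      using True by (simp add: mat_act_def col_antisymmetrize_def sum_distrib_left mult_ac)
    finally show ?thesis .
  qed
qed

lemma mat_act_basis:
  assumes "\<mu> \<in> partitions n" "S \<in> fillings n \<mu>"
  shows "mat_act n \<mu> A (basis_tensor S) =
    (\<lambda>T. if T \<in> fillings n \<mu> then \<Prod>b\<in>young_diagram \<mu>. A (T b, S b) else 0)"
proof
  fix T
  have "(\<Sum>R\<in>fillings n \<mu>. (\<Prod>b\<in>young_diagram \<mu>. A (T b, R b)) * basis_tensor S R) =
      (\<Sum>R\<in>fillings n \<mu>. if R = S then \<Prod>b\<in>young_diagram \<mu>. A (T b, R b) else 0)"
    by (intro sum.cong) (auto simp: basis_tensor_def)
  also have "\<dots> = (\<Prod>b\<in>young_diagram \<mu>. A (T b, S b))"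
    using assms finite_fillings[OF assms(1)] by simp
  finally show "mat_act n \<mu> A (basis_tensor S) T =
      (if T \<in> fillings n \<mu> then \<Prod>b\<in>young_diagram \<mu>. A (T b, S b) else 0)"
    by (simp add: mat_act_def)
qed

lemma mat_act_hw_vector:
  assumes mu: "\<mu> \<in> partitions n"
  shows "mat_act n \<mu> A (hw_vector \<mu>) = (\<lambda>T. if T \<in> fillings n \<mu> then bidet \<mu> T A else 0)"
  unfolding hw_vector_def col_antisymmetrize_mat_act[OF mu, symmetric]
    mat_act_basis[OF mu canonical_fillings[OF mu]]
  by (rule ext) (auto simp: col_antisymmetrize_def bidet_def
      fillings_comp_permutes col_perms_permutes canonical_def intro!: sum.cong sum.neutral)

lemma mat_act_mat_act:
  assumes mu: "\<mu> \<in> partitions n"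
  shows "mat_act n \<mu> A (mat_act n \<mu> B x) = mat_act n \<mu> (mat_mult n A B) x"
proof
  fix T
  let ?Y = "young_diagram \<mu>" and ?F = "fillings n \<mu>"
  have "(\<Sum>S\<in>?F. (\<Prod>b\<in>?Y. A (T b, S b)) * (\<Sum>R\<in>?F. (\<Prod>b\<in>?Y. B (S b, R b)) * x R))
      = (\<Sum>S\<in>?F. \<Sum>R\<in>?F. (\<Prod>b\<in>?Y. A (T b, S b) * B (S b, R b)) * x R)"
    by (simp add: sum_distrib_left prod.distrib mult_ac)
  also have "\<dots> = (\<Sum>R\<in>?F. \<Sum>S\<in>?F. (\<Prod>b\<in>?Y. A (T b, S b) * B (S b, R b)) * x R)"
    by (rule sum.swap)
  also have "\<dots> = (\<Sum>R\<in>?F. (\<Prod>b\<in>?Y. \<Sum>l<n. A (T b, l) * B (l, R b)) * x R)"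
    by (simp add: fillings_def sum_distrib_right prod_sum_PiE[OF finite_young_diagram[OF mu]])
  finally show "mat_act n \<mu> A (mat_act n \<mu> B x) T = mat_act n \<mu> (mat_mult n A B) x T"
    by (simp add: mat_act_def mat_mult_def)
qed

lemma bidet_mat_mult_left:
  assumes mu: "\<mu> \<in> partitions n" and T: "T \<in> fillings n \<mu>"
  shows "bidet \<mu> T (mat_mult n B A) =
    (\<Sum>S\<in>fillings n \<mu>. (\<Prod>b\<in>young_diagram \<mu>. B (T b, S b)) * bidet \<mu> S A)"
proof -
  have "bidet \<mu> T (mat_mult n B A) = mat_act n \<mu> (mat_mult n B A) (hw_vector \<mu>) T"
    using T by (simp add: mat_act_hw_vector[OF mu])
  also have "\<dots> = mat_act n \<mu> B (mat_act n \<mu> A (hw_vector \<mu>)) T"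
    by (simp add: mat_act_mat_act[OF mu])
  also have "\<dots> = (\<Sum>S\<in>fillings n \<mu>. (\<Prod>b\<in>young_diagram \<mu>. B (T b, S b)) * bidet \<mu> S A)"
    using T by (simp add: mat_act_def[of n \<mu> B] mat_act_hw_vector[OF mu])
  finally show ?thesis .
qed

text \<open>
  Pairing \<open>\<sigma>\<close> with its product by the transposition cancels the sum. The
  pairing is made between even and odd permutations because in characteristic 2 the equality of
  the sum with its own negative would not suffice.
\<close>

lemma sum_col_perms_alternating:
  fixes h :: "(nat \<times> nat \<Rightarrow> nat \<times> nat) \<Rightarrow> 'k::field"
  assumes mu: "\<mu> \<in> partitions n" and b: "b1 \<in> young_diagram \<mu>" "b2 \<in> young_diagram \<mu>" "b1 \<noteq> b2" "snd b1 = snd b2"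
    and h: "\<And>\<sigma>. \<sigma> \<in> col_perms \<mu> \<Longrightarrow> h (\<sigma> \<circ> transpose b1 b2) = h \<sigma>"
  shows "(\<Sum>\<sigma>\<in>col_perms \<mu>. of_int (sign \<sigma>) * h \<sigma>) = 0"
proof -
  let ?C = "col_perms \<mu>" and ?t = "transpose b1 b2"
  have t: "?t permutes young_diagram \<mu>" using b by (simp add: permutes_swap_id)
  have closed: "\<sigma> \<circ> ?t \<in> ?C" if "\<sigma> \<in> ?C" for \<sigma>
  proof -
    have "snd (\<sigma> (?t b)) = snd b" for b
    proof -
      have "snd (\<sigma> (?t b)) = snd (?t b)" using that by (simp add: col_perms_def del: split_paired_All)
      also have "\<dots> = snd b" using b(4) by (auto simp: transpose_def)
      finally show ?thesis .
    qed
    then show ?thesis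
      using that permutes_compose[OF t, of \<sigma>] by (simp add: col_perms_def del: split_paired_All)
  qed
  have perm: "permutation \<sigma>" if "\<sigma> \<in> ?C" for \<sigma>
    using that finite_young_diagram[OF mu] col_perms_permutes permutation_permutes by blast
  have sign: "sign (\<sigma> \<circ> ?t) = - sign \<sigma>" if "\<sigma> \<in> ?C" for \<sigma>
    using sign_compose[OF perm[OF that], of ?t] b(3)
    by (simp add: sign_swap_id permutation_swap_id)
  have sign_pm: "sign \<sigma> = 1 \<or> sign \<sigma> = - 1" for \<sigma> :: "nat \<times> nat \<Rightarrow> nat \<times> nat"
    by (simp add: sign_def)
  let ?E = "{\<sigma> \<in> ?C. sign \<sigma> = 1}" and ?O = "{\<sigma> \<in> ?C. sign \<sigma> \<noteq> 1}"
  have "(\<Sum>\<sigma>\<in>?O. of_int (sign \<sigma>) * h \<sigma>) = (\<Sum>\<sigma>\<in>?E. of_int (sign (\<sigma> \<circ> ?t)) * h (\<sigma> \<circ> ?t))"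
    by (rule sum.reindex_bij_witness[of _ "\<lambda>\<sigma>. \<sigma> \<circ> ?t" "\<lambda>\<sigma>. \<sigma> \<circ> ?t"])
      (use sign_pm in \<open>auto simp: o_assoc[symmetric] closed sign\<close>)
  also have "\<dots> = - (\<Sum>\<sigma>\<in>?E. of_int (sign \<sigma>) * h \<sigma>)"
    by (simp add: sign h sum_negf)
  finally have "(\<Sum>\<sigma>\<in>?E. of_int (sign \<sigma>) * h \<sigma>) + (\<Sum>\<sigma>\<in>?O. of_int (sign \<sigma>) * h \<sigma>) = 0"
    by simp
  then show ?thesis
    using sum.Int_Diff[OF finite_col_perms[OF mu], of "\<lambda>\<sigma>. of_int (sign \<sigma>) * h \<sigma>" "{\<sigma>. sign \<sigma> = 1}"]
    by (simp add: Int_def set_diff_eq)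
qed

text \<open>
  In a column, the box in row \<open>i\<close> has only the values \<open>0, \<dots>, i\<close> at
  its disposal, and those below \<open>i\<close> are used up by the boxes above it.
\<close>

lemma column_injective_below_canonical:
  assumes mu: "\<mu> \<in> partitions n"
    and le: "\<And>b. b \<in> young_diagram \<mu> \<Longrightarrow> L b \<le> box_row b"
    and inj: "\<And>b1 b2. b1 \<in> young_diagram \<mu> \<Longrightarrow> b2 \<in> young_diagram \<mu> \<Longrightarrow> snd b1 = snd b2 \<Longrightarrow> L b1 = L b2 \<Longrightarrow> b1 = b2"
    and b: "b \<in> young_diagram \<mu>"
  shows "L b = box_row b"
  using b
proof (induction "box_row b" arbitrary: b rule: less_induct)
  case less
  show ?case
  proof (rule ccontr)
    assume "L b \<noteq> box_row b"
    then have lt: "L b < box_row b" using le[OF less.prems] by simp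
    define b' where "b' = (Suc (L b), snd b)"
    have "b' \<in> young_diagram \<mu>"
      using young_diagram_up[OF mu, of "fst b" "snd b" "Suc (L b)"] less.prems lt
      by (auto simp: b'_def box_row_def)
    moreover have "box_row b' = L b" by (simp add: b'_def box_row_def)
    ultimately have "L b' = L b" using less.hyps[of b'] lt by simp
    then have "b' = b" using inj[of b' b] \<open>b' \<in> _\<close> less.prems by (simp add: b'_def)
    then show False using \<open>box_row b' = L b\<close> lt by simp
  qed
qed

lemma prod_over_fibres:
  assumes "finite Y" "finite V" "g ` Y \<subseteq> V"
  shows "(\<Prod>b\<in>Y. F (g b)) = (\<Prod>v\<in>V. F v ^ card {b \<in> Y. g b = v})"
proof -
  have "(\<Prod>b\<in>Y. F (g b)) = (\<Prod>v\<in>V. \<Prod>b\<in>{b \<in> Y. g b = v}. F (g b))"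
    using prod.group[OF assms, of "\<lambda>b. F (g b)"] by simp
  also have "\<dots> = (\<Prod>v\<in>V. F v ^ card {b \<in> Y. g b = v})"
    by (intro prod.cong refl) simp
  finally show ?thesis .
qed

lemma sum_over_fibres:
  fixes F :: "_ \<Rightarrow> nat"
  assumes "finite Y" "finite V" "g ` Y \<subseteq> V"
  shows "(\<Sum>b\<in>Y. F (g b)) = (\<Sum>v\<in>V. F v * card {b \<in> Y. g b = v})"
proof -
  have "(\<Sum>b\<in>Y. F (g b)) = (\<Sum>v\<in>V. \<Sum>b\<in>{b \<in> Y. g b = v}. F (g b))"
    using sum.group[OF assms, of "\<lambda>b. F (g b)"] by simp
  also have "\<dots> = (\<Sum>v\<in>V. F v * card {b \<in> Y. g b = v})"
    by (intro sum.cong refl) simp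
  finally show ?thesis .
qed

lemma card_row:
  assumes mu: "\<mu> \<in> partitions n" and "c < n"
  shows "card {b \<in> young_diagram \<mu>. box_row b = c} = \<mu> (Suc c)"
proof -
  have "{b \<in> young_diagram \<mu>. box_row b = c} = {Suc c} \<times> {1..\<mu> (Suc c)}"
    using assms by (auto simp: young_diagram_eq[OF mu] box_row_def)
  then show ?thesis by simp
qed

lemma chi_eq_prod_young_diagram:
  assumes mu: "\<mu> \<in> partitions n"
  shows "(\<Prod>b\<in>young_diagram \<mu>. B (box_row b, box_row b)) = chi n \<mu> B"
proof -
  have "(\<Prod>b\<in>young_diagram \<mu>. B (box_row b, box_row b)) = (\<Prod>c<n. B (c, c) ^ card {b \<in> young_diagram \<mu>. box_row b = c})"
    by (rule prod_over_fibres) (auto simp: finite_young_diagram[OF mu] box_row_less[OF mu])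
  also have "\<dots> = chi n \<mu> B"
    unfolding chi_def by (intro prod.cong refl) (simp add: card_row[OF mu])
  finally show ?thesis .
qed

text \<open>
  Expanding the product over all choices \<open>L\<close> of intermediate indices, a choice
  contributes only if it is injective on columns, since the sum over column permutations
  alternates, and if \<open>L b \<le> box_row b\<close>, since \<open>B\<close> is upper
  triangular. Only the canonical choice is left.
\<close>

lemma bidet_mat_mult_borel:
  fixes A B :: "'k::field entries"
  assumes mu: "\<mu> \<in> partitions n" and B: "borel n B"
  shows "bidet \<mu> T (mat_mult n A B) = chi n \<mu> B * bidet \<mu> T A"
proof -
  let ?Y = "young_diagram \<mu>" and ?F = "fillings n \<mu>"
  define W where "W L = (\<Sum>\<sigma>\<in>col_perms \<mu>. of_int (sign \<sigma>) * (\<Prod>b\<in>?Y. A (T (\<sigma> b), L b)))" for L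
  have "bidet \<mu> T (mat_mult n A B) = (\<Sum>\<sigma>\<in>col_perms \<mu>. of_int (sign \<sigma>) *
      (\<Sum>L\<in>?F. \<Prod>b\<in>?Y. A (T (\<sigma> b), L b) * B (L b, box_row b)))"
    unfolding bidet_def mat_mult_def
    by (simp add: fillings_def prod_sum_PiE[OF finite_young_diagram[OF mu]])
  also have "\<dots> = (\<Sum>L\<in>?F. \<Sum>\<sigma>\<in>col_perms \<mu>. of_int (sign \<sigma>) *
      (\<Prod>b\<in>?Y. A (T (\<sigma> b), L b) * B (L b, box_row b)))"
    by (subst sum.swap) (simp add: sum_distrib_left)
  also have "\<dots> = (\<Sum>L\<in>?F. (\<Prod>b\<in>?Y. B (L b, box_row b)) * W L)"
    by (simp add: W_def sum_distrib_left prod.distrib mult_ac)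
  also have "\<dots> = (\<Sum>L\<in>{canonical \<mu>}. (\<Prod>b\<in>?Y. B (L b, box_row b)) * W L)"
  proof (rule sum.mono_neutral_right)
    show "\<forall>L\<in>?F - {canonical \<mu>}. (\<Prod>b\<in>?Y. B (L b, box_row b)) * W L = 0"
    proof (rule ballI, rule ccontr)
      fix L assume L: "L \<in> ?F - {canonical \<mu>}" and nz: "(\<Prod>b\<in>?Y. B (L b, box_row b)) * W L \<noteq> 0"
      have le: "L b \<le> box_row b" if "b \<in> ?Y" for b
      proof (rule ccontr)
        assume "\<not> L b \<le> box_row b"
        then have "B (L b, box_row b) = 0"
          using B that L fillings_less[of L n \<mu> b] by (auto simp: borel_def)
        then show False using nz that finite_young_diagram[OF mu] by (auto simp: prod_zero_iff)
      qed
      have inj: "b1 = b2" if b: "b1 \<in> ?Y" "b2 \<in> ?Y" "snd b1 = snd b2" "L b1 = L b2" for b1 b2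
      proof (rule ccontr)
        assume ne: "b1 \<noteq> b2"
        have t: "transpose b1 b2 permutes ?Y" using b by (simp add: permutes_swap_id)
        have "W L = 0"
          unfolding W_def
        proof (rule sum_col_perms_alternating[OF mu b(1,2) ne b(3)])
          fix \<sigma>
          have "(\<Prod>b\<in>?Y. A (T ((\<sigma> \<circ> transpose b1 b2) b), L b)) =
              (\<Prod>b\<in>?Y. A (T (\<sigma> (transpose b1 b2 b)), L (transpose b1 b2 b)))"
            using b(4) by (intro prod.cong) (auto simp: transpose_def)
          also have "\<dots> = (\<Prod>b\<in>?Y. A (T (\<sigma> b), L b))"
            by (rule prod_comp_permutes[OF t, of "\<lambda>b. A (T (\<sigma> b), L b)"])
          finally show "(\<Prod>b\<in>?Y. A (T ((\<sigma> \<circ> transpose b1 b2) b), L b)) = (\<Prod>b\<in>?Y. A (T (\<sigma> b), L b))" .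
        qed
        then show False using nz by simp
      qed
      have "L b = box_row b" if "b \<in> ?Y" for b
        using column_injective_below_canonical[OF mu le inj that] by blast
      then have "L = canonical \<mu>"
        using L by (auto simp: canonical_def fillings_def fun_eq_iff PiE_iff extensional_def)
      then show False using L by simp
    qed
  qed (auto simp: finite_fillings[OF mu] canonical_fillings[OF mu])
  also have "\<dots> = chi n \<mu> B * bidet \<mu> T A"
    by (simp add: canonical_def W_def bidet_def chi_eq_prod_young_diagram[OF mu] cong: prod.cong)
  finally show ?thesis .
qed

lemma chi_add: "chi n (\<lambda>i. \<alpha> i + k * \<beta> i) B = chi n \<alpha> B * chi n \<beta> B ^ k"
  by (simp add: chi_def power_add prod.distrib prod_power_distrib power_mult mult.commute[of k])

lemma partitions_add: "\<alpha> \<in> partitions n \<Longrightarrow> \<beta> \<in> partitions n \<Longrightarrow> (\<lambda>i. \<alpha> i + k * \<beta> i) \<in> partitions n"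
  by (auto simp: partitions_def monotone_on_def intro!: add_mono mult_left_mono)

section \<open>Bigraded polynomial functions on matrices\<close>

abbreviation cells :: "nat \<Rightarrow> (nat \<times> nat) set" where
  "cells n \<equiv> {..<n} \<times> {..<n}"

text \<open>
  The column sums give the degree in each column of the matrix, which is the weight for the right
  action of the torus. Of the weight for the left action only the moment is recorded, in which row
  \<open>l\<close> counts with multiplicity \<open>l\<close>; it measures how far a weight is
  below the highest one.
\<close>

definition exponents :: "nat \<Rightarrow> (nat \<Rightarrow> nat) \<Rightarrow> nat \<Rightarrow> (nat \<times> nat \<Rightarrow> nat) set" where
  "exponents n \<alpha> D = {M. (\<forall>v. v \<notin> cells n \<longrightarrow> M v = 0) \<and>
     (\<forall>c<n. (\<Sum>l<n. M (l, c)) = \<alpha> (Suc c)) \<and> (\<Sum>(l, c)\<in>cells n. l * M (l, c)) = D}"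

abbreviation graded :: "nat \<Rightarrow> (nat \<Rightarrow> nat) \<Rightarrow> nat \<Rightarrow> (('k::field entries) \<Rightarrow> 'k) set" where
  "graded n \<alpha> D \<equiv> fs.span (mon_fun (cells n) ` exponents n \<alpha> D)"

definition pair_count :: "(nat \<Rightarrow> nat) \<Rightarrow> filling \<Rightarrow> filling \<Rightarrow> nat \<times> nat \<Rightarrow> nat" where
  "pair_count \<mu> S R v = card {b \<in> young_diagram \<mu>. (S b, R b) = v}"

abbreviation expo :: "(nat \<Rightarrow> nat) \<Rightarrow> filling \<Rightarrow> nat \<times> nat \<Rightarrow> nat" where
  "expo \<mu> T \<equiv> pair_count \<mu> T box_row"

definition moment :: "(nat \<Rightarrow> nat) \<Rightarrow> filling \<Rightarrow> nat" where
  "moment \<mu> T = (\<Sum>b\<in>young_diagram \<mu>. T b)"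

text \<open>
  The moment of the canonical filling and, for nonzero semi-invariants, the least one that is
  possible (see \<open>semi_invariant_moment_ge\<close> below).
\<close>

definition min_moment :: "nat \<Rightarrow> (nat \<Rightarrow> nat) \<Rightarrow> nat" where
  "min_moment n \<alpha> = (\<Sum>c<n. c * \<alpha> (Suc c))"

definition semi_invariant :: "nat \<Rightarrow> (nat \<Rightarrow> nat) \<Rightarrow> (('k::field entries) \<Rightarrow> 'k) \<Rightarrow> bool" where
  "semi_invariant n \<alpha> f \<longleftrightarrow> (\<forall>A B. borel n B \<longrightarrow> f (mat_mult n A B) = chi n \<alpha> B * f A)"

lemma prod_eq_mon_pair_count:
  assumes mu: "\<mu> \<in> partitions n" and lt: "\<And>b. b \<in> young_diagram \<mu> \<Longrightarrow> S b < n \<and> R b < n"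
  shows "(\<Prod>b\<in>young_diagram \<mu>. A (S b, R b)) = mon_fun (cells n) (pair_count \<mu> S R) A"
  unfolding mon_fun_def pair_count_def
  by (rule prod_over_fibres[OF finite_young_diagram[OF mu]]) (use lt in auto)

lemma sum_eq_sum_pair_count:
  fixes F :: "nat \<times> nat \<Rightarrow> nat"
  assumes mu: "\<mu> \<in> partitions n" and lt: "\<And>b. b \<in> young_diagram \<mu> \<Longrightarrow> S b < n \<and> R b < n"
  shows "(\<Sum>b\<in>young_diagram \<mu>. F (S b, R b)) = (\<Sum>v\<in>cells n. F v * pair_count \<mu> S R v)"
  unfolding pair_count_def
  by (rule sum_over_fibres[OF finite_young_diagram[OF mu]]) (use lt in auto)

text \<open>
  The exponent of \<open>A (l, c)\<close> in the product of the \<open>A (S b, R b)\<close> counts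
  boxes with \<open>S b = l\<close> and \<open>R b = c\<close>, so its column sums depend only on
  the content of \<open>R\<close> and its moment only on \<open>S\<close>.
\<close>

lemma pair_count_exponents:
  assumes mu: "\<mu> \<in> partitions n" and lt: "\<And>b. b \<in> young_diagram \<mu> \<Longrightarrow> S b < n \<and> R b < n"
    and R: "\<And>c. c < n \<Longrightarrow> card {b \<in> young_diagram \<mu>. R b = c} = \<alpha> (Suc c)"
  shows "pair_count \<mu> S R \<in> exponents n \<alpha> (moment \<mu> S)"
proof -
  have "pair_count \<mu> S R v = 0" if "v \<notin> cells n" for v
  proof -
    have "{b \<in> young_diagram \<mu>. (S b, R b) = v} = {}"
      using that lt by blast
    then show ?thesis unfolding pair_count_def by (metis card.empty)
  qed
  moreover have "(\<Sum>l<n. pair_count \<mu> S R (l, c)) = \<alpha> (Suc c)" if c: "c < n" for c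
  proof -
    let ?R = "{b \<in> young_diagram \<mu>. R b = c}"
    have "card ?R = (\<Sum>b\<in>?R. 1)" by simp
    also have "\<dots> = (\<Sum>l<n. 1 * card {b \<in> ?R. S b = l})"
      by (rule sum_over_fibres[where F = "\<lambda>_. 1"]) (use lt finite_young_diagram[OF mu] in auto)
    also have "\<dots> = (\<Sum>l<n. pair_count \<mu> S R (l, c))"
      by (auto simp: pair_count_def intro!: sum.cong arg_cong[of _ _ card])
    finally show ?thesis using R[OF c] by simp
  qed
  moreover have "(\<Sum>(l, c)\<in>cells n. l * pair_count \<mu> S R (l, c)) = moment \<mu> S"
    using sum_eq_sum_pair_count[OF mu lt, where F = fst] by (simp add: moment_def case_prod_beta)
  ultimately show ?thesis by (auto simp: exponents_def)
qed

lemma filling_box_row_less: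
  assumes "\<mu> \<in> partitions n" "T \<in> fillings n \<mu>" "b \<in> young_diagram \<mu>"
  shows "T b < n \<and> box_row b < n"
  using assms by (simp add: fillings_less box_row_less)

lemma expo_exponents:
  assumes mu: "\<mu> \<in> partitions n" and T: "T \<in> fillings n \<mu>"
  shows "expo \<mu> T \<in> exponents n \<mu> (moment \<mu> T)"
  by (rule pair_count_exponents[OF mu filling_box_row_less[OF mu T] card_row[OF mu]])

lemma exponents_outside: "M \<in> exponents n \<alpha> D \<Longrightarrow> v \<notin> cells n \<Longrightarrow> M v = 0"
  unfolding exponents_def by blast

lemma moment_comp:
  "\<sigma> permutes young_diagram \<mu> \<Longrightarrow> moment \<mu> (T \<circ> \<sigma>) = moment \<mu> T"
  using sum.permute[of \<sigma> "young_diagram \<mu>" T] by (simp add: moment_def)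

lemma moment_canonical: 
  assumes mu: "\<mu> \<in> partitions n"
  shows "moment \<mu> (canonical \<mu>) = min_moment n \<mu>"
proof -
  have "(\<Sum>b\<in>young_diagram \<mu>. box_row b) = (\<Sum>c<n. c * card {b \<in> young_diagram \<mu>. box_row b = c})"
    by (rule sum_over_fibres) (auto simp: finite_young_diagram[OF mu] box_row_less[OF mu])
  also have "\<dots> = min_moment n \<mu>"
    unfolding min_moment_def by (intro sum.cong refl) (simp add: card_row[OF mu])
  finally show ?thesis by (simp add: moment_def canonical_def)
qed

lemma bidet_eq_sum_mon:
  assumes mu: "\<mu> \<in> partitions n" and T: "T \<in> fillings n \<mu>"
  shows "bidet \<mu> T = (\<lambda>A. \<Sum>\<sigma>\<in>col_perms \<mu>. of_int (sign \<sigma>) * mon_fun (cells n) (expo \<mu> (T \<circ> \<sigma>)) A)"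
proof
  fix A :: "nat \<times> nat \<Rightarrow> 'a"
  show "bidet \<mu> T A = (\<Sum>\<sigma>\<in>col_perms \<mu>. of_int (sign \<sigma>) * mon_fun (cells n) (expo \<mu> (T \<circ> \<sigma>)) A)"
    unfolding bidet_def
  proof (intro sum.cong refl arg_cong[of _ _ "(*) _"])
    fix \<sigma> assume "\<sigma> \<in> col_perms \<mu>"
    then have "T \<circ> \<sigma> \<in> fillings n \<mu>"
      using T by (simp add: fillings_comp_permutes col_perms_permutes)
    then show "(\<Prod>b\<in>young_diagram \<mu>. A (T (\<sigma> b), box_row b)) = mon_fun (cells n) (expo \<mu> (T \<circ> \<sigma>)) A"
      using prod_eq_mon_pair_count[where S = "T \<circ> \<sigma>" and R = box_row and A = A,
          OF mu filling_box_row_less[OF mu, of "T \<circ> \<sigma>"]]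
      by simp
  qed
qed

lemma bidet_graded:
  assumes mu: "\<mu> \<in> partitions n" and T: "T \<in> fillings n \<mu>"
  shows "bidet \<mu> T \<in> graded n \<mu> (moment \<mu> T)"
  unfolding bidet_eq_sum_mon[OF mu T]
proof (intro fs_span_sum fs_span_scale fs.span_base imageI)
  fix \<sigma> assume "\<sigma> \<in> col_perms \<mu>"
  then have p: "\<sigma> permutes young_diagram \<mu>" by (rule col_perms_permutes)
  show "expo \<mu> (T \<circ> \<sigma>) \<in> exponents n \<mu> (moment \<mu> T)"
    using expo_exponents[OF mu, of "T \<circ> \<sigma>"] T by (simp add: fillings_comp_permutes[OF p] moment_comp[OF p])
qed

lemma bidet_semi_invariant: "\<mu> \<in> partitions n \<Longrightarrow> semi_invariant n \<mu> (bidet \<mu> T)"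
  by (simp add: semi_invariant_def bidet_mat_mult_borel)

lemma graded_mult:
  assumes "f \<in> graded n \<alpha> D" "g \<in> graded n \<beta> E"
  shows "(\<lambda>A. f A * g A) \<in> graded n (\<lambda>i. \<alpha> i + \<beta> i) (D + E)"
proof (rule fs_span_mult[OF assms], safe)
  fix M M' assume M: "M \<in> exponents n \<alpha> D" "M' \<in> exponents n \<beta> E"
  have "(\<lambda>x. mon_fun (cells n) M x * mon_fun (cells n) M' x) = mon_fun (cells n) (\<lambda>v. M v + M' v)"
    by (auto simp: mon_fun_def power_add prod.distrib)
  moreover have "(\<lambda>v. M v + M' v) \<in> exponents n (\<lambda>i. \<alpha> i + \<beta> i) (D + E)"
    using M by (auto simp: exponents_def sum.distrib add_mult_distrib2 case_prod_beta)
  ultimately show "(\<lambda>x. mon_fun (cells n) M x * mon_fun (cells n) M' x) \<in> graded n (\<lambda>i. \<alpha> i + \<beta> i) (D + E)"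
    by (auto intro: fs.span_base)
qed

lemma semi_invariant_mult:
  assumes "semi_invariant n \<alpha> f" "semi_invariant n \<beta> g"
  shows "semi_invariant n (\<lambda>i. \<alpha> i + \<beta> i) (\<lambda>A. f A * g A)"
  using assms by (simp add: semi_invariant_def chi_def power_add prod.distrib mult_ac)

section \<open>Leading exponents of semi-invariants are semistandard\<close>

text \<open>
  Unlike the leading coefficient, the coefficient at an upper bound of the degree is
  multiplicative even when it vanishes.
\<close>

definition lead :: "nat \<Rightarrow> 'a::comm_ring_1 poly \<Rightarrow> 'a \<Rightarrow> bool" where
  "lead N p a \<longleftrightarrow> degree p \<le> N \<and> coeff p N = a"

lemma lead_mult:
  assumes "lead m p a" "lead n q b"
  shows "lead (m + n) (p * q) (a * b)"
proof -
  have "coeff (p * q) (m + n) = (\<Sum>i\<le>m + n. if i = m then a * b else 0)"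
    unfolding coeff_mult
  proof (rule sum.cong[OF refl])
    fix i assume "i \<in> {..m + n}"
    have "coeff p i * coeff q (m + n - i) = 0" if "i \<noteq> m"
    proof (cases "i < m")
      case True
      then have "coeff q (m + n - i) = 0" using assms(2) by (intro coeff_eq_0) (auto simp: lead_def)
      then show ?thesis by simp
    next
      case False
      then have "coeff p i = 0" using that assms(1) by (intro coeff_eq_0) (auto simp: lead_def)
      then show ?thesis by simp
    qed
    then show "coeff p i * coeff q (m + n - i) = (if i = m then a * b else 0)"
      using assms by (auto simp: lead_def)
  qed
  moreover have "degree (p * q) \<le> m + n"
    using degree_mult_le[of p q] assms by (auto simp: lead_def)
  ultimately show ?thesis by (simp add: lead_def)
qed

lemma lead_one: "lead 0 1 1"
  by (simp add: lead_def)

lemma lead_power: "lead m p a \<Longrightarrow> lead (m * k) (p ^ k) (a ^ k)"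
proof (induction k)
  case (Suc k)
  then show ?case using lead_mult[of m p a "m * k" "p ^ k" "a ^ k"] by simp
qed (simp add: lead_one)

lemma lead_mon_fun:
  assumes "\<And>v. v \<in> I \<Longrightarrow> lead (w v) (P v) (e v)"
  shows "lead (\<Sum>v\<in>I. w v * M v) (mon_fun I M P) (mon_fun I M e)"
  using assms unfolding mon_fun_def
  by (induction I rule: infinite_finite_induct) (auto simp: lead_one intro!: lead_mult lead_power)

lemma poly_mon_fun: "poly (mon_fun I M P) y = mon_fun I M (\<lambda>v. poly (P v) y)"
  by (simp add: mon_fun_def poly_prod)

text \<open>
  \<open>Q\<close> is a polynomial in an outer variable \<open>E\<close> whose coefficients are
  polynomials in an inner variable. The coefficient of an inner degree above the bound is a
  polynomial in \<open>E\<close> that vanishes everywhere.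
\<close>

lemma degree_coeff_le:
  fixes Q :: "'k::field poly poly"
  assumes inf: "infinite (UNIV :: 'k set)" and bound: "\<And>E. degree (poly Q [:E:]) \<le> a"
  shows "degree (coeff Q N) \<le> a"
proof (rule degree_le, intro allI impI)
  fix d assume d: "a < d"
  define R where "R = (\<Sum>i\<le>degree Q. Polynomial.monom (coeff (coeff Q i) d) i)"
  have "poly R E = 0" for E
  proof -
    have "poly R E = coeff (\<Sum>i\<le>degree Q. Polynomial.smult (E ^ i) (coeff Q i)) d"
      by (simp add: R_def poly_sum poly_monom coeff_sum mult.commute)
    also have "(\<Sum>i\<le>degree Q. Polynomial.smult (E ^ i) (coeff Q i)) = poly Q [:E:]"
      by (simp add: poly_altdef poly_const_pow)
    also have "coeff (poly Q [:E:]) d = 0"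
      using bound[of E] d by (intro coeff_eq_0) simp
    finally show ?thesis .
  qed
  then have "R = 0" by (rule poly_eq_0_if_infinite[OF inf])
  then have "0 = coeff R N" by simp
  also have "\<dots> = (if N \<le> degree Q then coeff (coeff Q N) d else 0)"
    by (simp add: R_def coeff_sum)
  finally show "coeff (coeff Q N) d = 0"
    by (cases "N \<le> degree Q") (auto simp: coeff_eq_0)
qed

lemma mon_fun_monom:
  "mon_fun I M (\<lambda>v. Polynomial.monom (a v) (k v)) = Polynomial.monom (mon_fun I M a) (\<Sum>v\<in>I. k v * M v)"
  unfolding mon_fun_def
  by (induction I rule: infinite_finite_induct) (auto simp: monom_power mult_monom)

text \<open>
  The weight is chosen such that the height of an exponent increases when, of two row indices in
  different columns, the smaller one moves to the smaller column index in exchange for the larger.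
  Adding \<open>n\<close> to the column index keeps the exponents
  \<open>weight n (l, Suc j) - Suc i\<close> in the next proof nonnegative.
\<close>

definition weight :: "nat \<Rightarrow> nat \<times> nat \<Rightarrow> nat" where
  "weight n = (\<lambda>(l, d). Suc l * (d + n))"

definition height :: "nat \<Rightarrow> (nat \<times> nat \<Rightarrow> nat) \<Rightarrow> nat" where
  "height n M = (\<Sum>v\<in>cells n. weight n v * M v)"

definition col_op :: "nat \<Rightarrow> 'k::field \<Rightarrow> ('k entries) \<Rightarrow> 'k entries" where
  "col_op j x A = (\<lambda>(l, d). if d = Suc j then A (l, d) + x * A (l, j) else A (l, d))"

text \<open>
  Column \<open>j\<close> of \<open>M\<close> is the content of row \<open>j\<close> of a tableau.
  The condition says that this tableau increases strictly down its columns when each row is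
  written in increasing order.
\<close>

definition semistandard :: "nat \<Rightarrow> (nat \<times> nat \<Rightarrow> nat) \<Rightarrow> bool" where
  "semistandard n M \<longleftrightarrow>
    (\<forall>j i. Suc j < n \<longrightarrow> i < n \<longrightarrow> (\<Sum>l\<le>i. M (l, Suc j)) \<le> (\<Sum>l<i. M (l, j)))"

lemma mon_fun_cong: "(\<And>v. v \<in> I \<Longrightarrow> x v = y v) \<Longrightarrow> mon_fun I M x = mon_fun I M y"
  by (simp add: mon_fun_def)

text \<open>
  Fix two adjacent columns \<open>a\<close> and \<open>b\<close> of \<open>A\<close>. For vectors
  \<open>p\<close>, \<open>q\<close>, \<open>w\<close> and scalars \<open>s\<close>,
  \<open>\<tau>\<close> with \<open>p\<close> supported above row \<open>i\<close> and
  \<open>q\<close> below it, invariance under column operations gives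
  \<open>f (p + s w, q + s \<tau> w) = f (p + s w, q - \<tau> p)\<close>, whose degree in
  \<open>s\<close> is at most the degree of \<open>f\<close> in the column \<open>a\<close>. Scale
  the variables by powers of a new variable \<open>E\<close> according to their weights, where
  \<open>\<tau>\<close> scales with the exponent \<open>i + 1\<close>. Then the coefficient of the
  highest power of \<open>E\<close> is the part of \<open>f\<close> of greatest height, evaluated
  at a matrix in which exactly the entries of \<open>a\<close> from row \<open>i\<close> on and
  the entries of \<open>b\<close> up to row \<open>i\<close> carry a factor \<open>s\<close>. The
  monomials remain distinct after this substitution, so each of them obeys the bound on the degree
  in \<open>s\<close>, and that bound is the semistandard condition at \<open>i\<close> and
  \<open>j\<close>.
\<close>

lemma top_exponents_semistandard:
  fixes c :: "(nat \<times> nat \<Rightarrow> nat) \<Rightarrow> 'k::field"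
  assumes inf: "infinite (UNIV :: 'k set)" and S: "finite S" "S \<subseteq> exponents n \<alpha> D"
    and f: "f = (\<lambda>A. \<Sum>M\<in>S. c M * mon_fun (cells n) M A)"
    and inv: "\<And>A x j. Suc j < n \<Longrightarrow> f (col_op j x A) = f A"
    and N: "\<And>M. M \<in> S \<Longrightarrow> height n M \<le> N"
    and M0: "M0 \<in> S" "height n M0 = N" "c M0 \<noteq> 0"
  shows "semistandard n M0"
  unfolding semistandard_def
proof (intro allI impI)
  fix j i assume j: "Suc j < n" and i: "i < n"
  let ?m = "Polynomial.monom"
  let ?C = "cells n"
  define flag where "flag = (\<lambda>(l, d). if d = j \<and> i \<le> l \<or> d = Suc j \<and> l \<le> i then 1 else 0 :: nat)"
  define sdeg where "sdeg M = (\<Sum>v\<in>?C. flag v * M v)" for M :: "nat \<times> nat \<Rightarrow> nat"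
  define top where "top = {M \<in> S. height n M = N}"
  have vanish: "(\<Sum>M\<in>{M \<in> top. sdeg M = d}. c M * mon_fun ?C M A) = 0"
    if d: "\<alpha> (Suc j) < d" and A: "A (i, j) \<noteq> 0" "A (i, Suc j) \<noteq> 0" for A d
  proof -
    \<comment> \<open>row \<open>i\<close> occurs in both columns with the same entry of \<open>w\<close>, which forces this value of \<open>\<tau>\<close>\<close>
    define \<tau> where "\<tau> = A (i, Suc j) / A (i, j)"
    have tau: "\<tau> \<noteq> 0" "\<tau> * A (i, j) = A (i, Suc j)" using A by (auto simp: \<tau>_def)
    define w where "w = weight n"
    have w1: "w (l, Suc j) = w (l, j) + Suc l" for l by (simp add: w_def weight_def)
    have w2: "Suc i \<le> w (l, Suc j)" for l using i by (simp add: w_def weight_def)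
    define P where "P = (\<lambda>(l, d).
      if d = j then (if l < i then ?m (?m (A (l, j)) 0) (w (l, j)) + ?m (?m (A (l, Suc j) / \<tau>) 1) (w (l, Suc j) - Suc i)
                     else ?m (?m (A (l, j)) 1) (w (l, j)))
      else if d = Suc j then (if l \<le> i then ?m (?m (A (l, Suc j)) 1) (w (l, Suc j))
                     else ?m (?m (A (l, Suc j)) 0) (w (l, Suc j)) + ?m (?m (\<tau> * A (l, j)) 1) (w (l, j) + Suc i))
      else ?m (?m (A (l, d)) 0) (w (l, d)))"
    \<comment> \<open>the terms of \<open>P\<close> that have the full weight in \<open>E\<close>\<close>
    define e where "e = (\<lambda>v. ?m (A v) (flag v))"
    have leadP: "lead (w v) (P v) (e v)" for v
    proof -
      obtain l d where v: "v = (l, d)" by (cases v)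
      consider "d = j" "l < i" | "d = j" "\<not> l < i" | "d = Suc j" "l \<le> i" | "d = Suc j" "\<not> l \<le> i"
        | "d \<noteq> j" "d \<noteq> Suc j" by linarith
      then show ?thesis
      proof cases
        case 1
        then have "w (l, Suc j) - Suc i < w (l, j)" using w1[of l] w2[of l] by simp
        with 1 show ?thesis
          by (auto simp: v lead_def P_def e_def flag_def intro!: degree_add_le order.trans[OF degree_monom_le])
      next
        case 4
        then have "w (l, j) + Suc i < w (l, Suc j)" using w1[of l] by simp
        with 4 show ?thesis
          by (auto simp: v lead_def P_def e_def flag_def intro!: degree_add_le order.trans[OF degree_monom_le])
      qed (auto simp: v lead_def P_def e_def flag_def intro!: order.trans[OF degree_monom_le])
    qed
    define Q where "Q = (\<Sum>M\<in>S. [:[:c M:]:] * mon_fun ?C M P)"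
    have bound: "degree (poly Q [:E:]) \<le> \<alpha> (Suc j)" for E
    proof -
      \<comment> \<open>the matrix after the column operation; the variable \<open>s\<close> is left in column \<open>j\<close> only\<close>
      define P' where "P' = (\<lambda>(l, d). if d = Suc j then
          (if l < i then [:- \<tau> * (E ^ Suc i * E ^ w (l, j)) * A (l, j):]
           else if l = i then 0 else [:E ^ w (l, Suc j) * A (l, Suc j):])
         else poly (P (l, d)) [:E:])"
      define Q' where "Q' = (\<Sum>M\<in>S. [:c M:] * mon_fun ?C M P')"
      have eval: "poly (poly (?m (?m a k) b) [:E:]) s = E ^ b * (a * s ^ k)" for a k b s
        by (simp add: poly_monom poly_const_pow mult_ac)
      have "poly (poly Q [:E:]) s = poly Q' s" for s
      proof -
        let ?A = "\<lambda>v. poly (poly (P v) [:E:]) s"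
        have "poly (P' v) s = col_op j (- \<tau> * E ^ Suc i) ?A v" for v
        proof -
          obtain l d where v: "v = (l, d)" by (cases v)
          consider "d = Suc j" "l < i" | "d = Suc j" "l = i" | "d = Suc j" "i < l" | "d \<noteq> Suc j" by linarith
          then show ?thesis
          proof cases
            case 1
            have 2: "E ^ Suc i * E ^ (w (l, Suc j) - Suc i) = E ^ w (l, Suc j)"
              using w2[of l] by (simp add: power_add[symmetric] del: power_Suc)
            have "col_op j (- \<tau> * E ^ Suc i) ?A v =
                E ^ w (l, Suc j) * (A (l, Suc j) * s) - \<tau> * E ^ Suc i * (E ^ w (l, j) * A (l, j))
                - (E ^ Suc i * E ^ (w (l, Suc j) - Suc i)) * (A (l, Suc j) * s)"
              using 1 tau by (simp add: v col_op_def P_def eval algebra_simps del: power_Suc)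
            also have "\<dots> = poly (P' v) s"
              using 1 by (simp only: 2) (simp add: v P'_def algebra_simps del: power_Suc)
            finally show ?thesis by simp
          next
            case 2
            have "col_op j (- \<tau> * E ^ Suc i) ?A v =
                E ^ w (i, Suc j) * (A (i, Suc j) * s) - E ^ (w (i, j) + Suc i) * (\<tau> * A (i, j) * s)"
              using 2 by (simp add: v col_op_def P_def eval algebra_simps power_add)
            also have "\<dots> = 0" using w1[of i] tau(2) by simp
            finally show ?thesis using 2 by (simp add: v P'_def)
          next
            case 3
            then show ?thesis
              by (simp add: v col_op_def P_def P'_def eval algebra_simps power_add)
          next
            case 4
            then show ?thesis by (simp add: v col_op_def P'_def)
          qed
        qed
        then have "poly Q' s = f (col_op j (- \<tau> * E ^ Suc i) ?A)"
          by (simp add: Q'_def f poly_sum poly_mon_fun)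
        also have "\<dots> = f ?A" by (rule inv[OF j])
        also have "\<dots> = poly (poly Q [:E:]) s"
          by (simp add: Q_def f poly_sum poly_mon_fun)
        finally show ?thesis by simp
      qed
      then have "poly Q [:E:] - Q' = 0" by (intro poly_eq_0_if_infinite[OF inf]) simp
      moreover have "degree Q' \<le> \<alpha> (Suc j)"
        unfolding Q'_def
      proof (rule degree_sum_le[OF S(1)])
        fix M assume M: "M \<in> S"
        have "lead (if snd v = j then 1 else 0) (P' v) (coeff (P' v) (if snd v = j then 1 else 0))" for v
        proof -
          obtain l d where v: "v = (l, d)" by (cases v)
          have "degree (poly (?m (?m a k) b) [:E:]) \<le> k" for a k b
            by (simp add: poly_monom poly_const_pow smult_monom degree_monom_le)
          moreover from this[of _ 0] have "degree (poly (?m (?m a 0) b) [:E:]) \<le> Suc 0" for a b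
            using le_SucI by blast
          ultimately show ?thesis
            by (auto simp: v lead_def P'_def P_def intro!: degree_add_le)
        qed
        then have "lead (\<Sum>v\<in>?C. (if snd v = j then 1 else 0) * M v) (mon_fun ?C M P')
            (mon_fun ?C M (\<lambda>v. coeff (P' v) (if snd v = j then 1 else 0)))"
          by (intro lead_mon_fun)
        then have "degree (mon_fun ?C M P') \<le> (\<Sum>v\<in>?C. (if snd v = j then 1 else 0) * M v)"
          by (simp add: lead_def)
        also have "\<dots> = (\<Sum>l<n. \<Sum>d<n. if d = j then M (l, d) else 0)"
          unfolding sum.cartesian_product by (intro sum.cong) auto
        also have "\<dots> = \<alpha> (Suc j)"
          using M S(2) j by (auto simp: exponents_def)
        finally show "degree ([:c M:] * mon_fun ?C M P') \<le> \<alpha> (Suc j)"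
          using degree_mult_le[of "[:c M:]" "mon_fun ?C M P'"] by simp
      qed
      ultimately show ?thesis by simp
    qed
    have "coeff Q N = (\<Sum>M\<in>S. [:c M:] * coeff (mon_fun ?C M P) N)"
      by (simp add: Q_def coeff_sum)
    also have "\<dots> = (\<Sum>M\<in>S. if height n M = N then ?m (c M * mon_fun ?C M A) (sdeg M) else 0)"
    proof (rule sum.cong[OF refl])
      fix M assume M: "M \<in> S"
      have l: "lead (height n M) (mon_fun ?C M P) (mon_fun ?C M e)"
        using lead_mon_fun[of ?C w P e M] leadP by (simp add: height_def w_def)
      have "mon_fun ?C M e = ?m (mon_fun ?C M A) (sdeg M)"
        by (simp add: e_def sdeg_def mon_fun_monom)
      then show "[:c M:] * coeff (mon_fun ?C M P) N =
          (if height n M = N then ?m (c M * mon_fun ?C M A) (sdeg M) else 0)"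
        using l N[OF M] by (auto simp: lead_def smult_monom coeff_eq_0)
    qed
    also have "\<dots> = (\<Sum>M\<in>top. ?m (c M * mon_fun ?C M A) (sdeg M))"
      using S(1) by (simp add: top_def sum.inter_filter)
    finally have "coeff (coeff Q N) d = (\<Sum>M\<in>top. if sdeg M = d then c M * mon_fun ?C M A else 0)"
      by (simp add: coeff_sum)
    also have "\<dots> = (\<Sum>M\<in>{M \<in> top. sdeg M = d}. c M * mon_fun ?C M A)"
      using S(1) by (subst sum.inter_filter[symmetric]) (auto simp: top_def)
    finally show ?thesis
      using degree_coeff_le[OF inf bound, of N] d by (simp add: coeff_eq_0)
  qed
  have vanish': "(\<Sum>M\<in>{M \<in> top. sdeg M = d}. c M * mon_fun ?C M A) = 0" if d: "\<alpha> (Suc j) < d" for A d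
  proof (rule polyfun_zero_on_dense[OF inf, where I = ?C and
        f = "\<lambda>A. \<Sum>M\<in>{M \<in> top. sdeg M = d}. c M * mon_fun ?C M A" and g = "\<lambda>A. A (i, j) * A (i, Suc j)" and ?x0.0 = "\<lambda>_. 1"])
    show "(\<lambda>A. \<Sum>M\<in>{M \<in> top. sdeg M = d}. c M * mon_fun ?C M A) \<in> polyfun ?C"
      by (intro fs_span_sum fs_span_scale fs.span_base) auto
    show "(\<lambda>A. A (i, j) * A (i, Suc j)) \<in> polyfun ?C"
      using i j by (intro polyfun_mult polyfun_var) auto
  qed (use vanish[OF d] in auto)
  have "sdeg M0 \<le> \<alpha> (Suc j)"
  proof (rule ccontr)
    assume "\<not> sdeg M0 \<le> \<alpha> (Suc j)"
    then have d: "\<alpha> (Suc j) < sdeg M0" by simp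
    have "c M0 = 0"
    proof (intro mon_independent[OF inf, of ?C "{M \<in> top. sdeg M = sdeg M0}" c M0])
      show "M v = 0" if "M \<in> {M \<in> top. sdeg M = sdeg M0}" "v \<notin> ?C" for M v
        using that S(2) unfolding top_def exponents_def by blast
    qed (use S(1) M0 vanish'[OF d] in \<open>auto simp: top_def\<close>)
    then show False using M0 by simp
  qed
  moreover have "sdeg M0 = (\<Sum>l\<in>{i..<n}. M0 (l, j)) + (\<Sum>l\<le>i. M0 (l, Suc j))"
  proof -
    have "sdeg M0 = (\<Sum>l<n. \<Sum>d<n. flag (l, d) * M0 (l, d))"
      by (simp add: sdeg_def sum.cartesian_product case_prod_beta)
    also have "\<dots> = (\<Sum>l<n. (if i \<le> l then M0 (l, j) else 0) + (if l \<le> i then M0 (l, Suc j) else 0))"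
    proof (rule sum.cong[OF refl])
      fix l
      have "(\<Sum>d<n. flag (l, d) * M0 (l, d)) =
          (\<Sum>d<n. (if d = j then (if i \<le> l then M0 (l, j) else 0) else 0) +
            (if d = Suc j then (if l \<le> i then M0 (l, Suc j) else 0) else 0))"
        by (intro sum.cong) (auto simp: flag_def)
      then show "(\<Sum>d<n. flag (l, d) * M0 (l, d)) =
          (if i \<le> l then M0 (l, j) else 0) + (if l \<le> i then M0 (l, Suc j) else 0)"
        using j by (simp add: sum.distrib)
    qed
    also have "\<dots> = (\<Sum>l\<in>{l \<in> {..<n}. i \<le> l}. M0 (l, j)) + (\<Sum>l\<in>{l \<in> {..<n}. l \<le> i}. M0 (l, Suc j))"
      unfolding sum.distrib by (simp only: sum.inter_filter finite_lessThan)
    also have "{l \<in> {..<n}. i \<le> l} = {i..<n}" by auto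
    also have "{l \<in> {..<n}. l \<le> i} = {..i}" using i by auto
    finally show ?thesis .
  qed
  moreover have "\<alpha> (Suc j) = (\<Sum>l<i. M0 (l, j)) + (\<Sum>l\<in>{i..<n}. M0 (l, j))"
  proof -
    have "\<alpha> (Suc j) = (\<Sum>l<n. M0 (l, j))" using M0(1) S(2) j by (auto simp: exponents_def)
    also have "{..<n} = {..<i} \<union> {i..<n}" using i by auto
    finally show ?thesis by (simp add: sum.union_disjoint ivl_disj_int)
  qed
  ultimately show "(\<Sum>l\<le>i. M0 (l, Suc j)) \<le> (\<Sum>l<i. M0 (l, j))" by simp
qed

section \<open>Semi-invariants are spanned by bideterminants\<close>

text \<open>
  The tableau with weakly increasing rows in which the value \<open>l\<close> occurs
  \<open>M (l, c)\<close> times in row \<open>c\<close>.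
\<close>

definition tableau_of :: "(nat \<Rightarrow> nat) \<Rightarrow> (nat \<times> nat \<Rightarrow> nat) \<Rightarrow> filling" where
  "tableau_of \<mu> M = (\<lambda>b\<in>young_diagram \<mu>. LEAST l. snd b \<le> (\<Sum>l'\<le>l. M (l', box_row b)))"

lemma tableau_of_le_iff:
  assumes mu: "\<mu> \<in> partitions n" and M: "M \<in> exponents n \<mu> D" and b: "b \<in> young_diagram \<mu>"
  shows "tableau_of \<mu> M b \<le> l \<longleftrightarrow> snd b \<le> (\<Sum>l'\<le>l. M (l', box_row b))"
    and "tableau_of \<mu> M b < n"
proof -
  let ?s = "\<lambda>l. \<Sum>l'\<le>l. M (l', box_row b)"
  have n: "0 < n" using box_row_less[OF mu b] by simp
  have "{..<n} = {..n - 1}" using n by auto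
  then have "\<mu> (Suc (box_row b)) = ?s (n - 1)"
    using M box_row_less[OF mu b] by (auto simp: exponents_def)
  then have ex: "snd b \<le> ?s (n - 1)"
    using b fst_eq_Suc_row[OF mu b] by (cases b) (auto simp: young_diagram_def)
  have t: "tableau_of \<mu> M b = (LEAST l. snd b \<le> ?s l)" using b by (simp add: tableau_of_def)
  have least: "snd b \<le> ?s (tableau_of \<mu> M b)"
    unfolding t by (rule LeastI[where P = "\<lambda>l. snd b \<le> ?s l", OF ex])
  have "?s l \<le> ?s l'" if "l \<le> l'" for l l'
    using that by (intro sum_mono2) auto
  then show "tableau_of \<mu> M b \<le> l \<longleftrightarrow> snd b \<le> ?s l"
    using least Least_le[where P = "\<lambda>l. snd b \<le> ?s l", of l] t by (metis order.trans)
  have "tableau_of \<mu> M b \<le> n - 1"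
    unfolding t by (rule Least_le[where P = "\<lambda>l. snd b \<le> ?s l", OF ex])
  then show "tableau_of \<mu> M b < n" using n by simp
qed

lemma tableau_of_fillings:
  assumes mu: "\<mu> \<in> partitions n" and M: "M \<in> exponents n \<mu> D"
  shows "tableau_of \<mu> M \<in> fillings n \<mu>"
  using tableau_of_le_iff(2)[OF mu M] by (auto simp: fillings_def) (simp add: tableau_of_def)

lemma expo_tableau_of:
  assumes mu: "\<mu> \<in> partitions n" and M: "M \<in> exponents n \<mu> D"
  shows "expo \<mu> (tableau_of \<mu> M) = M"
proof
  fix v :: "nat \<times> nat"
  obtain l c where v: "v = (l, c)" by (cases v)
  let ?T = "tableau_of \<mu> M"
  show "expo \<mu> ?T v = M v"
  proof (cases "v \<in> cells n")
    case False
    then show ?thesis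
      using M expo_exponents[OF mu tableau_of_fillings[OF mu M]] unfolding exponents_def by (simp del: split_paired_All)
  next
    case True
    then have l: "l < n" "c < n" by (auto simp: v)
    let ?s = "\<lambda>l. \<Sum>l'<l. M (l', c)"
    have s: "(\<Sum>l'\<le>l. M (l', c)) = ?s l + M (l, c)"
      by (simp flip: lessThan_Suc_atMost)
    have "?s l + M (l, c) \<le> (\<Sum>l'<n. M (l', c))"
      unfolding s[symmetric] using l by (intro sum_mono2) auto
    also have "\<dots> = \<mu> (Suc c)" using M l by (auto simp: exponents_def)
    finally have le: "?s l + M (l, c) \<le> \<mu> (Suc c)" .
    have lt: "?T b < l \<longleftrightarrow> snd b \<le> ?s l" if b: "b \<in> young_diagram \<mu>" "box_row b = c" for b
    proof (cases l)
      case 0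
      then show ?thesis using b by (cases b) (auto simp: young_diagram_def)
    next
      case (Suc k)
      then show ?thesis
        using tableau_of_le_iff(1)[OF mu M b(1), of k] b(2) by (simp add: lessThan_Suc_atMost less_Suc_eq_le)
    qed
    have "{b \<in> young_diagram \<mu>. (?T b, box_row b) = v} = {Suc c} \<times> {?s l<..?s l + M (l, c)}"
      (is "?L = ?R")
    proof (rule Set.set_eqI)
      fix b
      have "b \<in> ?L \<longleftrightarrow> b \<in> young_diagram \<mu> \<and> box_row b = c \<and> ?T b \<le> l \<and> \<not> ?T b < l"
        by (auto simp: v)
      also have "\<dots> \<longleftrightarrow> b \<in> young_diagram \<mu> \<and> box_row b = c \<and> snd b \<le> ?s l + M (l, c) \<and> \<not> snd b \<le> ?s l"
        using lt[of b] tableau_of_le_iff(1)[OF mu M, of b l] s by auto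
      also have "\<dots> \<longleftrightarrow> b \<in> ?R"
        using le l by (cases b) (auto simp: young_diagram_eq[OF mu] box_row_def)
      finally show "b \<in> ?L \<longleftrightarrow> b \<in> ?R" .
    qed
    then show ?thesis by (simp only: pair_count_def card_cartesian_product) (simp add: v)
  qed
qed

lemma tableau_of_column_strict:
  assumes mu: "\<mu> \<in> partitions n" and M: "M \<in> exponents n \<mu> D" and ss: "semistandard n M"
    and b: "b1 \<in> young_diagram \<mu>" "b2 \<in> young_diagram \<mu>" "snd b1 = snd b2" "box_row b1 < box_row b2"
  shows "tableau_of \<mu> M b1 < tableau_of \<mu> M b2"
proof -
  let ?T = "tableau_of \<mu> M"
  have step: "?T (Suc i, c) < ?T (Suc (Suc i), c)" if y: "(Suc (Suc i), c) \<in> young_diagram \<mu>" for i c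
  proof -
    define l where "l = ?T (Suc (Suc i), c)"
    have y': "(Suc i, c) \<in> young_diagram \<mu>" using young_diagram_up[OF mu y] by simp
    have i: "Suc i < n" using box_row_less[OF mu y] by (simp add: box_row_def)
    have l: "l < n" using tableau_of_le_iff(2)[OF mu M y] by (simp add: l_def)
    have "c \<le> (\<Sum>l'\<le>l. M (l', Suc i))"
      using tableau_of_le_iff(1)[OF mu M y, of l] by (simp add: l_def box_row_def)
    also have "\<dots> \<le> (\<Sum>l'<l. M (l', i))"
      using ss i l by (auto simp: semistandard_def)
    finally have c: "c \<le> (\<Sum>l'<l. M (l', i))" .
    have "1 \<le> c" using y by (simp add: young_diagram_def)
    with c obtain k where k: "l = Suc k" by (cases l) auto
    then have "?T (Suc i, c) \<le> k"
      using c tableau_of_le_iff(1)[OF mu M y', of k] by (simp add: box_row_def lessThan_Suc_atMost)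
    then show ?thesis using k by (simp add: l_def)
  qed
  have gen: "?T (Suc i, c) < ?T (Suc (i + Suc k), c)" if "(Suc (i + Suc k), c) \<in> young_diagram \<mu>" for i c k
    using that
  proof (induction k)
    case 0
    then show ?case using step by simp
  next
    case (Suc k)
    have "(Suc (i + Suc k), c) \<in> young_diagram \<mu>"
      using young_diagram_up[OF mu Suc.prems] by simp
    then show ?case using Suc.IH step[of "i + Suc k" c] Suc.prems by simp
  qed
  obtain k where k: "box_row b2 = box_row b1 + Suc k" using b(4) less_iff_Suc_add by auto
  have "b1 = (Suc (box_row b1), snd b1)" "b2 = (Suc (box_row b1 + Suc k), snd b1)"
    using fst_eq_Suc_row[OF mu] b k by (metis prod.collapse)+
  then show ?thesis using gen[of "box_row b1" k "snd b1"] b(2) by metis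
qed

text \<open>
  Take a box moved by \<open>\<sigma>\<close> in the highest possible row, together with its
  preimage: both the image and the preimage of that box lie in lower rows.
\<close>

lemma column_inversion:
  assumes mu: "\<mu> \<in> partitions n" and s: "\<sigma> \<in> col_perms \<mu>" "\<sigma> \<noteq> id"
  obtains b1 b2 where "b1 \<in> young_diagram \<mu>" "b2 \<in> young_diagram \<mu>" "snd b1 = snd b2"
    "box_row b1 < box_row b2" "box_row (\<sigma> b2) < box_row (\<sigma> b1)" "box_row (\<sigma> b2) < box_row b2"
proof -
  let ?Y = "young_diagram \<mu>"
  have p: "\<sigma> permutes ?Y" and col: "\<And>b. snd (\<sigma> b) = snd b"
    using s(1) by (auto simp: col_perms_def simp del: split_paired_All)
  obtain b where b: "\<sigma> b \<noteq> b" "\<And>b'. \<sigma> b' \<noteq> b' \<Longrightarrow> box_row b \<le> box_row b'"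
  proof -
    have "\<exists>b. \<sigma> b \<noteq> b" using s(2) by (auto simp: fun_eq_iff)
    then show thesis
      using that ex_has_least_nat[of "\<lambda>b. \<sigma> b \<noteq> b" _ box_row] by metis
  qed
  have inY: "b' \<in> ?Y" if "\<sigma> b' \<noteq> b'" for b'
    using that p by (meson permutes_not_in)
  have eqI: "x = y" if "x \<in> ?Y" "y \<in> ?Y" "snd x = snd y" "box_row x = box_row y" for x y
    using that fst_eq_Suc_row[OF mu] by (metis prod.expand)
  have sY: "\<sigma> b \<in> ?Y" using inY[OF b(1)] p by (simp add: permutes_in_image)
  have s_moves: "\<sigma> (\<sigma> b) \<noteq> \<sigma> b" using b(1) p by (metis permutes_def)
  have lt1: "box_row b < box_row (\<sigma> b)"
    using b(2)[OF s_moves] eqI[OF sY inY[OF b(1)] col] b(1) by (metis le_neq_implies_less)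
  obtain b2 where b2: "\<sigma> b2 = b" using p by (metis permutes_def)
  have m2: "\<sigma> b2 \<noteq> b2" using b2 b(1) by metis
  have "snd b2 = snd b" using col[of b2] b2 by simp
  then have lt2: "box_row b < box_row b2"
    using b(2)[OF m2] eqI[OF inY[OF m2] inY[OF b(1)]] b2 b(1) by (metis le_neq_implies_less)
  show thesis
    using that[OF inY[OF b(1)] inY[OF m2]] \<open>snd b2 = snd b\<close> lt1 lt2 b2 by simp
qed

text \<open>
  The rearrangement inequality: exchanging the two boxes of an inversion increases the height, so
  the height is greatest at the identity and only there.
\<close>

lemma height_expo_less:
  assumes mu: "\<mu> \<in> partitions n" and T: "T \<in> fillings n \<mu>"
    and strict: "\<And>b1 b2. b1 \<in> young_diagram \<mu> \<Longrightarrow> b2 \<in> young_diagram \<mu> \<Longrightarrow> snd b1 = snd b2 \<Longrightarrow>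
      box_row b1 < box_row b2 \<Longrightarrow> T b1 < T b2"
    and s: "\<sigma> \<in> col_perms \<mu>" "\<sigma> \<noteq> id"
  shows "height n (expo \<mu> (T \<circ> \<sigma>)) < height n (expo \<mu> T)"
proof -
  let ?Y = "young_diagram \<mu>"
  define G where "G \<sigma> = (\<Sum>b\<in>?Y. weight n (T (\<sigma> b), box_row b))" for \<sigma>
  have G: "height n (expo \<mu> (T \<circ> \<sigma>)) = G \<sigma>" if "\<sigma> \<in> col_perms \<mu>" for \<sigma>
    using sum_eq_sum_pair_count[where S = "T \<circ> \<sigma>" and R = box_row and F = "weight n",
        OF mu filling_box_row_less[OF mu, of "T \<circ> \<sigma>"]] T that
    by (simp add: height_def G_def fillings_comp_permutes col_perms_permutes)
  have improve: "\<exists>\<sigma>'\<in>col_perms \<mu>. G \<sigma> < G \<sigma>'" if s: "\<sigma> \<in> col_perms \<mu>" "\<sigma> \<noteq> id" for \<sigma>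
  proof -
    obtain b1 b2 where b: "b1 \<in> ?Y" "b2 \<in> ?Y" "snd b1 = snd b2" "box_row b1 < box_row b2"
        "box_row (\<sigma> b2) < box_row (\<sigma> b1)"
      using column_inversion[OF mu s] by metis
    have p: "\<sigma> permutes ?Y" and col: "\<And>b. snd (\<sigma> b) = snd b"
      using s(1) by (auto simp: col_perms_def simp del: split_paired_All)
    let ?t = "transpose b1 b2"
    have ne: "b1 \<noteq> b2" using b(4) by auto
    have "snd (?t b) = snd b" for b using b(3) by (auto simp: transpose_def)
    then have mem: "\<sigma> \<circ> ?t \<in> col_perms \<mu>"
      using col permutes_compose[OF permutes_swap_id[OF b(1,2)] p]
      by (simp add: col_perms_def del: split_paired_All)
    have "T (\<sigma> b2) < T (\<sigma> b1)"
      using strict[of "\<sigma> b2" "\<sigma> b1"] b col p by (simp add: permutes_in_image)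
    then obtain x where x: "T (\<sigma> b1) = T (\<sigma> b2) + Suc x" using less_iff_Suc_add by auto
    obtain y where y: "box_row b2 = box_row b1 + Suc y" using b(4) less_iff_Suc_add by auto
    have split: "G \<rho> = weight n (T (\<rho> b1), box_row b1) + (weight n (T (\<rho> b2), box_row b2)
        + (\<Sum>b\<in>?Y - {b1} - {b2}. weight n (T (\<rho> b), box_row b)))" for \<rho>
      unfolding G_def using b ne finite_young_diagram[OF mu]
      by (subst sum.remove[of _ b1], simp, simp, subst sum.remove[of _ b2], auto)
    have rest: "(\<Sum>b\<in>?Y - {b1} - {b2}. weight n (T ((\<sigma> \<circ> ?t) b), box_row b)) =
        (\<Sum>b\<in>?Y - {b1} - {b2}. weight n (T (\<sigma> b), box_row b))"
      by (intro sum.cong) (auto simp: transpose_def)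
    have "G \<sigma> < G (\<sigma> \<circ> ?t)"
      unfolding split rest by (simp add: x y weight_def algebra_simps)
    then show ?thesis using mem by blast
  qed
  have "G \<sigma> \<le> G id" if "\<sigma> \<in> col_perms \<mu>" for \<sigma>
  proof -
    have fin: "finite (G ` col_perms \<mu>)" "G ` col_perms \<mu> \<noteq> {}"
      using finite_col_perms[OF mu] id_in_col_perms by auto
    obtain \<rho> where r: "\<rho> \<in> col_perms \<mu>" "G \<rho> = Max (G ` col_perms \<mu>)"
      using Max_in[OF fin] by auto
    have max: "G \<rho>' \<le> G \<rho>" if "\<rho>' \<in> col_perms \<mu>" for \<rho>'
      using r(2) Max_ge[OF fin(1)] that by simp
    have "\<rho> = id" using improve[OF r(1)] max by (meson leD)
    then show ?thesis using max[OF that] by simp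
  qed
  then have "G \<sigma> < G id" using improve[OF s] by (metis leD le_less_linear order.strict_trans1)
  then show ?thesis using G[OF s(1)] G[OF id_in_col_perms] by simp
qed

lemma graded_cong:
  assumes "f \<in> graded n \<alpha> D" "\<And>v. v \<in> cells n \<Longrightarrow> A v = B v"
  shows "f A = f B"
proof -
  obtain S c where "finite S" "S \<subseteq> exponents n \<alpha> D" "f = (\<lambda>A. \<Sum>M\<in>S. c M * mon_fun (cells n) M A)"
    by (rule fs_span_image_explicit[OF assms(1)])
  then show ?thesis using mon_fun_cong[of "cells n" A B] assms(2) by simp
qed

lemma col_op_invariant:
  assumes f: "f \<in> graded n \<alpha> D" "semi_invariant n \<alpha> f" and j: "Suc j < n"
  shows "f (col_op j x A) = f A"
proof -
  define E where "E = (\<lambda>(i, k). if i = k then 1 else if i = j \<and> k = Suc j then x else 0)"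
  have "f (col_op j x A) = f (mat_mult n A E)"
  proof (rule graded_cong[OF f(1)])
    fix v assume v: "v \<in> cells n"
    obtain l d where ld: "v = (l, d)" by (cases v)
    have "(\<Sum>k<n. A (l, k) * E (k, d)) =
        (\<Sum>k<n. (if k = d then A (l, k) else 0) + (if k = j then (if d = Suc j then x * A (l, j) else 0) else 0))"
      by (intro sum.cong) (auto simp: E_def)
    also have "\<dots> = A (l, d) + (if d = Suc j then x * A (l, j) else 0)"
      using v j by (simp add: ld sum.distrib)
    finally show "col_op j x A v = mat_mult n A E v"
      by (simp add: ld col_op_def mat_mult_def)
  qed
  also have "\<dots> = chi n \<alpha> E * f A"
    using f(2) by (auto simp: semi_invariant_def borel_def E_def)
  also have "chi n \<alpha> E = 1" by (simp add: chi_def E_def)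
  finally show ?thesis by simp
qed

text \<open>
  The diagonal term of the bideterminant of a column strict tableau is its only term of greatest
  height.
\<close>

lemma bidet_tableau_of:
  assumes mu: "\<mu> \<in> partitions n" and M: "M \<in> exponents n \<mu> D" and ss: "semistandard n M"
  shows "(\<lambda>A. bidet \<mu> (tableau_of \<mu> M) A - mon_fun (cells n) M A)
    \<in> fs.span (mon_fun (cells n) ` {M' \<in> exponents n \<mu> D. height n M' < height n M})"
proof -
  let ?T = "tableau_of \<mu> M" and ?C = "col_perms \<mu>"
  note T = tableau_of_fillings[OF mu M] and e = expo_tableau_of[OF mu M]
  have mom: "moment \<mu> ?T = D"
    using expo_exponents[OF mu T] M by (simp add: e exponents_def)
  have "bidet \<mu> ?T A - mon_fun (cells n) M A =
      (\<Sum>\<sigma>\<in>?C - {id}. of_int (sign \<sigma>) * mon_fun (cells n) (expo \<mu> (?T \<circ> \<sigma>)) A)" for A :: "nat \<times> nat \<Rightarrow> 'a"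
    unfolding bidet_eq_sum_mon[OF mu T]
    using sum.remove[OF finite_col_perms[OF mu] id_in_col_perms,
        of "\<lambda>\<sigma>. of_int (sign \<sigma>) * mon_fun (cells n) (expo \<mu> (?T \<circ> \<sigma>)) A"]
    by (simp add: e)
  moreover have "(\<lambda>A. \<Sum>\<sigma>\<in>?C - {id}. of_int (sign \<sigma>) * mon_fun (cells n) (expo \<mu> (?T \<circ> \<sigma>)) A)
      \<in> fs.span (mon_fun (cells n) ` {M' \<in> exponents n \<mu> D. height n M' < height n M})"
  proof (intro fs_span_sum fs_span_scale fs.span_base imageI CollectI conjI)
    fix \<sigma> assume s: "\<sigma> \<in> ?C - {id}"
    then have p: "\<sigma> permutes young_diagram \<mu>" by (simp add: col_perms_permutes)
    show "expo \<mu> (?T \<circ> \<sigma>) \<in> exponents n \<mu> D"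
      using expo_exponents[OF mu, of "?T \<circ> \<sigma>"] T mom
      by (simp add: fillings_comp_permutes[OF p] moment_comp[OF p])
    show "height n (expo \<mu> (?T \<circ> \<sigma>)) < height n M"
    proof -
      have "height n (expo \<mu> (?T \<circ> \<sigma>)) < height n (expo \<mu> ?T)"
        by (rule height_expo_less[OF mu T tableau_of_column_strict[OF mu M ss]]) (use s in simp_all)
      then show ?thesis unfolding e .
    qed
  qed
  ultimately show ?thesis by simp
qed

text \<open>
  The leading exponents of a semi-invariant are semistandard, hence so many multiples of
  bideterminants can be subtracted that all terms of greatest height disappear. The remainder is
  again a semi-invariant, and the process ends because heights are natural numbers.
\<close>

theorem semi_invariants_spanned_by_bidets:
  fixes f :: "('k::field entries) \<Rightarrow> 'k"
  assumes inf: "infinite (UNIV :: 'k set)" and mu: "\<mu> \<in> partitions n"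
    and f: "f \<in> graded n \<mu> D" "semi_invariant n \<mu> f"
  shows "f \<in> fs.span (bidet \<mu> ` {T \<in> fillings n \<mu>. moment \<mu> T = D})"
proof -
  let ?B = "bidet \<mu> ` {T \<in> fillings n \<mu>. moment \<mu> T = D}"
  let ?m = "mon_fun (cells n)"
  let ?below = "\<lambda>N. fs.span (?m ` {M \<in> exponents n \<mu> D. height n M < N})"
  have main: "f \<in> fs.span ?B" if "f \<in> ?below N" "semi_invariant n \<mu> f" for N and f :: "('k entries) \<Rightarrow> 'k"
    using that
  proof (induction N arbitrary: f)
    case 0
    then show ?case using fs_span_zero by (auto simp: fs.span_empty zero_fun_def)
  next
    case (Suc N)
    obtain S c where S: "finite S" "S \<subseteq> {M \<in> exponents n \<mu> D. height n M < Suc N}"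
      and fS: "f = (\<lambda>A. \<Sum>M\<in>S. c M * ?m M A)"
      by (rule fs_span_image_explicit[OF Suc.prems(1)])
    define top where "top = {M \<in> S. height n M = N \<and> c M \<noteq> 0}"
    have fg: "f \<in> graded n \<mu> D"
      using Suc.prems(1) fs.span_mono[of "?m ` {M \<in> exponents n \<mu> D. height n M < Suc N}" "?m ` exponents n \<mu> D"]
      by auto
    have ss: "semistandard n M" "M \<in> exponents n \<mu> D" "height n M = N" if "M \<in> top" for M
    proof -
      show "semistandard n M"
        by (rule top_exponents_semistandard[OF inf S(1) _ fS col_op_invariant[OF fg Suc.prems(2)], where N = N])
          (use S(2) that in \<open>auto simp: top_def\<close>)
    qed (use that S(2) in \<open>auto simp: top_def\<close>)
    let ?b = "\<lambda>M. bidet \<mu> (tableau_of \<mu> M) :: ('k entries) \<Rightarrow> 'k"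
    define g where "g = (\<lambda>A. f A - (\<Sum>M\<in>top. c M * ?b M A))"
    have "g = (\<lambda>A. (\<Sum>M\<in>S - top. c M * ?m M A) - (\<Sum>M\<in>top. c M * (?b M A - ?m M A)))"
    proof
      fix A
      have "(\<Sum>M\<in>S. c M * ?m M A) = (\<Sum>M\<in>S - top. c M * ?m M A) + (\<Sum>M\<in>top. c M * ?m M A)"
        by (rule sum.subset_diff) (use S(1) in \<open>auto simp: top_def\<close>)
      then show "g A = (\<Sum>M\<in>S - top. c M * ?m M A) - (\<Sum>M\<in>top. c M * (?b M A - ?m M A))"
        by (simp add: g_def fS right_diff_distrib sum_subtractf)
    qed
    moreover have "(\<lambda>A. (\<Sum>M\<in>S - top. c M * ?m M A) - (\<Sum>M\<in>top. c M * (?b M A - ?m M A))) \<in> ?below N"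
    proof (intro fs_span_diff fs_span_sum)
      fix M assume M: "M \<in> S - top"
      show "(\<lambda>A. c M * ?m M A) \<in> ?below N"
      proof (cases "c M = 0")
        case True
        then show ?thesis by (simp add: fs_span_zero)
      next
        case False
        then show ?thesis
          using M S(2) by (intro fs_span_scale fs.span_base) (auto simp: top_def less_Suc_eq)
      qed
    next
      fix M assume M: "M \<in> top"
      show "(\<lambda>A. c M * (?b M A - ?m M A)) \<in> ?below N"
        using bidet_tableau_of[OF mu ss(2,1)[OF M]] ss(3)[OF M] by (intro fs_span_scale) simp
    qed
    ultimately have g1: "g \<in> ?below N" by simp
    have "semi_invariant n \<mu> g"
      using Suc.prems(2)
      by (auto simp: semi_invariant_def g_def bidet_mat_mult_borel[OF mu] sum_distrib_left
          right_diff_distrib mult.left_commute)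
    then have g2: "g \<in> fs.span ?B" by (rule Suc.IH[OF g1])
    have "?b M \<in> fs.span ?B" if M: "M \<in> top" for M
    proof -
      note T = tableau_of_fillings[OF mu ss(2)[OF M]]
      have "moment \<mu> (tableau_of \<mu> M) = D"
        using expo_exponents[OF mu T] ss(2)[OF M] by (simp add: expo_tableau_of[OF mu ss(2)[OF M]] exponents_def)
      then show ?thesis using T by (auto intro!: fs.span_base)
    qed
    then have "(\<lambda>A. g A + (\<Sum>M\<in>top. c M * ?b M A)) \<in> fs.span ?B"
      using g2 by (intro fs_span_add fs_span_sum fs_span_scale)
    then show ?case by (simp add: g_def)
  qed
  obtain S c where S: "finite S" "S \<subseteq> exponents n \<mu> D" "f = (\<lambda>A. \<Sum>M\<in>S. c M * ?m M A)"
    by (rule fs_span_image_explicit[OF f(1)])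
  have "height n M < Suc (\<Sum>M\<in>S. height n M)" if "M \<in> S" for M
    using member_le_sum[OF that, of "height n"] S(1) by simp
  then have "f \<in> ?below (Suc (\<Sum>M\<in>S. height n M))"
    unfolding S(3) using S(2) by (intro fs_span_sum fs_span_scale fs.span_base) auto
  then show ?thesis using main f(2) by blast
qed

text \<open>
  A semistandard exponent is lower triangular: row \<open>c\<close> of a tableau with strictly
  increasing columns contains no value below \<open>c\<close>.
\<close>

lemma semi_invariant_leading_exponent:
  fixes f :: "('k::field entries) \<Rightarrow> 'k"
  assumes inf: "infinite (UNIV :: 'k set)" and f: "f \<in> graded n \<mu> D" "semi_invariant n \<mu> f"
    and nz: "f A0 \<noteq> 0"
  obtains S c M where "finite S" "S \<subseteq> exponents n \<mu> D" "f = (\<lambda>A. \<Sum>M\<in>S. c M * mon_fun (cells n) M A)"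
    "M \<in> S" "c M \<noteq> 0" "\<forall>l d. l < d \<longrightarrow> d < n \<longrightarrow> M (l, d) = 0"
proof -
  obtain S0 c where S0: "finite S0" "S0 \<subseteq> exponents n \<mu> D" "f = (\<lambda>A. \<Sum>M\<in>S0. c M * mon_fun (cells n) M A)"
    by (rule fs_span_image_explicit[OF f(1)])
  define S where "S = {M \<in> S0. c M \<noteq> 0}"
  have S: "finite S" "S \<subseteq> exponents n \<mu> D" using S0 by (auto simp: S_def)
  have fS: "f = (\<lambda>A. \<Sum>M\<in>S. c M * mon_fun (cells n) M A)"
    unfolding S0(3) S_def by (rule ext, rule sum.mono_neutral_right) (use S0(1) in auto)
  have "S \<noteq> {}" using nz fS by auto
  then have ne: "finite (height n ` S)" "height n ` S \<noteq> {}" using S by auto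
  obtain M where M: "M \<in> S" "height n M = Max (height n ` S)" using Max_in[OF ne] by auto
  have ss: "semistandard n M"
    by (rule top_exponents_semistandard[OF inf S fS col_op_invariant[OF f]])
      (use M ne in \<open>auto simp: S_def\<close>)
  have "(\<Sum>l<d. M (l, d)) = 0" if "d < n" for d
    using that
  proof (induction d)
    case (Suc d)
    have "(\<Sum>l\<le>d. M (l, Suc d)) \<le> (\<Sum>l<d. M (l, d))"
      using ss Suc.prems by (auto simp: semistandard_def)
    then show ?case using Suc by (simp add: lessThan_Suc_atMost)
  qed simp
  then have "\<forall>l d. l < d \<longrightarrow> d < n \<longrightarrow> M (l, d) = 0" by auto
  then show thesis using that[OF S fS M(1)] M(1) by (auto simp: S_def)
qed

lemma semi_invariant_moment_ge:
  fixes f :: "('k::field entries) \<Rightarrow> 'k"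
  assumes inf: "infinite (UNIV :: 'k set)" and f: "f \<in> graded n \<mu> D" "semi_invariant n \<mu> f"
    and nz: "f A0 \<noteq> 0"
  shows "min_moment n \<mu> \<le> D"
proof -
  obtain S c M where "finite S" and S: "S \<subseteq> exponents n \<mu> D"
    and "f = (\<lambda>A. \<Sum>M\<in>S. c M * mon_fun (cells n) M A)"
    and MS: "M \<in> S" and "c M \<noteq> 0" and low: "\<forall>l d. l < d \<longrightarrow> d < n \<longrightarrow> M (l, d) = 0"
    by (rule semi_invariant_leading_exponent[OF assms])
  note M = S MS low
  have "min_moment n \<mu> = (\<Sum>d<n. \<Sum>l<n. d * M (l, d))"
    using M(1,2) by (auto simp: min_moment_def exponents_def sum_distrib_left[symmetric] intro!: sum.cong)
  also have "\<dots> = (\<Sum>l<n. \<Sum>d<n. d * M (l, d))" by (rule sum.swap)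
  also have "\<dots> \<le> (\<Sum>l<n. \<Sum>d<n. l * M (l, d))"
  proof (intro sum_mono)
    fix l d assume "l \<in> {..<n}" "d \<in> {..<n}"
    then show "d * M (l, d) \<le> l * M (l, d)" using M(3) by (cases "l < d") auto
  qed
  also have "\<dots> = D"
    using M(1,2) by (auto simp: exponents_def sum.cartesian_product)
  finally show ?thesis .
qed

definition unilower :: "('k::field entries) \<Rightarrow> 'k entries" where
  "unilower y = (\<lambda>(l, d). if l = d then 1 else if d < l then y (l, d) else 0)"

text \<open>
  By semi-invariance \<open>f\<close> vanishes on the lower triangular matrices with nonzero
  diagonal, hence on all lower triangular matrices; but there the terms with lower triangular
  exponents survive, and if \<open>f\<close> is nonzero then its leading exponent is one of them.
\<close>

lemma semi_invariant_zero_if_zero_on_unilower: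
  fixes f :: "('k::field entries) \<Rightarrow> 'k"
  assumes inf: "infinite (UNIV :: 'k set)" and f: "f \<in> graded n \<mu> D" "semi_invariant n \<mu> f"
    and zero: "\<And>y. f (unilower y) = 0"
  shows "f A0 = 0"
proof (rule ccontr)
  assume nz: "f A0 \<noteq> 0"
  obtain S c M where S: "finite S" "S \<subseteq> exponents n \<mu> D" "f = (\<lambda>A. \<Sum>M\<in>S. c M * mon_fun (cells n) M A)"
    and M: "M \<in> S" "c M \<noteq> 0" "\<forall>l d. l < d \<longrightarrow> d < n \<longrightarrow> M (l, d) = 0"
    by (rule semi_invariant_leading_exponent[OF inf f nz])
  define lower where "lower = {M \<in> S. \<forall>l d. l < d \<longrightarrow> d < n \<longrightarrow> M (l, d) = 0}"
  define low where "low A = (\<lambda>(l, d). if d \<le> l then A (l, d) else 0)" for A :: "'k entries"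
  have flow: "f (low A) = (\<Sum>M\<in>lower. c M * mon_fun (cells n) M A)" for A
  proof -
    have "mon_fun (cells n) M (low A) = (if M \<in> lower then mon_fun (cells n) M A else 0)" if M: "M \<in> S" for M
    proof (cases "M \<in> lower")
      case True
      then show ?thesis by (auto simp: mon_fun_def low_def lower_def intro!: prod.cong)
    next
      case False
      then obtain l d where "l < d" "d < n" "M (l, d) \<noteq> 0" using M by (auto simp: lower_def)
      then have "low A (l, d) ^ M (l, d) = 0" "(l, d) \<in> cells n" by (auto simp: low_def)
      then have "mon_fun (cells n) M (low A) = 0"
        unfolding mon_fun_def by (meson finite_SigmaI finite_lessThan prod_zero)
      then show ?thesis using False by simp
    qed
    then have "f (low A) = (\<Sum>M\<in>S. if M \<in> lower then c M * mon_fun (cells n) M A else 0)"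
      unfolding S(3) by (intro sum.cong) auto
    also have "\<dots> = (\<Sum>M\<in>lower. c M * mon_fun (cells n) M A)"
      using S(1) by (intro sum.mono_neutral_cong_right) (auto simp: lower_def)
    finally show ?thesis .
  qed
  have diag: "f (low A) = 0" if A: "(\<Prod>d<n. A (d, d)) \<noteq> 0" for A
  proof -
    define t where "t = (\<lambda>(l, d). if l = d then A (d, d) else 0)"
    define y where "y = (\<lambda>(l, d). A (l, d) / A (d, d))"
    have "f (low A) = f (mat_mult n (unilower y) t)"
    proof (rule graded_cong[OF f(1)])
      fix v assume v: "v \<in> cells n"
      obtain l d where ld: "v = (l, d)" by (cases v)
      have "A (d, d) \<noteq> 0" using A v by (auto simp: ld)
      moreover have "(\<Sum>k<n. unilower y (l, k) * t (k, d)) = (\<Sum>k<n. if k = d then unilower y (l, d) * A (d, d) else 0)"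
        by (intro sum.cong) (auto simp: t_def)
      ultimately show "low A v = mat_mult n (unilower y) t v"
        using v by (auto simp: ld low_def mat_mult_def unilower_def y_def)
    qed
    also have "\<dots> = chi n \<mu> t * f (unilower y)"
      using f(2) A by (auto simp: semi_invariant_def borel_def t_def)
    finally show ?thesis using zero by simp
  qed
  have "(\<Sum>M\<in>lower. c M * mon_fun (cells n) M A) = 0" for A
  proof (rule polyfun_zero_on_dense[OF inf, where I = "cells n" and
        f = "\<lambda>A. \<Sum>M\<in>lower. c M * mon_fun (cells n) M A" and g = "\<lambda>A. \<Prod>d<n. A (d, d)" and ?x0.0 = "\<lambda>_. 1"])
    show "(\<lambda>A. \<Sum>M\<in>lower. c M * mon_fun (cells n) M A) \<in> polyfun (cells n)"
      by (intro fs_span_sum fs_span_scale fs.span_base) auto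
    show "(\<lambda>A. \<Prod>d<n. A (d, d)) \<in> polyfun (cells n)"
      by (intro polyfun_prod polyfun_var) auto
  qed (use diag flow in auto)
  then have "c M = 0"
  proof (intro mon_independent[OF inf, of "cells n" lower c M])
    show "M v = 0" if "M \<in> lower" "v \<notin> cells n" for M v
      using that S(2) by (auto simp: lower_def intro: exponents_outside simp del: split_paired_All)
  qed (use S(1) M in \<open>auto simp: lower_def\<close>)
  then show False using M(2) by simp
qed

section \<open>The Weyl module is generated by its highest weight vector\<close>

definition nonsingular :: "nat \<Rightarrow> ('k::field entries) \<Rightarrow> bool" where
  "nonsingular n A \<longleftrightarrow> Determinant.det (mat n n A) \<noteq> 0"

definition unit_matrix :: "'k::field entries" where
  "unit_matrix = (\<lambda>(i, j). if i = j then 1 else 0)"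

definition orbit :: "nat \<Rightarrow> (nat \<Rightarrow> nat) \<Rightarrow> 'k::field tensor set" where
  "orbit n \<mu> = {mat_act n \<mu> A (hw_vector \<mu>) |A. nonsingular n A}"

lemma mat_unit_matrix: "mat n n unit_matrix = 1\<^sub>m n"
  by (rule eq_matI) (auto simp: unit_matrix_def)

lemma nonsingular_unit_matrix: "nonsingular n unit_matrix"
  by (simp add: nonsingular_def mat_unit_matrix)

lemma det_polyfun:
  "(\<lambda>A :: 'k::field entries. Determinant.det (mat n n A)) \<in> polyfun (cells n)"
proof -
  have less: "p i < n" if "p permutes {0..<n}" "i < n" for p i
    using permutes_in_image[OF that(1), of i] that(2) by simp
  have "(\<lambda>A :: 'k entries. \<Sum>p\<in>{p. p permutes {0..<n}}. signof p * (\<Prod>i = 0..<n. A (i, p i))) \<in> polyfun (cells n)"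
    by (intro fs_span_sum fs_span_scale polyfun_prod polyfun_var) (auto simp: less)
  moreover have "Determinant.det (mat n n A) = (\<Sum>p\<in>{p. p permutes {0..<n}}. signof p * (\<Prod>i = 0..<n. A (i, p i)))"
    for A :: "'k entries"
    by (subst det_def'[where n = n]) (auto intro!: sum.cong prod.cong simp: less)
  ultimately show ?thesis by simp
qed

lemma polyfun_zero_if_zero_on_nonsingular:
  fixes f :: "('k::field entries) \<Rightarrow> 'k"
  assumes "infinite (UNIV :: 'k set)" "f \<in> polyfun (cells n)" "\<And>A. nonsingular n A \<Longrightarrow> f A = 0"
  shows "f A = 0"
  by (rule polyfun_zero_on_dense[OF assms(1,2) det_polyfun, of unit_matrix])
    (use assms(3) nonsingular_unit_matrix in \<open>auto simp: nonsingular_def\<close>)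

lemma borel_nonsingular:
  assumes "borel n B"
  shows "nonsingular n B"
proof -
  have "Determinant.det (mat n n B) = prod_list (diag_mat (mat n n B))"
    by (rule det_upper_triangular[where n = n]) (use assms in \<open>auto simp: borel_def\<close>)
  also have "\<dots> \<noteq> 0"
    using assms by (auto simp: prod_list_zero_iff diag_mat_def borel_def)
  finally show ?thesis by (simp add: nonsingular_def)
qed

lemma GL_iff_det: "B \<in> GL n \<longleftrightarrow> B \<in> carrier_mat n n \<and> Determinant.det B \<noteq> 0"
proof (cases "B \<in> carrier_mat n n")
  case True
  have "Determinant.det B \<noteq> 0" if inv: "invertible_mat B"
  proof -
    obtain C where C: "B * C = 1\<^sub>m n" "C * B = 1\<^sub>m (dim_row C)"
      using inv carrier_matD[OF True] by (auto simp: invertible_mat_def inverts_mat_def)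
    have "dim_col C = n" using arg_cong[OF C(1), of dim_col] by simp
    moreover have "dim_row C = n" using arg_cong[OF C(2), of dim_col] True by simp
    ultimately have "Determinant.det (B * C) = Determinant.det B * Determinant.det C"
      using True by (intro det_mult[where n = n]) auto
    then show ?thesis using C(1) by auto
  qed
  moreover have "invertible_mat B" if "Determinant.det B \<noteq> 0"
  proof -
    have "B \<in> Units (ring_mat TYPE('a) n ())" by (rule det_non_zero_imp_unit[OF True that])
    then obtain C where "C \<in> carrier_mat n n" "C * B = 1\<^sub>m n" "B * C = 1\<^sub>m n"
      by (auto simp: Units_def ring_mat_def)
    then show ?thesis using True by (auto simp: invertible_mat_def inverts_mat_def)
  qed
  ultimately show ?thesis using True by (auto simp: GL_def)
qed (simp add: GL_def)

lemma mat_mat_mult: "mat n n (mat_mult n A B) = mat n n A * mat n n B"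
  by (rule eq_matI) (auto simp: mat_mult_def scalar_prod_def lessThan_atLeast0)

lemma nonsingular_mat_mult: "nonsingular n A \<Longrightarrow> nonsingular n B \<Longrightarrow> nonsingular n (mat_mult n A B)"
  unfolding nonsingular_def mat_mat_mult by (subst det_mult[where n = n]) auto

lemma mat_act_cong:
  assumes "\<And>v. v \<in> cells n \<Longrightarrow> A v = B v"
  shows "mat_act n \<mu> A x = mat_act n \<mu> B x"
  unfolding mat_act_def
  using assms by (auto intro!: sum.cong prod.cong arg_cong2[of _ _ _ _ "(*)"] simp: fillings_less fun_eq_iff)

lemma GL_act_eq_mat_act: "GL_act n \<mu> B = mat_act n \<mu> (\<lambda>v. B $$ v)"
  by (simp add: GL_act_def mat_act_def fun_eq_iff)

lemma GL_act_mat: "GL_act n \<mu> (mat n n A) x = mat_act n \<mu> A x"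
  unfolding GL_act_eq_mat_act by (rule mat_act_cong) auto

lemma GL_nonsingular: "B \<in> GL n \<Longrightarrow> nonsingular n (\<lambda>v. B $$ v)"
proof -
  assume B: "B \<in> GL n"
  then have "mat n n (\<lambda>v. B $$ v) = B" by (intro eq_matI) (auto simp: GL_def)
  then show ?thesis using B by (simp add: nonsingular_def GL_iff_det)
qed

lemma mat_GL: "nonsingular n A \<Longrightarrow> mat n n A \<in> GL n"
  by (simp add: GL_iff_det nonsingular_def)

lemma mat_act_add: "mat_act n \<mu> A (\<lambda>T. x T + y T) = (\<lambda>T. mat_act n \<mu> A x T + mat_act n \<mu> A y T)"
  by (auto simp: mat_act_def algebra_simps sum.distrib)

lemma mat_act_scale: "mat_act n \<mu> A (\<lambda>T. c * x T) = (\<lambda>T. c * mat_act n \<mu> A x T)"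
  by (auto simp: mat_act_def algebra_simps sum_distrib_left)

lemma mat_act_zero: "mat_act n \<mu> A (\<lambda>T. 0) = (\<lambda>T. 0)"
  by (auto simp: mat_act_def)

lemma fillings_eqI:
  assumes "S \<in> fillings n \<mu>" "T \<in> fillings n \<mu>" "\<And>b. b \<in> young_diagram \<mu> \<Longrightarrow> T b = S b"
  shows "S = T"
  using PiE_ext[of S "young_diagram \<mu>" "\<lambda>_. {..<n}" T] assms unfolding fillings_def by simp

lemma mat_act_unit_matrix:
  assumes mu: "\<mu> \<in> partitions n" and x: "x \<in> tensors n \<mu>"
  shows "mat_act n \<mu> unit_matrix x = x"
proof
  fix T
  show "mat_act n \<mu> unit_matrix x T = x T"
  proof (cases "T \<in> fillings n \<mu>")
    case True
    have "(\<Prod>b\<in>young_diagram \<mu>. unit_matrix (T b, S b)) * x S = (if S = T then x T else 0)"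
      if S: "S \<in> fillings n \<mu>" for S
    proof (cases "S = T")
      case False
      obtain b where "b \<in> young_diagram \<mu>" "T b \<noteq> S b"
        using fillings_eqI[OF S True] False by metis
      then have "(\<Prod>b\<in>young_diagram \<mu>. unit_matrix (T b, S b)) = (0 :: 'a)"
        by (intro prod_zero[OF finite_young_diagram[OF mu]]) (auto simp: unit_matrix_def intro!: bexI[of _ b])
      then show ?thesis using False by simp
    qed (simp add: unit_matrix_def)
    then have "mat_act n \<mu> unit_matrix x T = (\<Sum>S\<in>fillings n \<mu>. if S = T then x T else 0)"
      using True by (simp add: mat_act_def)
    then show ?thesis using True finite_fillings[OF mu] by simp
  next
    case False
    then show ?thesis using x by (simp add: mat_act_def tensors_def)
  qed
qed

text \<open>
  Fillings with the same exponent have the same content in each row.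
\<close>

lemma expo_eq_imp_row_perm:
  assumes mu: "\<mu> \<in> partitions n" and T: "T \<in> fillings n \<mu>" "T' \<in> fillings n \<mu>" "expo \<mu> T = expo \<mu> T'"
  obtains \<sigma> where "\<sigma> \<in> row_perms \<mu>" "T = T' \<circ> \<sigma>"
proof -
  let ?Y = "young_diagram \<mu>"
  have "image_mset (\<lambda>b. (T b, box_row b)) (mset_set ?Y) = image_mset (\<lambda>b. (T' b, box_row b)) (mset_set ?Y)"
  proof (rule multiset_eqI)
    fix v
    have "count (image_mset (\<lambda>b. (R b, box_row b)) (mset_set ?Y)) v = expo \<mu> R v" for R :: filling
      using finite_young_diagram[OF mu]
      by (simp add: count_image_mset' pair_count_def count_mset_set' sum.If_cases Int_def eq_commute[of v])
    then show "count (image_mset (\<lambda>b. (T b, box_row b)) (mset_set ?Y)) v = count (image_mset (\<lambda>b. (T' b, box_row b)) (mset_set ?Y)) v"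
      using T(3) by simp
  qed
  then obtain p where p: "p permutes ?Y" "\<forall>x\<in>?Y. (T x, box_row x) = (T' (p x), box_row (p x))"
    by (rule image_mset_eq_implies_permutes[OF finite_young_diagram[OF mu]])
  have "fst (p b) = fst b" for b
  proof (cases "b \<in> ?Y")
    case True
    then show ?thesis
      using p fst_eq_Suc_row[OF mu, of b] fst_eq_Suc_row[OF mu, of "p b"] permutes_in_image[OF p(1), of b] by auto
  next
    case False
    then show ?thesis using permutes_not_in[OF p(1)] by simp
  qed
  then have "p \<in> row_perms \<mu>" using p(1) by (simp add: row_perms_def)
  moreover have "T = T' \<circ> p"
  proof
    fix b
    show "T b = (T' \<circ> p) b"
    proof (cases "b \<in> ?Y")
      case True
      then show ?thesis using p(2) by auto
    next
      case False
      then show ?thesis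
        using permutes_not_in[OF p(1) False] T(1,2)[unfolded fillings_def, THEN PiE_arb, OF False] by simp
    qed
  qed
  ultimately show thesis by (rule that)
qed

lemma row_symmetric_subspace: "fs.subspace (row_symmetric n \<mu>)"
  by (rule fs_subspaceI) (auto simp: row_symmetric_def tensors_def)

lemma mat_act_canonical_row_symmetric:
  assumes mu: "\<mu> \<in> partitions n"
  shows "mat_act n \<mu> A (basis_tensor (canonical \<mu>)) \<in> row_symmetric n \<mu>"
proof -
  have "mat_act n \<mu> A (basis_tensor (canonical \<mu>)) (T \<circ> \<sigma>) = mat_act n \<mu> A (basis_tensor (canonical \<mu>)) T"
    if s: "\<sigma> \<in> row_perms \<mu>" for \<sigma> T
  proof -
    have p: "\<sigma> permutes young_diagram \<mu>" using s by (simp add: row_perms_def)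
    have r: "canonical \<mu> b = box_row (\<sigma> b)" if "b \<in> young_diagram \<mu>" for b
      using s that by (simp add: canonical_def box_row_def row_perms_def del: split_paired_All)
    have "(\<Prod>b\<in>young_diagram \<mu>. A (T (\<sigma> b), canonical \<mu> b)) = (\<Prod>b\<in>young_diagram \<mu>. A (T (\<sigma> b), box_row (\<sigma> b)))"
      by (intro prod.cong refl) (simp add: r)
    also have "\<dots> = (\<Prod>b\<in>young_diagram \<mu>. A (T b, box_row b))"
      by (rule prod_comp_permutes[OF p, of "\<lambda>b. A (T b, box_row b)"])
    also have "\<dots> = (\<Prod>b\<in>young_diagram \<mu>. A (T b, canonical \<mu> b))"
      by (intro prod.cong) (auto simp: canonical_def)
    finally show ?thesis
      by (simp add: mat_act_basis[OF mu canonical_fillings[OF mu]] fillings_comp_permutes[OF p])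
  qed
  then show ?thesis by (auto simp: row_symmetric_def tensors_def mat_act_def)
qed

text \<open>
  A functional that vanishes on the orbit is a polynomial function of \<open>A\<close> that is
  zero on nonsingular matrices, hence all of its coefficients are zero. The coefficient of a
  monomial is the sum of the functional over the fillings with that exponent, which form one orbit
  under row permutations, and a row symmetric tensor is constant on these.
\<close>

lemma row_symmetric_spanned:
  assumes inf: "infinite (UNIV :: 'k::field set)" and mu: "\<mu> \<in> partitions n"
    and x: "(x :: 'k tensor) \<in> row_symmetric n \<mu>"
  shows "x \<in> fs.span {mat_act n \<mu> A (basis_tensor (canonical \<mu>)) |A. nonsingular n A}"
    (is "x \<in> fs.span ?O")
proof (rule ccontr)
  assume not: "x \<notin> fs.span ?O"
  let ?F = "fillings n \<mu>"
  have sub: "fs.span ?O \<subseteq> row_symmetric n \<mu>"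
    using mat_act_canonical_row_symmetric[OF mu] row_symmetric_subspace by (intro fs.span_minimal) auto
  have supp: "y T = 0" if "y \<in> insert x (fs.span ?O)" "T \<notin> ?F" for y T
    using that sub x by (auto simp: row_symmetric_def tensors_def)
  obtain g where g: "\<And>y. y \<in> fs.span ?O \<Longrightarrow> (\<Sum>T\<in>?F. g T * y T) = 0" "(\<Sum>T\<in>?F. g T * x T) \<noteq> 0"
  proof (rule separating_functional[OF finite_fillings[OF mu] fs.subspace_span not])
    show "y T = 0" if "y \<in> insert x (fs.span ?O)" "T \<notin> ?F" for y T by (rule supp[OF that])
  qed blast
  define c where "c M = (\<Sum>T\<in>{T \<in> ?F. expo \<mu> T = M}. g T)" for M
  have group: "(\<Sum>T\<in>?F. g T * G T) = (\<Sum>M\<in>expo \<mu> ` ?F. c M * a M)"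
    if "\<And>T. T \<in> ?F \<Longrightarrow> G T = a (expo \<mu> T)" for G and a :: "(nat \<times> nat \<Rightarrow> nat) \<Rightarrow> 'k"
  proof -
    have "(\<Sum>T\<in>?F. g T * G T) = (\<Sum>M\<in>expo \<mu> ` ?F. \<Sum>T\<in>{T \<in> ?F. expo \<mu> T = M}. g T * G T)"
      by (rule sum.group[symmetric]) (auto simp: finite_fillings[OF mu])
    also have "\<dots> = (\<Sum>M\<in>expo \<mu> ` ?F. c M * a M)"
      unfolding c_def sum_distrib_right using that by (intro sum.cong refl) auto
    finally show ?thesis .
  qed
  have "(\<Sum>M\<in>expo \<mu> ` ?F. c M * mon_fun (cells n) M A) = 0" for A
  proof (rule polyfun_zero_if_zero_on_nonsingular[OF inf, of "\<lambda>A. \<Sum>M\<in>expo \<mu> ` ?F. c M * mon_fun (cells n) M A"])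
    show "(\<lambda>A. \<Sum>M\<in>expo \<mu> ` ?F. c M * mon_fun (cells n) M A) \<in> polyfun (cells n)"
      by (intro fs_span_sum fs_span_scale fs.span_base) auto
  next
    fix A :: "'k entries" assume A: "nonsingular n A"
    let ?y = "mat_act n \<mu> A (basis_tensor (canonical \<mu>))"
    have "?y T = mon_fun (cells n) (expo \<mu> T) A" if T: "T \<in> ?F" for T
    proof -
      have "?y T = (\<Prod>b\<in>young_diagram \<mu>. A (T b, canonical \<mu> b))"
        using T by (simp add: mat_act_basis[OF mu canonical_fillings[OF mu]])
      also have "\<dots> = (\<Prod>b\<in>young_diagram \<mu>. A (T b, box_row b))"
        by (intro prod.cong) (auto simp: canonical_def)
      finally show ?thesis using prod_eq_mon_pair_count[where S = T and R = box_row and A = A, OF mu filling_box_row_less[OF mu T]] by simp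
    qed
    then have "(\<Sum>M\<in>expo \<mu> ` ?F. c M * mon_fun (cells n) M A) = (\<Sum>T\<in>?F. g T * ?y T)"
      by (rule group[symmetric])
    also have "\<dots> = 0" using A by (intro g(1) fs.span_base) auto
    finally show "(\<Sum>M\<in>expo \<mu> ` ?F. c M * mon_fun (cells n) M A) = 0" .
  qed
  then have c0: "c M = 0" if "M \<in> expo \<mu> ` ?F" for M
  proof (intro mon_independent[OF inf, of "cells n" "expo \<mu> ` ?F" c M])
    show "M v = 0" if "M \<in> expo \<mu> ` ?F" "v \<notin> cells n" for M v
      using that by (auto intro: exponents_outside[OF expo_exponents[OF mu]] simp del: split_paired_All)
  qed (use that finite_fillings[OF mu] in auto)
  define a where "a M = x (SOME T. T \<in> ?F \<and> expo \<mu> T = M)" for M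
  have "x T = a (expo \<mu> T)" if T: "T \<in> ?F" for T
  proof -
    let ?T' = "SOME T'. T' \<in> ?F \<and> expo \<mu> T' = expo \<mu> T"
    have T': "?T' \<in> ?F \<and> expo \<mu> ?T' = expo \<mu> T" using someI[of "\<lambda>T'. T' \<in> ?F \<and> expo \<mu> T' = expo \<mu> T" T] T by simp
    obtain \<sigma> where "\<sigma> \<in> row_perms \<mu>" "?T' = T \<circ> \<sigma>"
      by (rule expo_eq_imp_row_perm[OF mu conjunct1[OF T'] T conjunct2[OF T']])
    then show ?thesis using x by (simp add: a_def row_symmetric_def)
  qed
  then have "(\<Sum>T\<in>?F. g T * x T) = (\<Sum>M\<in>expo \<mu> ` ?F. c M * a M)" by (rule group)
  then show False using g(2) c0 by simp
qed

text \<open>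
  Column antisymmetrization carries the span of the orbit in the row symmetric tensors to the span
  of the orbit in the Weyl module.
\<close>

lemma weyl_module_eq_span_orbit:
  assumes inf: "infinite (UNIV :: 'k::field set)" and mu: "\<mu> \<in> partitions n"
  shows "(weyl_module n \<mu> :: 'k tensor set) = fs.span (orbit n \<mu>)"
proof -
  let ?e = "basis_tensor (canonical \<mu>) :: 'k tensor"
  let ?O = "{mat_act n \<mu> A ?e |A. nonsingular n A}"
  interpret ca: Vector_Spaces.linear fun_scale fun_scale "col_antisymmetrize \<mu> :: 'k tensor \<Rightarrow> 'k tensor"
  proof
    fix x y :: "'k tensor" and c
    show "col_antisymmetrize \<mu> (x + y) = col_antisymmetrize \<mu> x + col_antisymmetrize \<mu> y"
      by (auto simp: col_antisymmetrize_def distrib_left sum.distrib)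
    show "col_antisymmetrize \<mu> (fun_scale c x) = fun_scale c (col_antisymmetrize \<mu> x)"
      by (auto simp: col_antisymmetrize_def fun_scale_def sum_distrib_left mult.left_commute)
  qed
  have "row_symmetric n \<mu> = fs.span ?O"
    using row_symmetric_spanned[OF inf mu] mat_act_canonical_row_symmetric[OF mu] row_symmetric_subspace
    by (intro equalityI fs.span_minimal) auto
  then have "weyl_module n \<mu> = fs.span (col_antisymmetrize \<mu> ` ?O)"
    by (simp add: weyl_module_def ca.span_image)
  also have "col_antisymmetrize \<mu> ` ?O = orbit n \<mu>"
    by (auto simp: orbit_def hw_vector_def col_antisymmetrize_mat_act[OF mu, symmetric])
  finally show ?thesis .
qed

lemma weyl_module_subset_tensors:
  assumes inf: "infinite (UNIV :: 'k::field set)" and mu: "\<mu> \<in> partitions n"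
  shows "(weyl_module n \<mu> :: 'k tensor set) \<subseteq> tensors n \<mu>"
  unfolding weyl_module_eq_span_orbit[OF assms]
proof (rule fs.span_minimal)
  show "orbit n \<mu> \<subseteq> (tensors n \<mu> :: 'k tensor set)" by (auto simp: orbit_def tensors_def mat_act_def)
  show "fs.subspace (tensors n \<mu> :: 'k tensor set)" by (rule fs_subspaceI) (auto simp: tensors_def)
qed

lemma weyl_module_mat_act:
  assumes inf: "infinite (UNIV :: 'k::field set)" and mu: "\<mu> \<in> partitions n"
    and A: "nonsingular n A" and x: "(x :: 'k tensor) \<in> weyl_module n \<mu>"
  shows "mat_act n \<mu> A x \<in> weyl_module n \<mu>"
proof -
  have "weyl_module n \<mu> \<subseteq> {x :: 'k tensor. mat_act n \<mu> A x \<in> weyl_module n \<mu>}"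
    unfolding weyl_module_eq_span_orbit[OF inf mu]
  proof (rule fs.span_minimal)
    show "orbit n \<mu> \<subseteq> {x. mat_act n \<mu> A x \<in> fs.span (orbit n \<mu>)}"
    proof (intro subsetI CollectI fs.span_base)
      fix x :: "'k tensor" assume "x \<in> orbit n \<mu>"
      then obtain A' where A': "nonsingular n A'" "x = mat_act n \<mu> A' (hw_vector \<mu>)"
        unfolding orbit_def by blast
      then show "mat_act n \<mu> A x \<in> orbit n \<mu>"
        using nonsingular_mat_mult[OF A A'(1)] unfolding orbit_def A'(2) mat_act_mat_act[OF mu] by blast
    qed
    show "fs.subspace {x. mat_act n \<mu> A x \<in> fs.span (orbit n \<mu>)}"
      by (rule fs_subspaceI) (simp_all add: mat_act_add mat_act_scale mat_act_zero fs_span_zero fs_span_add fs_span_scale)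
  qed
  then show ?thesis using x by auto
qed

lemma hw_vector_tensors:
  assumes mu: "\<mu> \<in> partitions n"
  shows "(hw_vector \<mu> :: 'k::field tensor) \<in> tensors n \<mu>"
proof -
  have "hw_vector \<mu> T = (0 :: 'k)" if T: "T \<notin> fillings n \<mu>" for T
    unfolding hw_vector_def col_antisymmetrize_def
  proof (rule sum.neutral, rule ballI)
    fix \<sigma> assume "\<sigma> \<in> col_perms \<mu>"
    then have "T \<circ> \<sigma> \<notin> fillings n \<mu>" using T fillings_comp_permutes[OF col_perms_permutes] by blast
    then have "T \<circ> \<sigma> \<noteq> canonical \<mu>" using canonical_fillings[OF mu] by metis
    then show "of_int (sign \<sigma>) * basis_tensor (canonical \<mu>) (T \<circ> \<sigma>) = 0"
      by (simp add: basis_tensor_def)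
  qed
  then show ?thesis by (simp add: tensors_def)
qed

lemma hw_vector_in_weyl_module:
  assumes "infinite (UNIV :: 'k::field set)" "\<mu> \<in> partitions n"
  shows "(hw_vector \<mu> :: 'k tensor) \<in> weyl_module n \<mu>"
proof -
  have "mat_act n \<mu> unit_matrix (hw_vector \<mu>) \<in> fs.span (orbit n \<mu>)"
    using nonsingular_unit_matrix by (intro fs.span_base) (auto simp: orbit_def)
  then show ?thesis
    by (simp add: weyl_module_eq_span_orbit[OF assms] mat_act_unit_matrix[OF assms(2) hw_vector_tensors[OF assms(2)]])
qed

lemma weyl_module_induct:
  assumes inf: "infinite (UNIV :: 'k::field set)" and mu: "\<mu> \<in> partitions n"
    and x: "(x :: 'k tensor) \<in> weyl_module n \<mu>"
    and P: "P (\<lambda>T. 0)" "\<And>x y. P x \<Longrightarrow> P y \<Longrightarrow> P (\<lambda>T. x T + y T)" "\<And>c x. P x \<Longrightarrow> P (\<lambda>T. c * x T)"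
    and orb: "\<And>A. nonsingular n A \<Longrightarrow> P (mat_act n \<mu> A (hw_vector \<mu>))"
  shows "P x"
proof -
  have "fs.span (orbit n \<mu>) \<subseteq> {x. P x}"
  proof (rule fs.span_minimal)
    show "orbit n \<mu> \<subseteq> {x. P x}" using orb by (auto simp: orbit_def)
    show "fs.subspace {x. P x}" by (rule fs_subspaceI) (use P in simp_all)
  qed
  then show ?thesis using x by (auto simp: weyl_module_eq_span_orbit[OF inf mu])
qed

lemma mat_act_hw_vector_borel:
  assumes mu: "\<mu> \<in> partitions n" and B: "borel n B"
  shows "mat_act n \<mu> B (hw_vector \<mu>) = (\<lambda>T. chi n \<mu> B * hw_vector \<mu> T)"
proof -
  let ?h = "mat_act n \<mu> unit_matrix (hw_vector \<mu>)"
  have "mat_act n \<mu> B (hw_vector \<mu>) = mat_act n \<mu> (mat_mult n unit_matrix B) (hw_vector \<mu>)"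
  proof (rule mat_act_cong)
    fix v assume v: "v \<in> cells n"
    obtain l d where ld: "v = (l, d)" by (cases v)
    have "(\<Sum>k<n. unit_matrix (l, k) * B (k, d)) = (\<Sum>k<n. if k = l then B (l, d) else 0)"
      by (intro sum.cong) (auto simp: unit_matrix_def)
    then show "B v = mat_mult n unit_matrix B v" using v by (simp add: ld mat_mult_def)
  qed
  also have "\<dots> = (\<lambda>T. chi n \<mu> B * ?h T)"
    by (auto simp: mat_act_hw_vector[OF mu] bidet_mat_mult_borel[OF mu B])
  also have "?h = hw_vector \<mu>"
    by (rule mat_act_unit_matrix[OF mu hw_vector_tensors[OF mu]])
  finally show ?thesis .
qed

section \<open>Homomorphisms and primitive vectors\<close>

text \<open>
  The vectors of weight \<open>\<kappa>\<close> that are fixed by the unipotent upper triangular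
  matrices.
\<close>

definition primitive :: "nat \<Rightarrow> (nat \<Rightarrow> nat) \<Rightarrow> (nat \<Rightarrow> nat) \<Rightarrow> 'k::field tensor set" where
  "primitive n \<kappa> \<mu> = {w \<in> weyl_module n \<mu>. \<forall>B. borel n B \<longrightarrow> mat_act n \<mu> B w = (\<lambda>T. chi n \<kappa> B * w T)}"

lemma exponents_unique:
  assumes inf: "infinite (UNIV :: 'k::field set)" and eq: "\<And>s :: 'k. s \<noteq> 0 \<Longrightarrow> s ^ a = s ^ b"
  shows "a = b"
proof -
  define p where "p = Polynomial.monom (1 :: 'k) (Suc a) - Polynomial.monom 1 (Suc b)"
  have "poly p s = 0" for s
    using eq[of s] by (cases "s = 0") (auto simp: p_def poly_monom)
  then have "p = 0" by (rule poly_eq_0_if_infinite[OF inf])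
  then have "coeff (Polynomial.monom (1 :: 'k) (Suc a)) (Suc a) = coeff (Polynomial.monom 1 (Suc b)) (Suc a)"
    by (simp add: p_def)
  then show ?thesis by (auto split: if_splits)
qed

text \<open>
  Only the action of the torus is used: a diagonal matrix with a single entry \<open>s\<close>
  different from 1 multiplies the coefficient at \<open>T\<close> by \<open>s\<close> to the power
  of the multiplicity of its index in \<open>T\<close>.
\<close>

lemma primitive_content:
  assumes inf: "infinite (UNIV :: 'k::field set)" and mu: "\<mu> \<in> partitions n"
    and w: "(w :: 'k tensor) \<in> primitive n \<kappa> \<mu>" and T: "T \<in> fillings n \<mu>" "w T \<noteq> 0" and c: "c < n"
  shows "card {b \<in> young_diagram \<mu>. T b = c} = \<kappa> (Suc c)"
proof (rule exponents_unique[OF inf])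
  fix s :: 'k assume s: "s \<noteq> 0"
  let ?Y = "young_diagram \<mu>"
  define B where "B = (\<lambda>(i, j). if i = j then if i = c then s else 1 else 0)"
  have B: "borel n B" using s by (simp add: borel_def B_def)
  have "mat_act n \<mu> B w T = (\<Sum>S\<in>fillings n \<mu>. if S = T then s ^ card {b \<in> ?Y. T b = c} * w T else 0)"
    unfolding mat_act_def using T(1)
  proof (simp, intro sum.cong refl)
    fix S assume S: "S \<in> fillings n \<mu>"
    show "(\<Prod>b\<in>?Y. B (T b, S b)) * w S = (if S = T then s ^ card {b \<in> ?Y. T b = c} * w T else 0)"
    proof (cases "S = T")
      case True
      have "(\<Prod>b\<in>?Y. B (T b, T b)) = (\<Prod>l<n. B (l, l) ^ card {b \<in> ?Y. T b = l})"
        using T(1) by (intro prod_over_fibres finite_young_diagram[OF mu]) (auto simp: fillings_less)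
      also have "\<dots> = (\<Prod>l<n. if l = c then s ^ card {b \<in> ?Y. T b = c} else 1)"
        by (intro prod.cong) (auto simp: B_def)
      also have "\<dots> = s ^ card {b \<in> ?Y. T b = c}"
        using c by simp
      finally show ?thesis using True by simp
    next
      case False
      obtain b where "b \<in> ?Y" "T b \<noteq> S b"
        using fillings_eqI[OF S T(1)] False by metis
      then have "(\<Prod>b\<in>?Y. B (T b, S b)) = 0"
        by (intro prod_zero[OF finite_young_diagram[OF mu]]) (auto simp: B_def intro!: bexI[of _ b])
      then show ?thesis using False by simp
    qed
  qed
  also have "\<dots> = s ^ card {b \<in> ?Y. T b = c} * w T"
    using T(1) finite_fillings[OF mu] by simp
  finally have "mat_act n \<mu> B w T = s ^ card {b \<in> ?Y. T b = c} * w T" .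
  moreover have "mat_act n \<mu> B w T = chi n \<kappa> B * w T"
    using w B by (simp add: primitive_def)
  moreover have "chi n \<kappa> B = (\<Prod>l<n. if l = c then s ^ \<kappa> (Suc c) else 1)"
    unfolding chi_def by (intro prod.cong) (auto simp: B_def)
  ultimately show "s ^ card {b \<in> ?Y. T b = c} = s ^ \<kappa> (Suc c)"
    using T(2) c by simp
qed

lemma primitive_moment:
  assumes inf: "infinite (UNIV :: 'k::field set)" and mu: "\<mu> \<in> partitions n"
    and w: "(w :: 'k tensor) \<in> primitive n \<kappa> \<mu>" and T: "T \<in> fillings n \<mu>" "w T \<noteq> 0"
  shows "moment \<mu> T = min_moment n \<kappa>"
proof -
  have "moment \<mu> T = (\<Sum>c<n. c * card {b \<in> young_diagram \<mu>. T b = c})"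
    unfolding moment_def
    by (rule sum_over_fibres) (use T(1) finite_young_diagram[OF mu] in \<open>auto simp: fillings_less\<close>)
  then show ?thesis by (simp add: min_moment_def primitive_content[OF assms])
qed

lemma primitive_coefficient_graded:
  assumes inf: "infinite (UNIV :: 'k::field set)" and mu: "\<mu> \<in> partitions n"
    and w: "(w :: 'k tensor) \<in> primitive n \<kappa> \<mu>" and S: "S \<in> fillings n \<mu>"
  shows "(\<lambda>A. mat_act n \<mu> A w S) \<in> graded n \<kappa> (moment \<mu> S)"
proof -
  let ?Y = "young_diagram \<mu>"
  have "(\<lambda>A. \<Sum>T\<in>fillings n \<mu>. w T * (\<Prod>b\<in>?Y. A (S b, T b))) \<in> graded n \<kappa> (moment \<mu> S)"
  proof (rule fs_span_sum)
    fix T assume T: "T \<in> fillings n \<mu>"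
    show "(\<lambda>A. w T * (\<Prod>b\<in>?Y. A (S b, T b))) \<in> graded n \<kappa> (moment \<mu> S)"
    proof (cases "w T = 0")
      case True
      then show ?thesis by (simp add: fs_span_zero)
    next
      case False
      have lt: "S b < n \<and> T b < n" if "b \<in> ?Y" for b
        using S T that by (simp add: fillings_less)
      have "(\<lambda>A. \<Prod>b\<in>?Y. A (S b, T b)) = (mon_fun (cells n) (pair_count \<mu> S T) :: _ \<Rightarrow> 'k)"
        by (rule ext) (rule prod_eq_mon_pair_count[OF mu lt])
      moreover have "pair_count \<mu> S T \<in> exponents n \<kappa> (moment \<mu> S)"
        by (rule pair_count_exponents[OF mu lt primitive_content[OF inf mu w T False]])
      ultimately show ?thesis by (simp add: fs_span_scale fs.span_base)
    qed
  qed
  moreover have "(\<lambda>A. mat_act n \<mu> A w S) = (\<lambda>A. \<Sum>T\<in>fillings n \<mu>. w T * (\<Prod>b\<in>?Y. A (S b, T b)))"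
    using S by (auto simp: mat_act_def mult.commute)
  ultimately show ?thesis by simp
qed

lemma primitive_coefficient_semi_invariant:
  assumes "\<mu> \<in> partitions n" "w \<in> primitive n \<kappa> \<mu>"
  shows "semi_invariant n \<kappa> (\<lambda>A. mat_act n \<mu> A w S)"
  using assms
  by (auto simp: semi_invariant_def primitive_def mat_act_mat_act[OF assms(1), symmetric] mat_act_scale)

definition linear_between :: "nat \<Rightarrow> (nat \<Rightarrow> nat) \<Rightarrow> (nat \<Rightarrow> nat) \<Rightarrow> (filling \<Rightarrow> filling \<Rightarrow> 'k::field) \<Rightarrow> 'k tensor \<Rightarrow> 'k tensor" where
  "linear_between n \<alpha> \<beta> r x = (\<lambda>T. if T \<in> fillings n \<beta> then \<Sum>T'\<in>fillings n \<alpha>. r T T' * x T' else 0)"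

lemma linear_between_simps:
  "linear_between n \<alpha> \<beta> r (\<lambda>T. 0) = (\<lambda>T. 0)"
  "linear_between n \<alpha> \<beta> r (\<lambda>T. x T + y T) = (\<lambda>T. linear_between n \<alpha> \<beta> r x T + linear_between n \<alpha> \<beta> r y T)"
  "linear_between n \<alpha> \<beta> r (\<lambda>T. c * x T) = (\<lambda>T. c * linear_between n \<alpha> \<beta> r x T)"
  by (auto simp: linear_between_def fun_eq_iff algebra_simps sum.distrib sum_distrib_left)

lemma span_bidet_coefficients:
  assumes al: "\<alpha> \<in> partitions n" and f: "f \<in> fs.span (bidet \<alpha> ` {T \<in> fillings n \<alpha>. Q T})"
  obtains z where "f = (\<lambda>A. \<Sum>T\<in>fillings n \<alpha>. z T * bidet \<alpha> T A)" "\<And>T. \<not> Q T \<Longrightarrow> z T = 0"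
proof -
  obtain S c where S: "finite S" "S \<subseteq> {T \<in> fillings n \<alpha>. Q T}" "f = (\<lambda>A. \<Sum>T\<in>S. c T * bidet \<alpha> T A)"
    by (rule fs_span_image_explicit[OF f])
  define z where "z T = (if T \<in> S then c T else 0)" for T
  have "f = (\<lambda>A. \<Sum>T\<in>fillings n \<alpha>. z T * bidet \<alpha> T A)"
    unfolding S(3) z_def
    by (rule ext, rule sum.mono_neutral_cong_left) (use S finite_fillings[OF al] in auto)
  moreover have "z T = 0" if "\<not> Q T" for T using that S(2) by (auto simp: z_def)
  ultimately show thesis by (rule that)
qed

text \<open>
  Semi-invariants are combinations of bideterminants, and these are the coordinates of
  \<open>mat_act n \<alpha> A (hw_vector \<alpha>)\<close>. So a family of semi-invariants yields
  a linear map with prescribed values on the orbit; well-definedness on the span of the orbit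
  needs no further argument.
\<close>

lemma induced_map:
  fixes G :: "filling \<Rightarrow> ('k::field entries) \<Rightarrow> 'k"
  assumes inf: "infinite (UNIV :: 'k set)" and al: "\<alpha> \<in> partitions n"
    and G: "\<And>T. T \<in> fillings n \<beta> \<Longrightarrow> G T \<in> graded n \<alpha> (D T)"
      "\<And>T. T \<in> fillings n \<beta> \<Longrightarrow> semi_invariant n \<alpha> (G T)"
  shows "\<exists>r. \<forall>A. linear_between n \<alpha> \<beta> r (mat_act n \<alpha> A (hw_vector \<alpha>)) =
    (\<lambda>T. if T \<in> fillings n \<beta> then G T A else 0)"
proof -
  have "\<exists>z. G T = (\<lambda>A. \<Sum>T'\<in>fillings n \<alpha>. z T' * bidet \<alpha> T' A)" if T: "T \<in> fillings n \<beta>" for T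
    using semi_invariants_spanned_by_bidets[OF inf al G(1)[OF T] G(2)[OF T]]
    by (rule span_bidet_coefficients[OF al]) blast
  then obtain r where "\<And>T. T \<in> fillings n \<beta> \<Longrightarrow> G T = (\<lambda>A. \<Sum>T'\<in>fillings n \<alpha>. r T T' * bidet \<alpha> T' A)"
    by metis
  then have "linear_between n \<alpha> \<beta> r (mat_act n \<alpha> A (hw_vector \<alpha>)) =
      (\<lambda>T. if T \<in> fillings n \<beta> then G T A else 0)" for A
    by (auto simp: linear_between_def mat_act_hw_vector[OF al])
  then show ?thesis by blast
qed

lemma primitive_from_Hom:
  assumes inf: "infinite (UNIV :: 'k::field set)" and la: "\<kappa> \<in> partitions n" and mu: "\<mu> \<in> partitions n"
    and phi: "(\<phi> :: 'k tensor_map) \<in> weyl_Hom n \<kappa> \<mu>"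
  shows "\<phi> (hw_vector \<kappa>) \<in> primitive n \<kappa> \<mu>"
proof -
  note hw = hw_vector_in_weyl_module[OF inf la]
  have "mat_act n \<mu> B (\<phi> (hw_vector \<kappa>)) = (\<lambda>T. chi n \<kappa> B * \<phi> (hw_vector \<kappa>) T)" if B: "borel n B" for B
  proof -
    have "mat_act n \<mu> B (\<phi> (hw_vector \<kappa>)) = \<phi> (mat_act n \<kappa> B (hw_vector \<kappa>))"
      using phi hw mat_GL[OF borel_nonsingular[OF B]] by (auto simp: weyl_Hom_def simp flip: GL_act_mat)
    also have "\<dots> = \<phi> (tensor_scale (chi n \<kappa> B) (hw_vector \<kappa>))"
      by (simp add: mat_act_hw_vector_borel[OF la B] tensor_scale_def)
    also have "\<dots> = tensor_scale (chi n \<kappa> B) (\<phi> (hw_vector \<kappa>))"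
      using phi hw by (simp add: weyl_Hom_def)
    finally show ?thesis by (simp add: tensor_scale_def)
  qed
  then show ?thesis using phi hw by (auto simp: primitive_def weyl_Hom_def)
qed

lemma Hom_zero_if_zero_on_hw_vector:
  assumes inf: "infinite (UNIV :: 'k::field set)" and la: "\<kappa> \<in> partitions n"
    and phi: "(\<phi> :: 'k tensor_map) \<in> weyl_Hom n \<kappa> \<mu>" and zero: "\<phi> (hw_vector \<kappa>) = 0"
  shows "\<phi> = 0"
proof
  fix x :: "'k tensor"
  have add: "\<phi> (\<lambda>T. x T + y T) = (\<lambda>T. \<phi> x T + \<phi> y T)" if "x \<in> weyl_module n \<kappa>" "y \<in> weyl_module n \<kappa>" for x y
    using phi that by (auto simp: weyl_Hom_def plus_fun_def)
  have scale: "\<phi> (\<lambda>T. c * x T) = (\<lambda>T. c * \<phi> x T)" if "x \<in> weyl_module n \<kappa>" for x c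
    using phi that by (auto simp: weyl_Hom_def tensor_scale_def)
  show "\<phi> x = 0 x"
  proof (cases "x \<in> weyl_module n \<kappa>")
    case False
    then show ?thesis using phi by (simp add: weyl_Hom_def)
  next
    case True
    have hw: "(hw_vector \<kappa> :: 'k tensor) \<in> weyl_module n \<kappa>" by (rule hw_vector_in_weyl_module[OF inf la])
    have W: "weyl_module n \<kappa> = (fs.span (orbit n \<kappa>) :: 'k tensor set)" by (rule weyl_module_eq_span_orbit[OF inf la])
    have "x \<in> weyl_module n \<kappa> \<and> \<phi> x = (\<lambda>T. 0)"
    proof (rule weyl_module_induct[OF inf la True])
      show "(\<lambda>T. 0 :: 'k) \<in> weyl_module n \<kappa> \<and> \<phi> (\<lambda>T. 0) = (\<lambda>T. 0)"
        using scale[OF hw, of 0] by (simp add: W fs_span_zero)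
    next
      fix x y :: "'k tensor" assume xy: "x \<in> weyl_module n \<kappa> \<and> \<phi> x = (\<lambda>T. 0)" "y \<in> weyl_module n \<kappa> \<and> \<phi> y = (\<lambda>T. 0)"
      then have "(\<lambda>T. x T + y T) \<in> weyl_module n \<kappa>" unfolding W by (intro fs_span_add) auto
      then show "(\<lambda>T. x T + y T) \<in> weyl_module n \<kappa> \<and> \<phi> (\<lambda>T. x T + y T) = (\<lambda>T. 0)"
        using add[of x y] xy by simp
    next
      fix x :: "'k tensor" and c assume x: "x \<in> weyl_module n \<kappa> \<and> \<phi> x = (\<lambda>T. 0)"
      then have "(\<lambda>T. c * x T) \<in> weyl_module n \<kappa>" unfolding W by (intro fs_span_scale) auto
      then show "(\<lambda>T. c * x T) \<in> weyl_module n \<kappa> \<and> \<phi> (\<lambda>T. c * x T) = (\<lambda>T. 0)"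
        using scale[of x c] x by simp
    next
      fix A :: "'k entries" assume A: "nonsingular n A"
      have "\<phi> (mat_act n \<kappa> A (hw_vector \<kappa>)) = mat_act n \<mu> A (\<phi> (hw_vector \<kappa>))"
        using phi hw mat_GL[OF A] by (auto simp: weyl_Hom_def simp flip: GL_act_mat)
      also have "\<dots> = (\<lambda>T. 0)" using zero mat_act_zero by (simp add: zero_fun_def)
      finally show "mat_act n \<kappa> A (hw_vector \<kappa>) \<in> weyl_module n \<kappa> \<and> \<phi> (mat_act n \<kappa> A (hw_vector \<kappa>)) = (\<lambda>T. 0)"
        using weyl_module_mat_act[OF inf la A hw] by simp
    qed
    then show ?thesis by (simp add: zero_fun_def)
  qed
qed

text \<open>
  The universal property of the Weyl module, in the form that every primitive vector is the image
  of the highest weight vector.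
\<close>

lemma Hom_from_primitive:
  assumes inf: "infinite (UNIV :: 'k::field set)" and la: "\<kappa> \<in> partitions n" and mu: "\<mu> \<in> partitions n"
    and w: "(w :: 'k tensor) \<in> primitive n \<kappa> \<mu>"
  shows "\<exists>\<phi>\<in>weyl_Hom n \<kappa> \<mu>. \<phi> (hw_vector \<kappa>) = w"
proof -
  have wW: "w \<in> weyl_module n \<mu>" using w by (simp add: primitive_def)
  have wT: "w \<in> tensors n \<mu>" using wW weyl_module_subset_tensors[OF inf mu] by auto
  have "\<exists>r. \<forall>A. linear_between n \<kappa> \<mu> r (mat_act n \<kappa> A (hw_vector \<kappa>)) =
      (\<lambda>T. if T \<in> fillings n \<mu> then mat_act n \<mu> A w T else 0)"
    by (rule induced_map[OF inf la, where G = "\<lambda>T A. mat_act n \<mu> A w T" and D = "moment \<mu>"])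
      (simp_all add: primitive_coefficient_graded[OF inf mu w] primitive_coefficient_semi_invariant[OF mu w])
  then obtain r where r0: "\<And>A. linear_between n \<kappa> \<mu> r (mat_act n \<kappa> A (hw_vector \<kappa>)) =
      (\<lambda>T. if T \<in> fillings n \<mu> then mat_act n \<mu> A w T else 0)"
    by blast
  let ?L = "linear_between n \<kappa> \<mu> r"
  have r: "?L (mat_act n \<kappa> A (hw_vector \<kappa>)) = mat_act n \<mu> A w" for A
    unfolding r0 by (auto simp: mat_act_def)
  define \<phi> where "\<phi> x = (if x \<in> weyl_module n \<kappa> then ?L x else 0)" for x
  have W: "weyl_module n \<kappa> = (fs.span (orbit n \<kappa>) :: 'k tensor set)" by (rule weyl_module_eq_span_orbit[OF inf la])
  have W': "weyl_module n \<mu> = (fs.span (orbit n \<mu>) :: 'k tensor set)" by (rule weyl_module_eq_span_orbit[OF inf mu])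
  have closed: "(\<lambda>T. x T + y T) \<in> weyl_module n \<kappa>" "(\<lambda>T. c * x T) \<in> weyl_module n \<kappa>"
    if "x \<in> weyl_module n \<kappa>" "y \<in> weyl_module n \<kappa>" for x y :: "'k tensor" and c
    using that unfolding W by (auto intro: fs_span_add fs_span_scale)
  have img: "?L x \<in> weyl_module n \<mu>" if "x \<in> weyl_module n \<kappa>" for x
  proof (rule weyl_module_induct[OF inf la that])
    show "?L (mat_act n \<kappa> A (hw_vector \<kappa>)) \<in> weyl_module n \<mu>" if "nonsingular n A" for A
      unfolding r by (rule weyl_module_mat_act[OF inf mu that wW])
  qed (simp_all add: linear_between_simps W' fs_span_zero fs_span_add fs_span_scale)
  have equiv: "?L (mat_act n \<kappa> B x) = mat_act n \<mu> B (?L x)" if "x \<in> weyl_module n \<kappa>" for x B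
  proof (rule weyl_module_induct[OF inf la that])
    show "?L (mat_act n \<kappa> B (mat_act n \<kappa> A (hw_vector \<kappa>))) = mat_act n \<mu> B (?L (mat_act n \<kappa> A (hw_vector \<kappa>)))" for A
      by (simp add: mat_act_mat_act[OF la] r mat_act_mat_act[OF mu])
  qed (simp_all add: linear_between_simps mat_act_add mat_act_scale mat_act_zero)
  have "\<phi> \<in> weyl_Hom n \<kappa> \<mu>"
    unfolding weyl_Hom_def
  proof (intro CollectI conjI ballI allI impI)
    fix x y :: "'k tensor" assume "x \<in> weyl_module n \<kappa>" "y \<in> weyl_module n \<kappa>"
    then show "\<phi> (x + y) = \<phi> x + \<phi> y"
      using closed(1)[of x y] linear_between_simps(2)[of n \<kappa> \<mu> r x y] by (simp add: \<phi>_def plus_fun_def)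
  next
    fix c and x :: "'k tensor" assume "x \<in> weyl_module n \<kappa>"
    then show "\<phi> (tensor_scale c x) = tensor_scale c (\<phi> x)"
      using closed(2)[of x x c] linear_between_simps(3)[of n \<kappa> \<mu> r c x] by (simp add: \<phi>_def tensor_scale_def)
  next
    fix A :: "'k mat" and x :: "'k tensor" assume A: "A \<in> GL n" and x: "x \<in> weyl_module n \<kappa>"
    then show "\<phi> (GL_act n \<kappa> A x) = GL_act n \<mu> A (\<phi> x)"
      using weyl_module_mat_act[OF inf la GL_nonsingular[OF A] x] equiv[OF x]
      by (simp add: GL_act_eq_mat_act \<phi>_def)
  qed (auto simp: \<phi>_def img)
  moreover have "\<phi> (hw_vector \<kappa>) = w"
  proof -
    have "\<phi> (hw_vector \<kappa>) = ?L (mat_act n \<kappa> unit_matrix (hw_vector \<kappa>))"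
      by (simp add: \<phi>_def hw_vector_in_weyl_module[OF inf la] mat_act_unit_matrix[OF la hw_vector_tensors[OF la]])
    then show ?thesis by (simp add: r mat_act_unit_matrix[OF mu wT])
  qed
  ultimately show ?thesis by blast
qed

lemma weyl_Hom_subspace:
  assumes inf: "infinite (UNIV :: 'k::field set)" and mu: "\<mu> \<in> partitions n"
  shows "tensor_map.subspace (weyl_Hom n \<kappa> \<mu> :: 'k tensor_map set)"
proof -
  have W: "weyl_module n \<mu> = (fs.span (orbit n \<mu>) :: 'k tensor set)" by (rule weyl_module_eq_span_orbit[OF inf mu])
  show ?thesis
    unfolding tensor_map.subspace_def
  proof (intro conjI ballI allI)
    show "0 \<in> (weyl_Hom n \<kappa> \<mu> :: 'k tensor_map set)"
      by (auto simp: weyl_Hom_def W fs.span_zero tensor_scale_def GL_act_def fun_eq_iff)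
  next
    fix \<phi> \<psi> :: "'k tensor_map" assume "\<phi> \<in> weyl_Hom n \<kappa> \<mu>" "\<psi> \<in> weyl_Hom n \<kappa> \<mu>"
    then show "\<phi> + \<psi> \<in> weyl_Hom n \<kappa> \<mu>"
      unfolding weyl_Hom_def W GL_act_eq_mat_act
      by (auto simp: fs.span_add tensor_scale_def algebra_simps plus_fun_def mat_act_add intro: fs_span_add)
  next
    fix c and \<phi> :: "'k tensor_map" assume "\<phi> \<in> weyl_Hom n \<kappa> \<mu>"
    then show "map_scale c \<phi> \<in> weyl_Hom n \<kappa> \<mu>"
      unfolding weyl_Hom_def W GL_act_eq_mat_act
      by (auto simp: map_scale_def tensor_scale_def algebra_simps plus_fun_def zero_fun_def mat_act_scale intro: fs_span_scale)
  qed
qed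

lemma primitive_subspace:
  assumes inf: "infinite (UNIV :: 'k::field set)" and mu: "\<mu> \<in> partitions n"
  shows "fs.subspace (primitive n \<kappa> \<mu> :: 'k tensor set)"
  by (rule fs_subspaceI)
    (auto simp: primitive_def weyl_module_eq_span_orbit[OF inf mu] mat_act_zero mat_act_add mat_act_scale
      fs_span_zero fs_span_add fs_span_scale algebra_simps)

lemma primitive_finite_dimensional:
  assumes inf: "infinite (UNIV :: 'k::field set)" and mu: "\<mu> \<in> partitions n"
  shows "\<exists>T. finite T \<and> (primitive n \<kappa> \<mu> :: 'k tensor set) \<subseteq> fs.span T"
proof (intro exI conjI subsetI)
  show "finite ((basis_tensor :: _ \<Rightarrow> 'k tensor) ` fillings n \<mu>)" using finite_fillings[OF mu] by simp
  fix w :: "'k tensor" assume "w \<in> primitive n \<kappa> \<mu>"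
  then have w: "w \<in> tensors n \<mu>" using weyl_module_subset_tensors[OF inf mu] by (auto simp: primitive_def)
  have "w = (\<lambda>S. \<Sum>T\<in>fillings n \<mu>. w T * basis_tensor T S)"
    using w finite_fillings[OF mu] by (auto simp: basis_tensor_def tensors_def if_distrib[of "(*) _"] cong: if_cong)
  moreover have "(\<lambda>S. \<Sum>T\<in>fillings n \<mu>. w T * basis_tensor T S) \<in> fs.span (basis_tensor ` fillings n \<mu>)"
    by (intro fs_span_sum fs_span_scale fs.span_base) auto
  ultimately show "w \<in> fs.span (basis_tensor ` fillings n \<mu>)" by simp
qed

text \<open>
  Evaluation at the highest weight vector is a bijection; both directions are used as injections
  into a finite-dimensional space.
\<close>

theorem dim_weyl_Hom_eq_dim_primitive:
  assumes inf: "infinite (UNIV :: 'k::field set)" and la: "\<kappa> \<in> partitions n" and mu: "\<mu> \<in> partitions n"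
  shows "tensor_map.dim (weyl_Hom n \<kappa> \<mu> :: 'k tensor_map set) = fs.dim (primitive n \<kappa> \<mu> :: 'k tensor set)"
proof -
  let ?H = "weyl_Hom n \<kappa> \<mu> :: 'k tensor_map set" and ?P = "primitive n \<kappa> \<mu> :: 'k tensor set"
  have tm: "vector_space (map_scale :: 'k \<Rightarrow> _)" by unfold_locales
  have vs: "vector_space (fun_scale :: 'k \<Rightarrow> 'k tensor \<Rightarrow> _)" by unfold_locales
  obtain T where T: "finite T" "?P \<subseteq> fs.span T"
    using primitive_finite_dimensional[OF inf mu] by blast
  note sub = weyl_Hom_subspace[OF inf mu, of \<kappa>] and subP = primitive_subspace[OF inf mu, of \<kappa>]
  note 1 = dim_le_of_injective[OF tm vs sub, where f = "\<lambda>\<phi>. \<phi> (hw_vector \<kappa>)" and W = ?P, OF _ _ _ _ T]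
  have le: "tensor_map.dim ?H \<le> fs.dim ?P" and ex: "\<exists>T'. finite T' \<and> ?H \<subseteq> tensor_map.span T'"
    by (rule 1; use Hom_zero_if_zero_on_hw_vector[OF inf la] primitive_from_Hom[OF inf la mu] in
        \<open>auto simp: map_scale_def tensor_scale_def fun_scale_def\<close>)+
  obtain T' where T': "finite T'" "?H \<subseteq> tensor_map.span T'" using ex by blast
  define F where "F w = (SOME \<phi>. \<phi> \<in> ?H \<and> \<phi> (hw_vector \<kappa>) = w)" for w
  have F: "F w \<in> ?H" "F w (hw_vector \<kappa>) = w" if "w \<in> ?P" for w
    using someI_ex[of "\<lambda>\<phi>. \<phi> \<in> ?H \<and> \<phi> (hw_vector \<kappa>) = w"] Hom_from_primitive[OF inf la mu that]
    by (auto simp: F_def)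
  have uniq: "\<phi> = \<psi>" if "\<phi> \<in> ?H" "\<psi> \<in> ?H" "\<phi> (hw_vector \<kappa>) = \<psi> (hw_vector \<kappa>)" for \<phi> \<psi>
  proof -
    have "\<phi> - \<psi> \<in> ?H" using tensor_map.subspace_diff[OF sub that(1,2)] .
    then have "\<phi> - \<psi> = 0" by (rule Hom_zero_if_zero_on_hw_vector[OF inf la]) (simp add: that(3))
    then show ?thesis by simp
  qed
  have "fs.dim ?P \<le> tensor_map.dim ?H"
  proof (rule dim_le_of_injective(1)[OF vs tm subP, where f = F, OF _ _ _ _ T'])
    fix x y assume "x \<in> ?P" "y \<in> ?P"
    then show "F (x + y) = F x + F y"
      using F fs.subspace_add[OF subP, of x y] tensor_map.subspace_add[OF sub] by (intro uniq) auto
  next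
    fix c x assume "x \<in> ?P"
    then show "F (fun_scale c x) = map_scale c (F x)"
      using F fs.subspace_scale[OF subP, of x c] tensor_map.subspace_scale[OF sub]
      by (intro uniq) (auto simp: map_scale_def tensor_scale_def fun_scale_def)
  next
    fix x assume "x \<in> ?P" "F x = 0"
    then show "x = 0" using F(2)[of x] by simp
  qed (use F in auto)
  then show ?thesis using le by simp
qed

section \<open>The moment filtration\<close>

text \<open>
  Semi-invariants of weight \<open>\<alpha>\<close> whose left weights are of moment at least
  \<open>D\<close>.
\<close>

definition filtered :: "nat \<Rightarrow> (nat \<Rightarrow> nat) \<Rightarrow> nat \<Rightarrow> (('k::field entries) \<Rightarrow> 'k) set" where
  "filtered n \<alpha> D = fs.span (bidet \<alpha> ` {T \<in> fillings n \<alpha>. D \<le> moment \<alpha> T})"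

lemma filtered_if_graded:
  assumes "infinite (UNIV :: 'k::field set)" "\<alpha> \<in> partitions n"
    and "(f :: ('k entries) \<Rightarrow> 'k) \<in> graded n \<alpha> E" "semi_invariant n \<alpha> f" "D \<le> E"
  shows "f \<in> filtered n \<alpha> D"
proof -
  have "fs.span (bidet \<alpha> ` {T \<in> fillings n \<alpha>. moment \<alpha> T = E}) \<subseteq> filtered n \<alpha> D"
    unfolding filtered_def by (intro fs.span_mono image_mono) (use assms(5) in auto)
  then show ?thesis using semi_invariants_spanned_by_bidets[OF assms(1-4)] by blast
qed

lemma filtered_mult:
  assumes inf: "infinite (UNIV :: 'k::field set)" and ab: "\<alpha> \<in> partitions n" "\<beta> \<in> partitions n"
    and f: "(f :: ('k entries) \<Rightarrow> 'k) \<in> filtered n \<alpha> D" and g: "g \<in> filtered n \<beta> E"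
  shows "(\<lambda>A. f A * g A) \<in> filtered n (\<lambda>i. \<alpha> i + \<beta> i) (D + E)"
  unfolding filtered_def
proof (rule fs_span_mult[OF f[unfolded filtered_def] g[unfolded filtered_def]])
  fix a b :: "('k entries) \<Rightarrow> 'k"
  assume "a \<in> bidet \<alpha> ` {T \<in> fillings n \<alpha>. D \<le> moment \<alpha> T}" "b \<in> bidet \<beta> ` {T \<in> fillings n \<beta>. E \<le> moment \<beta> T}"
  then obtain T T' where T: "T \<in> fillings n \<alpha>" "D \<le> moment \<alpha> T" "a = bidet \<alpha> T"
    and T': "T' \<in> fillings n \<beta>" "E \<le> moment \<beta> T'" "b = bidet \<beta> T'" by auto
  have "(\<lambda>A. a A * b A) \<in> filtered n (\<lambda>i. \<alpha> i + \<beta> i) (D + E)"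
  proof (rule filtered_if_graded[OF inf])
    show "(\<lambda>i. \<alpha> i + \<beta> i) \<in> partitions n" using partitions_add[OF ab, of 1] by simp
    show "(\<lambda>A. a A * b A) \<in> graded n (\<lambda>i. \<alpha> i + \<beta> i) (moment \<alpha> T + moment \<beta> T')"
      using graded_mult[OF bidet_graded[OF ab(1) T(1)] bidet_graded[OF ab(2) T'(1)]] by (simp add: T(3) T'(3))
    show "semi_invariant n (\<lambda>i. \<alpha> i + \<beta> i) (\<lambda>A. a A * b A)"
      using semi_invariant_mult[OF bidet_semi_invariant[OF ab(1), of T] bidet_semi_invariant[OF ab(2), of T']]
      by (simp add: T(3) T'(3))
  qed (use T(2) T'(2) in simp)
  then show "(\<lambda>A. a A * b A) \<in> fs.span (bidet (\<lambda>i. \<alpha> i + \<beta> i) `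
      {T \<in> fillings n (\<lambda>i. \<alpha> i + \<beta> i). D + E \<le> moment (\<lambda>i. \<alpha> i + \<beta> i) T})"
    by (simp add: filtered_def)
qed

lemma one_graded: "(\<lambda>A. 1 :: 'k::field) \<in> graded n (\<lambda>_. 0) 0"
proof -
  have "(\<lambda>A. 1 :: 'k) = mon_fun (cells n) (\<lambda>_. 0)" by (auto simp: mon_fun_def)
  then show ?thesis by (auto simp: exponents_def intro!: fs.span_base)
qed

lemma one_semi_invariant: "semi_invariant n (\<lambda>_. 0) (\<lambda>A. 1)"
  by (simp add: semi_invariant_def chi_def)

lemma zero_partition: "(\<lambda>_. 0) \<in> partitions n"
  by (simp add: partitions_def monotone_on_def)

lemma partitions_times: "\<alpha> \<in> partitions n \<Longrightarrow> (\<lambda>i. j * \<alpha> i) \<in> partitions n"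
  using partitions_add[OF zero_partition, of \<alpha> n j] by simp

lemma filtered_power:
  assumes inf: "infinite (UNIV :: 'k::field set)" and al: "\<alpha> \<in> partitions n"
    and f: "(f :: ('k entries) \<Rightarrow> 'k) \<in> filtered n \<alpha> D"
  shows "(\<lambda>A. f A ^ j) \<in> filtered n (\<lambda>i. j * \<alpha> i) (j * D)"
proof (induction j)
  case 0
  show ?case
    using filtered_if_graded[OF inf zero_partition one_graded one_semi_invariant le_refl, of n] by simp
next
  case (Suc j)
  show ?case using filtered_mult[OF inf al partitions_times[OF al] f Suc.IH] by simp
qed

lemma bidet_filtered:
  assumes inf: "infinite (UNIV :: 'k::field set)" and al: "\<alpha> \<in> partitions n" and T: "T \<in> fillings n \<alpha>"
  shows "(bidet \<alpha> T :: ('k entries) \<Rightarrow> 'k) \<in> filtered n \<alpha> (min_moment n \<alpha>)"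
proof (cases "\<exists>A. (bidet \<alpha> T A :: 'k) \<noteq> 0")
  case True
  then obtain A where "(bidet \<alpha> T A :: 'k) \<noteq> 0" by blast
  then have "min_moment n \<alpha> \<le> moment \<alpha> T"
    by (rule semi_invariant_moment_ge[OF inf bidet_graded[OF al T] bidet_semi_invariant[OF al]])
  then show ?thesis using T by (auto simp: filtered_def intro!: fs.span_base)
next
  case False
  then have "bidet \<alpha> T = (\<lambda>A. 0 :: 'k)" by auto
  then show ?thesis by (simp add: filtered_def fs_span_zero)
qed

lemma bidet_left_translate_filtered:
  assumes inf: "infinite (UNIV :: 'k::field set)" and al: "\<alpha> \<in> partitions n" and T: "T \<in> fillings n \<alpha>"
  shows "(\<lambda>A :: 'k entries. bidet \<alpha> T (mat_mult n B A)) \<in> filtered n \<alpha> (min_moment n \<alpha>)"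
  unfolding bidet_mat_mult_left[OF al T]
  using bidet_filtered[OF inf al] unfolding filtered_def by (intro fs_span_sum fs_span_scale) auto

lemma min_moment_add: "min_moment n (\<lambda>i. \<alpha> i + k * \<beta> i) = min_moment n \<alpha> + k * min_moment n \<beta>"
  by (simp add: min_moment_def sum.distrib sum_distrib_left algebra_simps)

text \<open>
  \<open>bidet \<nu> (canonical \<nu>) (B A)\<close> is a combination of the
  \<open>bidet \<nu> S A\<close> with \<open>S b \<ge> box_row b\<close> for all boxes
  \<open>b\<close>. Apart from the canonical filling such \<open>S\<close> have larger moment. In
  characteristic \<open>p\<close> the \<open>q\<close>-th power of the sum is taken term by term,
  and it multiplies the difference of the moments by \<open>q\<close>.
\<close>

lemma principal_left_translate_power:
  assumes inf: "infinite (UNIV :: 'k::field set)" and p: "prime CHAR('k)" and q: "q = CHAR('k) ^ a"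
    and nu: "\<nu> \<in> partitions n" and B: "borel n (B :: 'k entries)"
  shows "(\<lambda>A. bidet \<nu> (canonical \<nu>) (mat_mult n B A) ^ q - (chi n \<nu> B * bidet \<nu> (canonical \<nu>) A) ^ q)
    \<in> filtered n (\<lambda>i. q * \<nu> i) (q * min_moment n \<nu> + q)"
proof -
  let ?c = "canonical \<nu>" and ?Y = "young_diagram \<nu>"
  define \<beta> where "\<beta> S = (\<Prod>b\<in>?Y. B (?c b, S b))" for S
  note c = canonical_fillings[OF nu]
  have bc: "\<beta> ?c = chi n \<nu> B"
    unfolding \<beta>_def chi_eq_prod_young_diagram[OF nu, symmetric] by (intro prod.cong) (auto simp: canonical_def)
  have eq: "bidet \<nu> ?c (mat_mult n B A) ^ q - (chi n \<nu> B * bidet \<nu> ?c A) ^ q =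
      (\<Sum>S\<in>fillings n \<nu> - {?c}. \<beta> S ^ q * bidet \<nu> S A ^ q)" for A
  proof -
    have "bidet \<nu> ?c (mat_mult n B A) ^ q = (\<Sum>S\<in>fillings n \<nu>. \<beta> S * bidet \<nu> S A) ^ q"
      by (simp add: bidet_mat_mult_left[OF nu c] \<beta>_def)
    also have "\<dots> = (\<Sum>S\<in>fillings n \<nu>. (\<beta> S * bidet \<nu> S A) ^ q)"
      by (rule freshmans_dream_sum'[OF p q])
    also have "\<dots> = (\<beta> ?c * bidet \<nu> ?c A) ^ q + (\<Sum>S\<in>fillings n \<nu> - {?c}. (\<beta> S * bidet \<nu> S A) ^ q)"
      by (rule sum.remove[OF finite_fillings[OF nu] c])
    finally show ?thesis by (simp add: bc power_mult_distrib)
  qed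
  have "(\<lambda>A. \<Sum>S\<in>fillings n \<nu> - {?c}. \<beta> S ^ q * bidet \<nu> S A ^ q) \<in>
      filtered n (\<lambda>i. q * \<nu> i) (q * min_moment n \<nu> + q)"
    unfolding filtered_def
  proof (rule fs_span_sum)
    fix S assume S: "S \<in> fillings n \<nu> - {?c}"
    have q0: "q > 0" using p by (simp add: q prime_gt_0_nat)
    show "(\<lambda>A. \<beta> S ^ q * bidet \<nu> S A ^ q) \<in> fs.span (bidet (\<lambda>i. q * \<nu> i) `
        {T \<in> fillings n (\<lambda>i. q * \<nu> i). q * min_moment n \<nu> + q \<le> moment (\<lambda>i. q * \<nu> i) T})"
    proof (cases "\<beta> S = 0")
      case True
      then show ?thesis by (simp add: zero_power[OF q0] fs_span_zero)
    next
      case False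
      have le: "box_row b \<le> S b" if b: "b \<in> ?Y" for b
      proof (rule ccontr)
        assume "\<not> box_row b \<le> S b"
        then have "B (?c b, S b) = 0" using B b box_row_less[OF nu b] by (simp add: borel_def canonical_def)
        then show False
          using False b prod_zero[OF finite_young_diagram[OF nu], of "\<lambda>b. B (?c b, S b)"] by (auto simp: \<beta>_def)
      qed
      have ex: "\<exists>b\<in>?Y. box_row b < S b"
      proof (rule ccontr)
        assume "\<not> (\<exists>b\<in>?Y. box_row b < S b)"
        then have "S b = ?c b" if "b \<in> ?Y" for b using le[OF that] that by (auto simp: canonical_def)
        then have "?c = S" using fillings_eqI[OF c, of S] S by auto
        then show False using S by simp
      qed
      have "min_moment n \<nu> = (\<Sum>b\<in>?Y. box_row b)"
        using moment_canonical[OF nu] by (simp add: moment_def canonical_def)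
      also have "\<dots> < moment \<nu> S"
        unfolding moment_def by (rule sum_strict_mono_ex1[OF finite_young_diagram[OF nu]]) (use le ex in auto)
      finally have "(bidet \<nu> S :: ('k entries) \<Rightarrow> 'k) \<in> filtered n \<nu> (Suc (min_moment n \<nu>))"
        using S by (auto simp: filtered_def intro!: fs.span_base)
      from filtered_power[OF inf nu this, of q] show ?thesis
        by (simp add: filtered_def fs_span_scale add.commute)
    qed
  qed
  then show ?thesis by (simp add: eq)
qed

text \<open>
  With \<open>u\<close> and \<open>v\<close> the \<open>q\<close>-th powers of the two functions,
  \<open>u - v\<close> divides \<open>u\<^sup>m - v\<^sup>m\<close> and already has moment larger
  by \<open>q\<close> than the minimum.
\<close>

lemma twist_filtered:
  assumes inf: "infinite (UNIV :: 'k::field set)" and p: "prime CHAR('k)" and q: "q = CHAR('k) ^ a"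
    and al: "\<alpha> \<in> partitions n" and nu: "\<nu> \<in> partitions n" and B: "borel n (B :: 'k entries)"
    and T: "T \<in> fillings n \<alpha>"
  shows "(\<lambda>A. (bidet \<nu> (canonical \<nu>) (mat_mult n B A) ^ (q * m) - (chi n \<nu> B * bidet \<nu> (canonical \<nu>) A) ^ (q * m))
      * bidet \<alpha> T (mat_mult n B A))
    \<in> filtered n (\<lambda>i. \<alpha> i + (q * m) * \<nu> i) (min_moment n (\<lambda>i. \<alpha> i + (q * m) * \<nu> i) + q)"
proof -
  define u where "u A = bidet \<nu> (canonical \<nu>) (mat_mult n B A) ^ q" for A
  define v where "v A = (chi n \<nu> B * bidet \<nu> (canonical \<nu>) A) ^ q" for A
  note c = canonical_fillings[OF nu] and qnu = partitions_times[OF nu, of q]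
  have u: "u \<in> filtered n (\<lambda>i. q * \<nu> i) (q * min_moment n \<nu>)"
    unfolding u_def by (rule filtered_power[OF inf nu bidet_left_translate_filtered[OF inf nu c]])
  have v: "v \<in> filtered n (\<lambda>i. q * \<nu> i) (q * min_moment n \<nu>)"
    unfolding v_def
    by (rule filtered_power[OF inf nu])
      (use bidet_filtered[OF inf nu c] in \<open>auto simp: filtered_def fs_span_scale\<close>)
  have uv: "(\<lambda>A. u A - v A) \<in> filtered n (\<lambda>i. q * \<nu> i) (q * min_moment n \<nu> + q)"
    unfolding u_def v_def by (rule principal_left_translate_power[OF inf p q nu B])
  have eq: "(bidet \<nu> (canonical \<nu>) (mat_mult n B A) ^ (q * m) - (chi n \<nu> B * bidet \<nu> (canonical \<nu>) A) ^ (q * m))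
      * bidet \<alpha> T (mat_mult n B A) =
    (\<Sum>i<m. bidet \<alpha> T (mat_mult n B A) * ((u A - v A) * (v A ^ (m - Suc i) * u A ^ i)))" for A
  proof -
    have "u A ^ m - v A ^ m = (u A - v A) * (\<Sum>i<m. v A ^ (m - Suc i) * u A ^ i)"
      by (rule power_diff_sumr2)
    moreover have "bidet \<nu> (canonical \<nu>) (mat_mult n B A) ^ (q * m) = u A ^ m"
      "(chi n \<nu> B * bidet \<nu> (canonical \<nu>) A) ^ (q * m) = v A ^ m"
      by (simp_all only: u_def v_def power_mult)
    ultimately show ?thesis
      by (simp add: sum_distrib_left sum_distrib_right mult_ac)
  qed
  have "(\<lambda>A. \<Sum>i<m. bidet \<alpha> T (mat_mult n B A) * ((u A - v A) * (v A ^ (m - Suc i) * u A ^ i)))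
      \<in> filtered n (\<lambda>i. \<alpha> i + (q * m) * \<nu> i) (min_moment n (\<lambda>i. \<alpha> i + (q * m) * \<nu> i) + q)"
    unfolding filtered_def
  proof (rule fs_span_sum, unfold filtered_def[symmetric])
    fix i assume "i \<in> {..<m}"
    then obtain j where j: "m = Suc (i + j)" using less_iff_Suc_add by auto
    let ?x = "min_moment n \<nu>"
    have vu: "(\<lambda>A. v A ^ j * u A ^ i) \<in> filtered n (\<lambda>t. j * (q * \<nu> t) + i * (q * \<nu> t)) (j * (q * ?x) + i * (q * ?x))"
      by (intro filtered_mult[OF inf] filtered_power[OF inf] partitions_times qnu u v)
    have pvu: "(\<lambda>t. j * (q * \<nu> t) + i * (q * \<nu> t)) \<in> partitions n"
      using partitions_times[OF nu, of "j * q + i * q"] by (simp add: algebra_simps)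
    have uvu: "(\<lambda>A. (u A - v A) * (v A ^ j * u A ^ i)) \<in>
        filtered n (\<lambda>t. q * \<nu> t + (j * (q * \<nu> t) + i * (q * \<nu> t))) (q * ?x + q + (j * (q * ?x) + i * (q * ?x)))"
      by (rule filtered_mult[OF inf qnu pvu uv vu])
    have puvu: "(\<lambda>t. q * \<nu> t + (j * (q * \<nu> t) + i * (q * \<nu> t))) \<in> partitions n"
      using partitions_times[OF nu, of "q + j * q + i * q"] by (simp add: algebra_simps)
    have "(\<lambda>A. bidet \<alpha> T (mat_mult n B A) * ((u A - v A) * (v A ^ j * u A ^ i))) \<in>
        filtered n (\<lambda>t. \<alpha> t + (q * \<nu> t + (j * (q * \<nu> t) + i * (q * \<nu> t))))
          (min_moment n \<alpha> + (q * ?x + q + (j * (q * ?x) + i * (q * ?x))))"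
      by (rule filtered_mult[OF inf al puvu bidet_left_translate_filtered[OF inf al T] uvu])
    moreover have "(\<lambda>t. \<alpha> t + (q * \<nu> t + (j * (q * \<nu> t) + i * (q * \<nu> t)))) = (\<lambda>t. \<alpha> t + (q * m) * \<nu> t)"
      by (auto simp: j algebra_simps)
    moreover have "min_moment n \<alpha> + (q * ?x + q + (j * (q * ?x) + i * (q * ?x))) =
        min_moment n (\<lambda>i. \<alpha> i + (q * m) * \<nu> i) + q"
      unfolding min_moment_add by (simp add: j algebra_simps)
    ultimately show "(\<lambda>A. bidet \<alpha> T (mat_mult n B A) * ((u A - v A) * (v A ^ (m - Suc i) * u A ^ i))) \<in>
        filtered n (\<lambda>i. \<alpha> i + (q * m) * \<nu> i) (min_moment n (\<lambda>i. \<alpha> i + (q * m) * \<nu> i) + q)"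
      by (simp add: j)
  qed
  then show ?thesis by (simp only: eq)
qed

section \<open>Comparing different multiples of a partition\<close>

lemma shift_graded:
  assumes nu: "\<nu> \<in> partitions n"
    and f: "f \<in> graded n (\<lambda>i. \<alpha> i + k * \<nu> i) D" "semi_invariant n (\<lambda>i. \<alpha> i + k * \<nu> i) f"
  shows "(\<lambda>A. f A * bidet \<nu> (canonical \<nu>) A ^ Q) \<in> graded n (\<lambda>i. \<alpha> i + (k + Q) * \<nu> i) (D + Q * min_moment n \<nu>)"
    and "semi_invariant n (\<lambda>i. \<alpha> i + (k + Q) * \<nu> i) (\<lambda>A. f A * bidet \<nu> (canonical \<nu>) A ^ Q)"
proof -
  let ?h = "bidet \<nu> (canonical \<nu>) :: (nat \<times> nat \<Rightarrow> 'a) \<Rightarrow> 'a"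
  have "(\<lambda>A. f A * ?h A ^ Q) \<in> graded n (\<lambda>i. \<alpha> i + (k + Q) * \<nu> i) (D + Q * min_moment n \<nu>) \<and>
      semi_invariant n (\<lambda>i. \<alpha> i + (k + Q) * \<nu> i) (\<lambda>A. f A * ?h A ^ Q)"
  proof (induction Q)
    case 0
    then show ?case using f by simp
  next
    case (Suc Q)
    have h: "?h \<in> graded n \<nu> (min_moment n \<nu>)"
      using bidet_graded[OF nu canonical_fillings[OF nu]] by (simp add: moment_canonical[OF nu])
    have e: "(\<lambda>i. \<alpha> i + (k + Q) * \<nu> i + \<nu> i) = (\<lambda>i. \<alpha> i + (k + Suc Q) * \<nu> i)" by (auto simp: algebra_simps)
    show ?case
      using graded_mult[OF conjunct1[OF Suc.IH] h] semi_invariant_mult[OF conjunct2[OF Suc.IH] bidet_semi_invariant[OF nu, of "canonical \<nu>"]]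
      unfolding e by (simp add: mult_ac add_ac)
  qed
  then show "(\<lambda>A. f A * ?h A ^ Q) \<in> graded n (\<lambda>i. \<alpha> i + (k + Q) * \<nu> i) (D + Q * min_moment n \<nu>)"
      "semi_invariant n (\<lambda>i. \<alpha> i + (k + Q) * \<nu> i) (\<lambda>A. f A * ?h A ^ Q)" by blast+
qed

text \<open>
  The leading principal minors of a lower unitriangular matrix are 1.
\<close>

lemma bidet_canonical_unilower:
  assumes nu: "\<nu> \<in> partitions n"
  shows "bidet \<nu> (canonical \<nu>) (unilower y) = 1"
proof -
  let ?Y = "young_diagram \<nu>"
  have "bidet \<nu> (canonical \<nu>) (unilower y) = (\<Sum>\<sigma>\<in>col_perms \<nu>. if \<sigma> = id then 1 else 0)"
    unfolding bidet_def
  proof (rule sum.cong[OF refl])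
    fix \<sigma> assume s: "\<sigma> \<in> col_perms \<nu>"
    show "of_int (sign \<sigma>) * (\<Prod>b\<in>?Y. unilower y (canonical \<nu> (\<sigma> b), box_row b)) = (if \<sigma> = id then 1 else 0)"
    proof (cases "\<sigma> = id")
      case True
      then show ?thesis by (simp add: canonical_def unilower_def)
    next
      case False
      obtain b where b: "b \<in> ?Y" "box_row (\<sigma> b) < box_row b"
        using column_inversion[OF nu s False] by metis
      then have "unilower y (canonical \<nu> (\<sigma> b), box_row b) = 0"
        using permutes_in_image[OF col_perms_permutes[OF s], of b] by (simp add: canonical_def unilower_def)
      then have "(\<Prod>b\<in>?Y. unilower y (canonical \<nu> (\<sigma> b), box_row b)) = 0"
        using b(1) finite_young_diagram[OF nu] by (meson prod_zero)
      then show ?thesis using False by simp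
    qed
  qed
  also have "\<dots> = 1" using finite_col_perms[OF nu] id_in_col_perms by simp
  finally show ?thesis .
qed

text \<open>
  Restriction to lower unitriangular matrices identifies semi-invariants of the different weights
  \<open>\<mu> + k\<nu>\<close> with polynomials on one and the same space, where they can be
  compared.
\<close>

definition stage :: "nat \<Rightarrow> (nat \<Rightarrow> nat) \<Rightarrow> nat \<Rightarrow> (('k::field entries) \<Rightarrow> 'k) set" where
  "stage n \<alpha> D = fs.span ((\<lambda>T y. bidet \<alpha> T (unilower y)) ` {T \<in> fillings n \<alpha>. moment \<alpha> T = D})"

lemma restricted_semi_invariant_in_stage:
  assumes inf: "infinite (UNIV :: 'k::field set)" and al: "\<alpha> \<in> partitions n"
    and f: "(f :: ('k entries) \<Rightarrow> 'k) \<in> graded n \<alpha> D" "semi_invariant n \<alpha> f"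
  shows "(\<lambda>y. f (unilower y)) \<in> stage n \<alpha> D"
proof -
  obtain S c where S: "S \<subseteq> {T \<in> fillings n \<alpha>. moment \<alpha> T = D}" "f = (\<lambda>A. \<Sum>T\<in>S. c T * bidet \<alpha> T A)"
    by (rule fs_span_image_explicit[OF semi_invariants_spanned_by_bidets[OF inf al f]])
  have "(\<lambda>y. \<Sum>T\<in>S. c T * bidet \<alpha> T (unilower y)) \<in> stage n \<alpha> D"
    unfolding stage_def using S(1) by (intro fs_span_sum fs_span_scale fs.span_base imageI) auto
  then show ?thesis by (simp add: S(2))
qed

lemma stage_mono:
  assumes inf: "infinite (UNIV :: 'k::field set)" and mu: "\<mu> \<in> partitions n" and nu: "\<nu> \<in> partitions n"
  shows "(stage n (\<lambda>i. \<mu> i + k * \<nu> i) D :: (('k entries) \<Rightarrow> 'k) set) \<subseteq>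
    stage n (\<lambda>i. \<mu> i + (k + Q) * \<nu> i) (D + Q * min_moment n \<nu>)"
proof -
  let ?M = "\<lambda>k i. \<mu> i + k * \<nu> i"
  have pM: "?M k \<in> partitions n" for k by (rule partitions_add[OF mu nu])
  show ?thesis
    unfolding stage_def[of n "?M k" D]
  proof (rule fs.span_minimal)
    show "fs.subspace (stage n (?M (k + Q)) (D + Q * min_moment n \<nu>))" by (simp add: stage_def)
    show "(\<lambda>T y. bidet (?M k) T (unilower y)) ` {T \<in> fillings n (?M k). moment (?M k) T = D}
        \<subseteq> (stage n (?M (k + Q)) (D + Q * min_moment n \<nu>) :: (('k entries) \<Rightarrow> 'k) set)"
    proof safe
      fix T assume T: "T \<in> fillings n (?M k)" "D = moment (?M k) T"
      have "(\<lambda>y :: 'k entries. bidet (?M k) T (unilower y) * bidet \<nu> (canonical \<nu>) (unilower y) ^ Q) \<in>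
          stage n (?M (k + Q)) (moment (?M k) T + Q * min_moment n \<nu>)"
        by (rule restricted_semi_invariant_in_stage[OF inf pM
              shift_graded[OF nu bidet_graded[OF pM T(1)] bidet_semi_invariant[OF pM]]])
      then show "(\<lambda>y :: 'k entries. bidet (?M k) T (unilower y)) \<in>
          stage n (?M (k + Q)) (moment (?M k) T + Q * min_moment n \<nu>)"
        by (simp add: bidet_canonical_unilower[OF nu])
    qed
  qed
qed

text \<open>
  On lower unitriangular matrices the weighted degree of a monomial, in which the entry
  \<open>(l, d)\<close> has weight \<open>l - d\<close>, is the excess of the moment over the
  minimal moment.
\<close>

lemma stage_bounded:
  assumes al: "\<alpha> \<in> partitions n" and D: "D \<le> min_moment n \<alpha> + N"
  shows "stage n \<alpha> D \<subseteq> fs.span (mon_fun (cells n) ` {M. (\<forall>v. v \<notin> cells n \<longrightarrow> M v = 0) \<and> (\<forall>v. M v \<le> N)})"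
    (is "_ \<subseteq> fs.span ?E")
  unfolding stage_def
proof (rule fs.span_minimal)
  show "fs.subspace (fs.span ?E)" by simp
  show "(\<lambda>T y. bidet \<alpha> T (unilower y)) ` {T \<in> fillings n \<alpha>. moment \<alpha> T = D} \<subseteq> fs.span ?E"
  proof safe
    fix T assume T: "T \<in> fillings n \<alpha>" "D = moment \<alpha> T"
    have "(\<lambda>y. \<Sum>\<sigma>\<in>col_perms \<alpha>. of_int (sign \<sigma>) * mon_fun (cells n) (expo \<alpha> (T \<circ> \<sigma>)) (unilower y)) \<in> fs.span ?E"
    proof (intro fs_span_sum fs_span_scale)
      fix \<sigma> assume "\<sigma> \<in> col_perms \<alpha>"
      then have p: "\<sigma> permutes young_diagram \<alpha>" by (rule col_perms_permutes)
      define M where "M = expo \<alpha> (T \<circ> \<sigma>)"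
      have M: "M \<in> exponents n \<alpha> D"
        using expo_exponents[OF al, of "T \<circ> \<sigma>"] T
        by (simp add: M_def fillings_comp_permutes[OF p] moment_comp[OF p])
      show "(\<lambda>y. mon_fun (cells n) (expo \<alpha> (T \<circ> \<sigma>)) (unilower y)) \<in> fs.span ?E"
      proof (cases "\<exists>l d. l < d \<and> d < n \<and> M (l, d) \<noteq> 0")
        case True
        then obtain l d where ld: "l < d" "d < n" "M (l, d) \<noteq> 0" by blast
        have "mon_fun (cells n) M (unilower y) = 0" for y :: "nat \<times> nat \<Rightarrow> 'a"
        proof -
          have "unilower y (l, d) ^ M (l, d) = 0" "(l, d) \<in> cells n" using ld by (auto simp: unilower_def)
          then show ?thesis unfolding mon_fun_def by (meson finite_SigmaI finite_lessThan prod_zero)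
        qed
        then show ?thesis by (simp add: M_def fs_span_zero)
      next
        case False
        define M' where "M' = (\<lambda>(l, d). if d < l then M (l, d) else 0)"
        have "mon_fun (cells n) M (unilower y) = mon_fun (cells n) M' y" for y :: "nat \<times> nat \<Rightarrow> 'a"
          unfolding mon_fun_def
        proof (intro prod.cong refl)
          fix v assume v: "v \<in> cells n"
          obtain l d where ld: "v = (l, d)" by (cases v)
          then have "l < d \<Longrightarrow> M (l, d) = 0" using False v by auto
          then show "unilower y v ^ M v = y v ^ M' v"
            by (auto simp: ld unilower_def M'_def not_less_iff_gr_or_eq)
        qed
        moreover have "M' v \<le> N" for v
        proof -
          have "(\<Sum>(l, d)\<in>cells n. d * M (l, d)) = (\<Sum>l<n. \<Sum>d<n. d * M (l, d))"
            by (simp add: sum.cartesian_product)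
          also have "\<dots> = (\<Sum>d<n. \<Sum>l<n. d * M (l, d))" by (rule sum.swap)
          also have "\<dots> = min_moment n \<alpha>"
            using M by (auto simp: min_moment_def exponents_def sum_distrib_left[symmetric] intro!: sum.cong)
          finally have 1: "(\<Sum>(l, d)\<in>cells n. d * M (l, d)) = min_moment n \<alpha>" .
          have "min_moment n \<alpha> + (\<Sum>v\<in>cells n. M' v) \<le> (\<Sum>v\<in>cells n. (case v of (l, d) \<Rightarrow> l * M (l, d)))"
            unfolding 1[symmetric] sum.distrib[symmetric]
          proof (rule sum_mono)
            fix v assume v: "v \<in> cells n"
            obtain l d where ld: "v = (l, d)" by (cases v)
            show "(case v of (l, d) \<Rightarrow> d * M (l, d)) + M' v \<le> (case v of (l, d) \<Rightarrow> l * M (l, d))"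
            proof (cases "d < l")
              case True
              then obtain t where "l = Suc (d + t)" using less_iff_Suc_add by auto
              then show ?thesis by (simp add: ld M'_def algebra_simps)
            next
              case False': False
              then have "l = d \<or> M (l, d) = 0" using False v ld by (cases "l < d") auto
              then show ?thesis using False' by (auto simp: ld M'_def)
            qed
          qed
          also have "\<dots> = D" using M by (simp add: exponents_def)
          finally have s: "(\<Sum>v\<in>cells n. M' v) \<le> N" using D by simp
          show ?thesis
          proof (cases "v \<in> cells n")
            case True
            then have "M' v \<le> (\<Sum>v\<in>cells n. M' v)" by (intro member_le_sum) auto
            then show ?thesis using s by simp
          next
            case False
            then show ?thesis using exponents_outside[OF M, of v] by (cases v) (simp add: M'_def)
          qed
        qed
        moreover have "M' v = 0" if "v \<notin> cells n" for v
          using exponents_outside[OF M that] by (cases v) (simp add: M'_def)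
        ultimately show ?thesis
          by (simp add: M_def[symmetric]) (intro fs.span_base imageI CollectI conjI allI impI; blast)
      qed
    qed
    then show "(\<lambda>y. bidet \<alpha> T (unilower y)) \<in> fs.span ?E" by (simp add: bidet_eq_sum_mon[OF al T(1)])
  qed
qed

section \<open>Stabilization\<close>

lemma finite_bounded_exponents:
  assumes "finite I"
  shows "finite {M :: 'v \<Rightarrow> nat. (\<forall>v. v \<notin> I \<longrightarrow> M v = 0) \<and> (\<forall>v. M v \<le> N)}"
proof (rule finite_subset)
  let ?r = "\<lambda>M v. if v \<in> I then M v else (0 :: nat)"
  show "finite (?r ` (PiE I (\<lambda>_. {..N})))" using assms by (intro finite_imageI finite_PiE) auto
  show "{M :: 'v \<Rightarrow> nat. (\<forall>v. v \<notin> I \<longrightarrow> M v = 0) \<and> (\<forall>v. M v \<le> N)} \<subseteq> ?r ` (PiE I (\<lambda>_. {..N}))"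
  proof
    fix M :: "'v \<Rightarrow> nat" assume M: "M \<in> {M. (\<forall>v. v \<notin> I \<longrightarrow> M v = 0) \<and> (\<forall>v. M v \<le> N)}"
    then have "M = ?r (restrict M I)" by auto
    then show "M \<in> ?r ` (PiE I (\<lambda>_. {..N}))" using M by (intro image_eqI[of _ _ "restrict M I"]) auto
  qed
qed

text \<open>
  An independent set of the greatest size that occurs in any member of the chain spans all later
  members.
\<close>

lemma bounded_chain_stabilizes:
  fixes X :: "nat \<Rightarrow> ('a \<Rightarrow> 'k::field) set"
  assumes sub: "\<And>k. fs.subspace (X k)" and mono: "\<And>j k. j \<le> k \<Longrightarrow> X j \<subseteq> X k"
    and E: "finite E" "\<And>k. X k \<subseteq> fs.span E"
  shows "\<exists>k0. \<forall>k\<ge>k0. X k \<subseteq> X k0"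
proof -
  define P where "P c \<longleftrightarrow> (\<exists>B k. B \<subseteq> X k \<and> fs.independent B \<and> card B = c)" for c
  have bound: "finite B \<and> card B \<le> card E" if "B \<subseteq> X k" "fs.independent B" for B k
    using fs.independent_span_bound[OF E(1) that(2)] that(1) E(2)[of k] by auto
  have "P 0" using fs.independent_empty by (auto simp: P_def intro!: exI[of _ "{}"])
  moreover have "\<forall>c. P c \<longrightarrow> c \<le> card E" using bound by (auto simp: P_def)
  ultimately obtain c where c: "P c" "\<And>c'. P c' \<Longrightarrow> c' \<le> c"
    by (metis GreatestI_nat Greatest_le_nat)
  then obtain B k0 where B: "B \<subseteq> X k0" "fs.independent B" "card B = c" by (auto simp: P_def)
  have "X k \<subseteq> X k0" if k: "k0 \<le> k" for k
  proof
    fix x assume x: "x \<in> X k"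
    have "x \<in> fs.span B"
    proof (rule ccontr)
      assume nx: "x \<notin> fs.span B"
      then have "fs.independent (insert x B)" using B(2) by (rule fs.independent_insertI)
      moreover have "insert x B \<subseteq> X k" using x B(1) mono[OF k] by auto
      ultimately have "P (card (insert x B))" unfolding P_def by blast
      moreover have "card (insert x B) = Suc c"
        using bound[OF B(1,2)] nx fs.span_superset[of B] B(3) by (subst card_insert_disjoint) auto
      ultimately show False using c(2) by fastforce
    qed
    then show "x \<in> X k0" using fs.span_minimal[OF B(1) sub] by auto
  qed
  then show ?thesis by blast
qed

text \<open>
  The map \<open>?R\<close> in the proof sends \<open>A v\<close> to
  \<open>h(A)\<^sup>Q A v'\<close>, where \<open>h\<close> is the highest weight coefficient of
  \<open>\<Delta>(\<nu>)\<close> and \<open>v\<close>, \<open>v'\<close> are the highest weight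
  vectors for the weights \<open>\<mu> + (k + Q)\<nu>\<close> and \<open>\<mu> + k\<nu>\<close>.
  On primitive vectors it commutes with upper triangular matrices up to the expected scalar,
  because the defect given by \<open>twist_filtered\<close> lives in moments that a primitive
  vector does not have. It is injective on them, because by stability each coefficient that can be
  nonzero on a primitive vector is \<open>h\<^sup>Q\<close> times a semi-invariant of weight
  \<open>\<mu> + k\<nu>\<close>, and so is a combination of coefficients of the image.
\<close>

theorem dim_primitive_decreasing:
  assumes inf: "infinite (UNIV :: 'k::field set)" and p: "prime CHAR('k)" and q: "q = CHAR('k) ^ a"
    and la: "\<kappa> \<in> partitions n" and mu: "\<mu> \<in> partitions n" and nu: "\<nu> \<in> partitions n"
    and big: "min_moment n \<kappa> < q" and Q: "Q = q * m"
    and stable: "(stage n (\<lambda>i. \<mu> i + (k + Q) * \<nu> i) (min_moment n (\<lambda>i. \<kappa> i + (k + Q) * \<nu> i)) :: (('k entries) \<Rightarrow> 'k) set)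
      \<subseteq> stage n (\<lambda>i. \<mu> i + k * \<nu> i) (min_moment n (\<lambda>i. \<kappa> i + k * \<nu> i))"
  shows "fs.dim (primitive n (\<lambda>i. \<kappa> i + (k + Q) * \<nu> i) (\<lambda>i. \<mu> i + (k + Q) * \<nu> i) :: 'k tensor set)
    \<le> fs.dim (primitive n (\<lambda>i. \<kappa> i + k * \<nu> i) (\<lambda>i. \<mu> i + k * \<nu> i) :: 'k tensor set)"
proof -
  define L where "L k = (\<lambda>i. \<kappa> i + k * \<nu> i)" for k
  define M where "M k = (\<lambda>i. \<mu> i + k * \<nu> i)" for k
  let ?k = "k + Q"
  have pL: "L j \<in> partitions n" and pM: "M j \<in> partitions n" for j
    by (simp_all add: L_def M_def partitions_add la mu nu)
  have mL: "min_moment n (L ?k) = min_moment n (L k) + Q * min_moment n \<nu>"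
    unfolding L_def min_moment_add by (simp add: algebra_simps)
  let ?h = "bidet \<nu> (canonical \<nu>) :: ('k entries) \<Rightarrow> 'k"
  have "\<exists>r. \<forall>A. linear_between n (M ?k) (M k) r (mat_act n (M ?k) A (hw_vector (M ?k))) =
      (\<lambda>T. if T \<in> fillings n (M k) then bidet (M k) T A * ?h A ^ Q else 0)"
  proof (rule induced_map[OF inf pM, where G = "\<lambda>T A. bidet (M k) T A * ?h A ^ Q"
        and D = "\<lambda>T. moment (M k) T + Q * min_moment n \<nu>"])
    fix T assume T: "T \<in> fillings n (M k)"
    note b = bidet_graded[OF pM T] bidet_semi_invariant[OF pM, of k T]
    show "(\<lambda>A. bidet (M k) T A * ?h A ^ Q) \<in> graded n (M ?k) (moment (M k) T + Q * min_moment n \<nu>)"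
      using shift_graded(1)[OF nu b[unfolded M_def]] by (simp add: M_def)
    show "semi_invariant n (M ?k) (\<lambda>A. bidet (M k) T A * ?h A ^ Q)"
      using shift_graded(2)[OF nu b[unfolded M_def]] by (simp add: M_def)
  qed
  then obtain r where r0: "\<And>A. linear_between n (M ?k) (M k) r (mat_act n (M ?k) A (hw_vector (M ?k))) =
      (\<lambda>T. if T \<in> fillings n (M k) then bidet (M k) T A * ?h A ^ Q else 0)" by blast
  let ?R = "linear_between n (M ?k) (M k) r"
  have r: "?R (mat_act n (M ?k) A (hw_vector (M ?k))) = (\<lambda>T. ?h A ^ Q * mat_act n (M k) A (hw_vector (M k)) T)" for A
    unfolding r0 by (auto simp: mat_act_hw_vector[OF pM])
  have W: "weyl_module n (M k) = (fs.span (orbit n (M k)) :: 'k tensor set)" by (rule weyl_module_eq_span_orbit[OF inf pM])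
  have Rweyl: "?R x \<in> weyl_module n (M k)" if "x \<in> weyl_module n (M ?k)" for x
  proof (rule weyl_module_induct[OF inf pM that])
    show "?R (mat_act n (M ?k) A (hw_vector (M ?k))) \<in> weyl_module n (M k)" if "nonsingular n A" for A
      unfolding r using weyl_module_mat_act[OF inf pM that hw_vector_in_weyl_module[OF inf pM], of k]
      by (simp add: W fs_span_scale)
  qed (simp_all add: linear_between_simps W fs_span_zero fs_span_add fs_span_scale)
  have moment_w: "moment (M j) T = min_moment n (L j)"
    if "(w :: 'k tensor) \<in> primitive n (L j) (M j)" "T \<in> fillings n (M j)" "w T \<noteq> 0" for w T j
    by (rule primitive_moment[OF inf pM that])
  have twist: "?R (mat_act n (M ?k) B w) = (\<lambda>T. chi n \<nu> B ^ Q * mat_act n (M k) B (?R w) T)"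
    if w: "w \<in> primitive n (L ?k) (M ?k)" and B: "borel n B" for w B
  proof
    fix T
    show "?R (mat_act n (M ?k) B w) T = chi n \<nu> B ^ Q * mat_act n (M k) B (?R w) T"
    proof (cases "T \<in> fillings n (M k)")
      case False
      then show ?thesis by (simp add: linear_between_def mat_act_def)
    next
      case T: True
      have e: "(\<lambda>i. M k i + q * m * \<nu> i) = M ?k" by (auto simp: M_def Q algebra_simps)
      have "(\<lambda>A. (?h (mat_mult n B A) ^ (q * m) - (chi n \<nu> B * ?h A) ^ (q * m)) * bidet (M k) T (mat_mult n B A))
          \<in> filtered n (M ?k) (min_moment n (M ?k) + q)"
        using twist_filtered[OF inf p q pM nu B T, of m] unfolding e .
      then obtain z where z: "(\<lambda>A. (?h (mat_mult n B A) ^ (q * m) - (chi n \<nu> B * ?h A) ^ (q * m)) * bidet (M k) T (mat_mult n B A))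
          = (\<lambda>A. \<Sum>T'\<in>fillings n (M ?k). z T' * bidet (M ?k) T' A)"
        and z0: "\<And>T'. \<not> min_moment n (M ?k) + q \<le> moment (M ?k) T' \<Longrightarrow> z T' = 0"
        unfolding filtered_def by (rule span_bidet_coefficients[OF pM]) blast
      have "?R (mat_act n (M ?k) B x) T - chi n \<nu> B ^ Q * mat_act n (M k) B (?R x) T =
          (\<Sum>T'\<in>fillings n (M ?k). z T' * x T')" if "x \<in> weyl_module n (M ?k)" for x
      proof (rule weyl_module_induct[OF inf pM that])
        fix A :: "'k entries"
        have "?R (mat_act n (M ?k) B (mat_act n (M ?k) A (hw_vector (M ?k)))) T =
            bidet (M k) T (mat_mult n B A) * ?h (mat_mult n B A) ^ Q"
          using T by (simp add: mat_act_mat_act[OF pM] r0)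
        moreover have "mat_act n (M k) B (?R (mat_act n (M ?k) A (hw_vector (M ?k)))) T =
            ?h A ^ Q * bidet (M k) T (mat_mult n B A)"
          unfolding r mat_act_scale mat_act_mat_act[OF pM] using T by (simp add: mat_act_hw_vector[OF pM])
        ultimately have "?R (mat_act n (M ?k) B (mat_act n (M ?k) A (hw_vector (M ?k)))) T
            - chi n \<nu> B ^ Q * mat_act n (M k) B (?R (mat_act n (M ?k) A (hw_vector (M ?k)))) T =
          (?h (mat_mult n B A) ^ (q * m) - (chi n \<nu> B * ?h A) ^ (q * m)) * bidet (M k) T (mat_mult n B A)"
          unfolding Q[symmetric] by (simp add: power_mult_distrib algebra_simps)
        also have "\<dots> = (\<Sum>T'\<in>fillings n (M ?k). z T' * bidet (M ?k) T' A)"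
          using fun_cong[OF z, of A] by simp
        finally show "?R (mat_act n (M ?k) B (mat_act n (M ?k) A (hw_vector (M ?k)))) T
            - chi n \<nu> B ^ Q * mat_act n (M k) B (?R (mat_act n (M ?k) A (hw_vector (M ?k)))) T =
          (\<Sum>T'\<in>fillings n (M ?k). z T' * mat_act n (M ?k) A (hw_vector (M ?k)) T')"
          by (simp add: mat_act_hw_vector[OF pM])
      qed (simp_all add: linear_between_simps mat_act_add mat_act_scale mat_act_zero algebra_simps sum.distrib sum_distrib_left)
      from this[of w] have "?R (mat_act n (M ?k) B w) T - chi n \<nu> B ^ Q * mat_act n (M k) B (?R w) T =
          (\<Sum>T'\<in>fillings n (M ?k). z T' * w T')" using w by (simp add: primitive_def)
      also have "\<dots> = 0"
      proof (rule sum.neutral, rule ballI)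
        fix T' assume T': "T' \<in> fillings n (M ?k)"
        have "z T' = 0" if "w T' \<noteq> 0"
        proof (rule z0)
          have "min_moment n (L ?k) < min_moment n (M ?k) + q"
            using big by (simp add: L_def M_def min_moment_add)
          then show "\<not> min_moment n (M ?k) + q \<le> moment (M ?k) T'" using moment_w[OF w T' that] by simp
        qed
        then show "z T' * w T' = 0" by auto
      qed
      finally show ?thesis by simp
    qed
  qed
  have Rprim: "?R w \<in> primitive n (L k) (M k)" if w: "w \<in> primitive n (L ?k) (M ?k)" for w
  proof -
    have "mat_act n (M k) B (?R w) = (\<lambda>T. chi n (L k) B * ?R w T)" if B: "borel n B" for B
    proof
      fix T
      have nz: "chi n \<nu> B \<noteq> 0" using B by (auto simp: chi_def borel_def)
      have c: "chi n (L ?k) B = chi n (L k) B * chi n \<nu> B ^ Q"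
        unfolding L_def chi_add by (simp add: power_add)
      have "chi n \<nu> B ^ Q * mat_act n (M k) B (?R w) T = ?R (mat_act n (M ?k) B w) T"
        using twist[OF w B] by simp
      also have "mat_act n (M ?k) B w = (\<lambda>T. chi n (L ?k) B * w T)" using w B by (simp add: primitive_def)
      also have "?R (\<lambda>T. chi n (L ?k) B * w T) T = chi n \<nu> B ^ Q * (chi n (L k) B * ?R w T)"
        unfolding linear_between_simps(3) c by (simp add: mult_ac)
      finally show "mat_act n (M k) B (?R w) T = chi n (L k) B * ?R w T" using nz by simp
    qed
    then show ?thesis using Rweyl w by (simp add: primitive_def)
  qed
  have Rinj: "w = 0" if w: "w \<in> primitive n (L ?k) (M ?k)" and R0: "?R w = 0" for w
  proof
    fix T'
    show "w T' = 0 T'"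
    proof (rule ccontr)
      assume nz: "w T' \<noteq> 0 T'"
      have ww: "w \<in> weyl_module n (M ?k)" using w by (simp add: primitive_def)
      then have T': "T' \<in> fillings n (M ?k)"
        using nz weyl_module_subset_tensors[OF inf pM, of ?k] by (auto simp: tensors_def)
      have mT': "moment (M ?k) T' = min_moment n (L ?k)" using moment_w[OF w T'] nz by simp
      have "(\<lambda>y :: 'k entries. bidet (M ?k) T' (unilower y)) \<in> stage n (M ?k) (min_moment n (L ?k))"
        unfolding stage_def using T' mT' by (intro fs.span_base) auto
      then have "(\<lambda>y :: 'k entries. bidet (M ?k) T' (unilower y)) \<in> stage n (M k) (min_moment n (L k))"
        using stable by (auto simp: L_def M_def)
      then obtain S c where S: "finite S" "S \<subseteq> {T \<in> fillings n (M k). moment (M k) T = min_moment n (L k)}"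
        and cS: "(\<lambda>y :: 'k entries. bidet (M ?k) T' (unilower y)) = (\<lambda>y. \<Sum>T\<in>S. c T * bidet (M k) T (unilower y))"
        unfolding stage_def by (rule fs_span_image_explicit)
      define f where "f A = (\<Sum>T\<in>S. c T * bidet (M k) T A)" for A :: "'k entries"
      have f: "f \<in> graded n (M k) (min_moment n (L k))" "semi_invariant n (M k) f"
      proof -
        have "bidet (M k) T \<in> graded n (M k) (min_moment n (L k))" if "T \<in> S" for T
          using bidet_graded[OF pM, of T k] that S(2) by auto
        then show "f \<in> graded n (M k) (min_moment n (L k))"
          unfolding f_def by (intro fs_span_sum fs_span_scale)
        show "semi_invariant n (M k) f"
          by (simp add: semi_invariant_def f_def bidet_mat_mult_borel[OF pM] sum_distrib_left mult_ac)
      qed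
      have fh: "(\<lambda>A. f A * ?h A ^ Q) \<in> graded n (M ?k) (min_moment n (L ?k))"
        "semi_invariant n (M ?k) (\<lambda>A. f A * ?h A ^ Q)"
        using shift_graded[OF nu f[unfolded M_def], of Q] unfolding mL by (simp_all add: M_def)
      have bT': "bidet (M ?k) T' \<in> graded n (M ?k) (min_moment n (L ?k))" "semi_invariant n (M ?k) (bidet (M ?k) T')"
        using bidet_graded[OF pM T'] bidet_semi_invariant[OF pM] by (auto simp: mT')
      have "bidet (M ?k) T' A - f A * ?h A ^ Q = 0" for A
      proof (rule semi_invariant_zero_if_zero_on_unilower[OF inf, where f = "\<lambda>A. bidet (M ?k) T' A - f A * ?h A ^ Q"])
        show "(\<lambda>A. bidet (M ?k) T' A - f A * ?h A ^ Q) \<in> graded n (M ?k) (min_moment n (L ?k))"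
          by (rule fs_span_diff[OF bT'(1) fh(1)])
        show "semi_invariant n (M ?k) (\<lambda>A. bidet (M ?k) T' A - f A * ?h A ^ Q)"
          using bT'(2) fh(2) by (simp add: semi_invariant_def right_diff_distrib)
        show "bidet (M ?k) T' (unilower y) - f (unilower y) * ?h (unilower y) ^ Q = 0" for y
          using fun_cong[OF cS, of y] by (simp add: f_def bidet_canonical_unilower[OF nu])
      qed
      then have b: "bidet (M ?k) T' A = (\<Sum>T\<in>S. c T * (bidet (M k) T A * ?h A ^ Q))" for A
        by (simp add: f_def sum_distrib_right mult.assoc)
      have "x T' = (\<Sum>T\<in>S. c T * ?R x T)" if "x \<in> weyl_module n (M ?k)" for x
      proof (rule weyl_module_induct[OF inf pM that])
        fix A :: "'k entries"
        show "mat_act n (M ?k) A (hw_vector (M ?k)) T' = (\<Sum>T\<in>S. c T * ?R (mat_act n (M ?k) A (hw_vector (M ?k))) T)"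
          unfolding r0 using T' S(2) b[of A] by (auto simp: mat_act_hw_vector[OF pM] intro!: sum.cong)
      qed (simp_all add: linear_between_simps algebra_simps sum.distrib sum_distrib_left)
      from this[OF ww] show False using nz R0 by simp
    qed
  qed
  obtain E where E: "finite E" "(primitive n (L k) (M k) :: 'k tensor set) \<subseteq> fs.span E"
    using primitive_finite_dimensional[OF inf pM] by blast
  have vs: "vector_space (fun_scale :: 'k \<Rightarrow> 'k tensor \<Rightarrow> _)" by unfold_locales
  have "fs.dim (primitive n (L ?k) (M ?k) :: 'k tensor set) \<le> fs.dim (primitive n (L k) (M k) :: 'k tensor set)"
  proof (rule dim_le_of_injective(1)[OF vs vs primitive_subspace[OF inf pM] _ _ Rinj Rprim E])
    fix x y :: "'k tensor"
    show "?R (x + y) = ?R x + ?R y" using linear_between_simps(2)[of n "M ?k" "M k" r x y] by (simp add: plus_fun_def)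
  next
    fix c and x :: "'k tensor"
    show "?R (fun_scale c x) = fun_scale c (?R x)" by (simp add: fun_scale_def linear_between_simps)
  qed
  then show ?thesis by (simp add: L_def M_def)
qed

lemma eventually_decreasing_stabilizes:
  fixes d :: "nat \<Rightarrow> nat"
  assumes "\<And>a. a0 \<le> a \<Longrightarrow> d (Suc a) \<le> d a"
  shows "\<exists>c. \<forall>\<^sub>F a in sequentially. d a = c"
proof -
  obtain a1 where a1: "a0 \<le> a1" "\<And>a. a0 \<le> a \<Longrightarrow> d a1 \<le> d a"
    using ex_has_least_nat[of "\<lambda>a. a0 \<le> a" a0 d] by auto
  have "d a \<le> d a1" if "a1 \<le> a" for a
    using that
  proof (induction rule: dec_induct)
    case (step a)
    then show ?case using assms[of a] a1(1) by linarith
  qed simp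
  then have "d a = d a1" if "a1 \<le> a" for a
    using that a1(2)[of a] a1(1) by (meson le_antisym order.trans)
  then show ?thesis by (auto simp: eventually_sequentially)
qed

theorem corollary4p5:
  fixes n r p g m :: nat and lam \<mu> \<nu> :: "nat \<Rightarrow> nat" and d :: "nat \<Rightarrow> nat"
  assumes "infinite (UNIV :: 'k::field set)" and "CHAR('k) = p" and "p > 0"
    and "r > 0"
    and "lam \<in> partitions_of n r" and "\<mu> \<in> partitions_of n r" and "\<nu> \<in> partitions n"
    and "g = num_parts \<nu>" and "g \<ge> 1" and "m = num_parts \<mu>"
    and "lam \<in> P_set n r \<mu>" and "\<mu> \<in> partitions_g n g" and "g < m"
    and "\<And>k. d k = vector_space.dim map_scale
           (weyl_Hom n (\<lambda>i. lam i + k * \<nu> i) (\<lambda>i. \<mu> i + k * \<nu> i) :: 'k tensor_map set)"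
  shows "\<exists>c. \<forall>\<^sub>F a in sequentially. d (p ^ a) = c"
proof -
  note inf = assms(1) and nu = assms(7)
  have la: "lam \<in> partitions n" and mu: "\<mu> \<in> partitions n" using assms(5,6) by (simp_all add: partitions_of_def)
  let ?L = "\<lambda>k i. lam i + k * \<nu> i" and ?M = "\<lambda>k i. \<mu> i + k * \<nu> i"
  have p: "prime CHAR('k)" using assms(2,3) prime_CHAR_semidom by auto
  have d: "d k = fs.dim (primitive n (?L k) (?M k) :: 'k tensor set)" for k
    unfolding assms(14) by (rule dim_weyl_Hom_eq_dim_primitive[OF inf]) (simp_all add: partitions_add la mu nu)
  define X :: "nat \<Rightarrow> (('k entries) \<Rightarrow> 'k) set" where "X k = stage n (?M k) (min_moment n (?L k))" for k
  have "\<exists>k0. \<forall>k\<ge>k0. X k \<subseteq> X k0"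
  proof (rule bounded_chain_stabilizes)
    show "fs.subspace (X k)" for k by (simp add: X_def stage_def)
    show "X j \<subseteq> X k" if "j \<le> k" for j k
      using stage_mono[OF inf mu nu, of j "min_moment n (?L j)" "k - j"] that
      by (simp add: X_def min_moment_add add_mult_distrib[symmetric] add.assoc)
    let ?E = "mon_fun (cells n) ` {M. (\<forall>v. v \<notin> cells n \<longrightarrow> M v = 0) \<and> (\<forall>v. M v \<le> min_moment n lam)}"
    show "finite (?E :: (('k entries) \<Rightarrow> 'k) set)"
      by (intro finite_imageI finite_bounded_exponents) auto
    show "X k \<subseteq> fs.span ?E" for k
      unfolding X_def
      by (rule stage_bounded) (simp_all add: partitions_add mu nu min_moment_add)
  qed
  then obtain k0 where k0: "\<And>k. k0 \<le> k \<Longrightarrow> X k \<subseteq> X k0" by blast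
  have X_mono: "X k0 \<subseteq> X k" if "k0 \<le> k" for k
    using stage_mono[OF inf mu nu, of k0 "min_moment n (?L k0)" "k - k0"] that
    by (simp add: X_def min_moment_add add_mult_distrib[symmetric] add.assoc)
  have "d (p ^ Suc a) \<le> d (p ^ a)" if a: "max k0 (min_moment n lam) \<le> a" for a
  proof -
    have p2: "2 \<le> p" using p assms(2) prime_ge_2_nat by blast
    \<comment> \<open>\<open>p ^ a\<close> has to exceed both \<open>k0\<close> and the bound on the moments\<close>
    have "a < 2 ^ a" by (rule less_exp)
    also have "(2 :: nat) ^ a \<le> p ^ a" using p2 by (intro power_mono) auto
    finally have pa: "a < p ^ a" .
    define Q where "Q = p ^ a * (p - 1)"
    have Suc: "p ^ Suc a = p ^ a + Q" using p2 by (cases p) (auto simp: Q_def algebra_simps)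
    have "X (p ^ a + Q) \<subseteq> X k0" "X k0 \<subseteq> X (p ^ a)" using k0 X_mono a pa by auto
    then have stable: "X (p ^ a + Q) \<subseteq> X (p ^ a)" by blast
    have "d (p ^ a + Q) \<le> d (p ^ a)"
      unfolding d
      by (rule dim_primitive_decreasing[OF inf p _ la mu nu _ Q_def stable[unfolded X_def]])
        (use a pa assms(2) in auto)
    then show ?thesis unfolding Suc .
  qed
  then show ?thesis by (rule eventually_decreasing_stabilizes)
qed

end
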